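(* For a positive integer $N$ and a real number $k>0$ define the pseudomoment \[\mathcal{M}_k(N)=\lim_{T\to\infty}\frac{1}{T}\int_0^T\Big|\sum_{n=1}^N n^{-1/2-it}\Big|^{2k}\,dt .\] There exist constants $c>0$, $C_1>0$ such that the following hold as $N\to\infty$, where the implied constants in the $O(k^2)$ terms are absolute. (i) Uniformly for real $2\le k\le c\sqrt{\log\log N}$, \[\frac{\mathcal{M}_k(N)}{(\log N)^{k^2}}\ \ge\ \exp\big(-k^2\log k-k^2\log\log k+O(k^2)\big).\] (ii) Uniformly for real $2\le k\le C_1\log N/\log\log N$, \[\frac{\mathcal{M}_k(N)}{(\log N)^{k^2}}\ \le\ \exp\big(-k^2\log k-k^2\log\log k+O(k^2)\big).\] (iii) The upper bound in (ii) does not hold for $k=C_2\log N/\log\log N$, when $C_2$ is a sufficiently large constant (depending on the implied constant in the $O(k^2)$ term).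
   Context: Here $\log$ is the natural logarithm; $N$ and $k$ are assumed large enough that all iterated logarithms appearing are positive. *)

theory Defs
  imports "HOL-Analysis.Analysis"
begin

definition dirpoly :: "nat \<Rightarrow> real \<Rightarrow> complex" where
  "dirpoly N t = (\<Sum>n=1..N. (of_nat n :: complex) powr (-(1/2 + \<i> * of_real t)))"

definition pseudomoment :: "real \<Rightarrow> nat \<Rightarrow> real" where
  "pseudomoment k N =
     Lim at_top (\<lambda>T::real. (1 / T) * integral {0..T} (\<lambda>t. (cmod (dirpoly N t)) powr (2 * k)))"

end

theory Submission
  imports Defs
begin

text \<open>
  By unique factorization, long-time averages treat the functions \<open>z\<^sub>p = p\<^bsup>-it\<^esup>\<close> as
  independent random variables. Write \<open>E\<close> for such an average and \<open>P\<close> for the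
  Dirichlet polynomial.

  Lower bound: by Young's inequality it suffices to bound \<open>E (P G)\<close> from below, where
  \<open>G = exp ((k - 1) X + k cnj X)\<close> and \<open>X\<close> is the sum of \<open>p\<^bsup>-1/2\<^esup> z\<^sub>p\<close> over \<open>p \<le> N\<^bsup>1/(5k)\<^esup>\<close>.
  All Fourier coefficients are nonnegative, the cutoff \<open>n \<le> N\<close> is harmless by Rankin's trick, and
  without it \<open>E (P G)\<close> dominates \<open>E \<bar>exp X\<bar>\<^bsup>2k\<^esup>\<close>, a product of Bessel functions.

  Upper bound: up to a factor \<open>n\<^bsup>s\<^esup>\<close> with \<open>s = k / ln N\<close>, removed by Abel summation at the cost of
  \<open>exp (O(k\<^sup>2))\<close>, \<open>P\<close> is the projection of an Euler product to an interval of frequencies. Such projections are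
  bounded on \<open>L\<^bsup>2k\<^esup>\<close> with norm \<open>exp (O(k))\<close>: for even exponents by a pointwise inequality,
  for real ones by Marcinkiewicz interpolation. The moment of the Euler product is computed prime by prime.

  Failure for large \<open>k\<close>: there the claimed bound drops below \<open>1\<close>, but the pseudomoment is at least \<open>1\<close>.
\<close>

section \<open>Mean values and almost periodic functions\<close>

text \<open>For general real \<open>k\<close> the function
  \<open>norm (dirpoly N t) powr (2 * k)\<close> is no trigonometric polynomial, so even the
  existence of the limit in \<open>pseudomoment\<close> needs an argument. The proof works with
  uniform limits of trigonometric polynomials and records which coefficients and frequencies occur:
  nonnegative coefficients give nonnegative means, disjoint sets of primes give independence, half
  lines of frequencies give the projections. The shape of the bound is the sum of k^2/p over k^2 < p
  <= N^(1/k), which is k^2 (ln ln N - ln k - ln ln k + O(1)) by Mertens. Primes below about k^2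
  contribute only exp(O(k^2)); the lower bound drops their factors, which are at least 1. The upper
  end N^(1/k) is an explicit cutoff in the lower bound and the effect of the weight n^(-s) in the
  upper bound. Since every loss of size exp(O(k^2)) is allowed, crude constants suffice in the
  projection theorem and in the prime sums.\<close>

definition has_mean :: "(real \<Rightarrow> 'a::euclidean_space) \<Rightarrow> 'a \<Rightarrow> bool" where
  "has_mean f m \<longleftrightarrow> continuous_on UNIV f \<and> ((\<lambda>T. (1 / T) *\<^sub>R integral {0..T} f) \<longlongrightarrow> m) at_top"

text \<open>\<open>Lim\<close> is total, so \<open>mean f\<close> carries information only together
  with \<open>has_mean f m\<close> for some \<open>m\<close>. Continuity is part of
  \<open>has_mean\<close> so that every integral over \<open>{0..T}\<close> exists.\<close>

definition mean :: "(real \<Rightarrow> 'a::euclidean_space) \<Rightarrow> 'a" where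
  "mean f = Lim at_top (\<lambda>T. (1 / T) *\<^sub>R integral {0..T} f)"

lemma has_mean_imp_mean: "has_mean f m \<Longrightarrow> mean f = m"
  unfolding has_mean_def mean_def by (auto intro: tendsto_Lim)

lemma continuous_integrable_interval:
  fixes f :: "real \<Rightarrow> 'a::euclidean_space"
  shows "continuous_on UNIV f \<Longrightarrow> f integrable_on {a..b}"
  by (meson continuous_on_subset integrable_continuous_real subset_UNIV)

lemma has_mean_const: "has_mean (\<lambda>t. c) c"
proof -
  have "((\<lambda>T::real. (1 / T) *\<^sub>R integral {0..T} (\<lambda>t. c)) \<longlongrightarrow> c) at_top \<longleftrightarrow> ((\<lambda>T::real. c) \<longlongrightarrow> c) at_top"
  proof (rule tendsto_cong)
    show "\<forall>\<^sub>F T::real in at_top. (1 / T) *\<^sub>R integral {0..T} (\<lambda>t. c) = c"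
      using eventually_gt_at_top[of 0] by eventually_elim simp
  qed
  then show ?thesis
    by (simp add: has_mean_def)
qed

lemma has_mean_add:
  assumes "has_mean f a" "has_mean g b"
  shows "has_mean (\<lambda>t. f t + g t) (a + b)"
proof -
  have "((\<lambda>T. (1 / T) *\<^sub>R integral {0..T} f + (1 / T) *\<^sub>R integral {0..T} g) \<longlongrightarrow> a + b) at_top"
    using assms by (auto simp: has_mean_def intro: tendsto_add)
  moreover have "integral {0..T} (\<lambda>t. f t + g t) = integral {0..T} f + integral {0..T} g" for T
    by (intro integral_add continuous_integrable_interval) (use assms in \<open>auto simp: has_mean_def\<close>)
  ultimately show ?thesis
    using assms by (auto simp: has_mean_def scaleR_add_right intro: continuous_on_add)
qed

lemma has_mean_linear:
  assumes "has_mean f a" "bounded_linear h"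
  shows "has_mean (\<lambda>t. h (f t)) (h a)"
proof -
  interpret h: bounded_linear h by fact
  have "((\<lambda>T. h ((1 / T) *\<^sub>R integral {0..T} f)) \<longlongrightarrow> h a) at_top"
    using assms by (auto simp: has_mean_def intro: h.tendsto)
  moreover have "integral {0..T} (\<lambda>t. h (f t)) = h (integral {0..T} f)" for T
    using integral_linear[OF continuous_integrable_interval assms(2), of f 0 T] assms
    by (auto simp: has_mean_def o_def)
  ultimately show ?thesis
    using assms by (auto simp: has_mean_def h.scaleR intro: h.continuous_on)
qed

lemma has_mean_cmult:
  fixes f :: "real \<Rightarrow> 'a::{euclidean_space, real_normed_algebra}"
  shows "has_mean f a \<Longrightarrow> has_mean (\<lambda>t. c * f t) (c * a)"
  by (rule has_mean_linear) (auto intro: bounded_linear_mult_right)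

lemma average_norm_le:
  fixes f :: "real \<Rightarrow> 'a::euclidean_space"
  assumes "continuous_on UNIV f" "\<And>t. norm (f t) \<le> e" "T > 0"
  shows "norm ((1 / T) *\<^sub>R integral {0..T} f) \<le> e"
proof -
  have "norm (integral {0..T} f) \<le> e * (T - 0)"
    using assms by (intro integral_bound continuous_on_subset[OF assms(1)]) auto
  then show ?thesis
    using assms(3) by (simp add: divide_simps mult.commute)
qed

lemma has_mean_norm_le:
  assumes "has_mean f a" "\<And>t. norm (f t) \<le> e"
  shows "norm a \<le> e"
proof (rule tendsto_upperbound)
  show "((\<lambda>T. norm ((1 / T) *\<^sub>R integral {0..T} f)) \<longlongrightarrow> norm a) at_top"
    using assms(1) unfolding has_mean_def by (intro tendsto_norm) auto
  show "\<forall>\<^sub>F T in at_top. norm ((1 / T) *\<^sub>R integral {0..T} f) \<le> e"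
    using eventually_gt_at_top[of 0]
  proof eventually_elim
    case (elim T)
    then show ?case
      using average_norm_le[of f e T] assms by (simp add: has_mean_def)
  qed
qed simp

lemma has_mean_mono:
  fixes f g :: "real \<Rightarrow> real"
  assumes "has_mean f a" "has_mean g b" "\<And>t. f t \<le> g t"
  shows "a \<le> b"
proof (rule tendsto_le)
  show "((\<lambda>T. (1 / T) *\<^sub>R integral {0..T} g) \<longlongrightarrow> b) at_top"
    "((\<lambda>T. (1 / T) *\<^sub>R integral {0..T} f) \<longlongrightarrow> a) at_top"
    using assms by (auto simp: has_mean_def)
  show "\<forall>\<^sub>F T in at_top. (1 / T) *\<^sub>R integral {0..T} f \<le> (1 / T) *\<^sub>R integral {0..T} g"
    using eventually_gt_at_top[of 0]
  proof eventually_elim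
    case (elim T)
    have "integral {0..T} f \<le> integral {0..T} g"
      using assms by (intro integral_le continuous_integrable_interval) (auto simp: has_mean_def)
    then show ?case
      using elim by (simp add: divide_right_mono)
  qed
qed simp

lemma has_mean_diff:
  assumes "has_mean f a" "has_mean g b"
  shows "has_mean (\<lambda>t. f t - g t) (a - b)"
  using has_mean_add[OF assms(1) has_mean_linear[OF assms(2), of uminus]]
  by (simp add: bounded_linear_minus[OF bounded_linear_ident])

text \<open>An average is bounded by the supremum norm. Hence the means of a uniformly convergent
  sequence form a Cauchy sequence, and the limits in \<open>n\<close> and in \<open>T\<close> can be
  interchanged. The existence of all means below rests on this.\<close>

lemma has_mean_uniform_limit:
  fixes f :: "real \<Rightarrow> 'a::euclidean_space"
  assumes g: "\<And>n. has_mean (g n) (m n)" and lim: "uniform_limit UNIV g f sequentially"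
  shows "\<exists>l. m \<longlonglongrightarrow> l \<and> has_mean f l"
proof -
  have cg: "continuous_on UNIV (g n)" for n
    using g by (auto simp: has_mean_def)
  have cf: "continuous_on UNIV f"
    by (rule uniform_limit_theorem[OF _ lim]) (use cg in auto)
  have close: "\<exists>N. \<forall>n\<ge>N. \<forall>t. norm (g n t - f t) \<le> e" if "e > 0" for e
    using uniform_limitD[OF lim that]
    by (auto simp: eventually_sequentially dist_norm intro: less_imp_le)
  have "Cauchy m"
  proof (rule CauchyI)
    fix e :: real assume e: "e > 0"
    obtain N where N: "\<And>n t. n \<ge> N \<Longrightarrow> norm (g n t - f t) \<le> e / 4"
      using close[of "e / 4"] e by auto
    have "norm (m a - m b) < e" if "a \<ge> N" "b \<ge> N" for a b
    proof -
      have "norm (g a t - g b t) \<le> e / 2" for t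
        using norm_triangle_ineq4[of "g a t - f t" "g b t - f t"] N[OF that(1), of t] N[OF that(2), of t]
        by auto
      then show ?thesis
        using has_mean_norm_le[OF has_mean_diff[OF g g], of a b "e / 2"] e by force
    qed
    then show "\<exists>M. \<forall>a\<ge>M. \<forall>b\<ge>M. norm (m a - m b) < e" by blast
  qed
  then obtain l where l: "m \<longlonglongrightarrow> l"
    using Cauchy_convergent_iff convergent_def by blast
  have "((\<lambda>T. (1 / T) *\<^sub>R integral {0..T} f) \<longlongrightarrow> l) at_top"
  proof (rule tendstoI)
    fix e :: real assume e: "e > 0"
    obtain N where N: "\<And>n t. n \<ge> N \<Longrightarrow> norm (g n t - f t) \<le> e / 4"
      using close[of "e / 4"] e by auto
    obtain n where n: "n \<ge> N" "norm (m n - l) < e / 4"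
      using LIMSEQ_D[OF l, of "e / 4"] e by (metis divide_pos_pos zero_less_numeral nle_le)
    have "\<forall>\<^sub>F T in at_top. dist ((1 / T) *\<^sub>R integral {0..T} (g n)) (m n) < e / 4"
      using g[of n] e unfolding has_mean_def by (intro tendstoD) auto
    then show "\<forall>\<^sub>F T in at_top. dist ((1 / T) *\<^sub>R integral {0..T} f) l < e"
      using eventually_gt_at_top[of 0]
    proof eventually_elim
      case (elim T)
      have "norm ((1 / T) *\<^sub>R integral {0..T} (\<lambda>t. g n t - f t)) \<le> e / 4"
        using N[OF n(1)] elim cg cf by (intro average_norm_le continuous_on_diff) auto
      moreover have "integral {0..T} (\<lambda>t. g n t - f t) = integral {0..T} (g n) - integral {0..T} f"
        using cg cf by (intro integral_diff continuous_integrable_interval) auto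
      ultimately have "dist ((1 / T) *\<^sub>R integral {0..T} (g n)) ((1 / T) *\<^sub>R integral {0..T} f) \<le> e / 4"
        by (simp add: dist_norm scaleR_diff_right)
      then show ?case
        using elim(1) n(2) e dist_triangle[of "(1 / T) *\<^sub>R integral {0..T} f" l "m n"]
          dist_triangle[of "(1 / T) *\<^sub>R integral {0..T} f" "m n" "(1 / T) *\<^sub>R integral {0..T} (g n)"]
        by (simp add: dist_norm norm_minus_commute)
    qed
  qed
  then show ?thesis
    using l cf by (auto simp: has_mean_def)
qed

lemma has_mean_cis: "has_mean (\<lambda>t. cis (l * t)) (if l = 0 then 1 else 0)"
proof (cases "l = 0")
  case True
  then show ?thesis using has_mean_const[of "1::complex"] by simp
next
  case False
  have I: "integral {0..T} (\<lambda>t. cis (l * t)) = (cis (l * T) - 1) / (\<i> * l)" if "T > 0" for T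
  proof -
    have "((\<lambda>t. cis (l * t)) has_integral (cis (l * T) / (\<i> * l) - cis (l * 0) / (\<i> * l))) {0..T}"
    proof (rule fundamental_theorem_of_calculus)
      fix t
      have "((\<lambda>t. exp (\<i> * (l * of_real t)) / (\<i> * l)) has_vector_derivative exp (\<i> * (l * of_real t))) (at t within {0..T})"
        using False by (auto intro!: derivative_eq_intros has_vector_derivative_real_field simp: ac_simps)
      then show "((\<lambda>t. cis (l * t) / (\<i> * l)) has_vector_derivative cis (l * t)) (at t within {0..T})"
        by (simp add: cis_conv_exp)
    qed (use that in simp)
    then show ?thesis
      by (simp add: integral_unique diff_divide_distrib)
  qed
  have "((\<lambda>T. (1 / T) *\<^sub>R integral {0..T} (\<lambda>t. cis (l * t))) \<longlongrightarrow> 0) at_top"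
  proof (rule Lim_null_comparison)
    show "\<forall>\<^sub>F T in at_top. norm ((1 / T) *\<^sub>R integral {0..T} (\<lambda>t. cis (l * t))) \<le> (2 / \<bar>l\<bar>) / T"
      using eventually_gt_at_top[of 0]
    proof eventually_elim
      case (elim T)
      have "norm (cis (l * T) - 1) \<le> 2"
        using norm_triangle_ineq4[of "cis (l * T)" 1] by simp
      then show ?case
        using elim False divide_right_mono[of "norm (cis (l * T) - 1)" 2 "\<bar>l\<bar> * T"]
        by (simp add: I norm_divide norm_mult mult.commute[of T])
    qed
    show "((\<lambda>T. (2 / \<bar>l\<bar>) / T) \<longlongrightarrow> 0) at_top"
      by (intro tendsto_divide_0[OF tendsto_const] filterlim_at_top_imp_at_infinity filterlim_ident)
  qed
  then show ?thesis
    using False by (auto simp: has_mean_def intro!: continuous_intros)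
qed

text \<open>\<open>C\<close> restricts the coefficients and \<open>G\<close> the frequencies.
  Frequencies may repeat, so no uniqueness of Fourier coefficients is involved and every fact about
  means follows by induction on the terms. The choices that matter: nonnegative reals for
  \<open>C\<close>; half lines and the groups \<open>freqs S\<close> for \<open>G\<close>.\<close>

inductive_set trigs :: "complex set \<Rightarrow> real set \<Rightarrow> (real \<Rightarrow> complex) set" for C G where
  zero: "(\<lambda>t. 0) \<in> trigs C G"
| step: "c \<in> C \<Longrightarrow> l \<in> G \<Longrightarrow> g \<in> trigs C G \<Longrightarrow> (\<lambda>t. c * cis (l * t) + g t) \<in> trigs C G"

lemma trigs_mono: "f \<in> trigs C G \<Longrightarrow> C \<subseteq> C' \<Longrightarrow> G \<subseteq> G' \<Longrightarrow> f \<in> trigs C' G'"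
  by (induction rule: trigs.induct) (auto intro: trigs.intros)

lemma trigs_monom: "c \<in> C \<Longrightarrow> l \<in> G \<Longrightarrow> (\<lambda>t. c * cis (l * t)) \<in> trigs C G"
  using trigs.step[OF _ _ trigs.zero, of c C l G] by simp

lemma trigs_const: "c \<in> C \<Longrightarrow> 0 \<in> G \<Longrightarrow> (\<lambda>t. c) \<in> trigs C G"
  using trigs_monom[of c C 0 G] by simp

lemma trigs_add: "f \<in> trigs C G \<Longrightarrow> g \<in> trigs C G \<Longrightarrow> (\<lambda>t. f t + g t) \<in> trigs C G"
  by (induction rule: trigs.induct) (auto simp: add.assoc intro: trigs.intros)

lemma trigs_sum: "(\<And>i. i \<in> I \<Longrightarrow> f i \<in> trigs C G) \<Longrightarrow> (\<lambda>t. \<Sum>i\<in>I. f i t) \<in> trigs C G"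
  by (induction I rule: infinite_finite_induct) (auto intro: trigs.zero trigs_add)

lemma trigs_mult_monom:
  assumes "g \<in> trigs C G2" "c \<in> C" "l \<in> G1" "\<And>x y. x \<in> C \<Longrightarrow> y \<in> C \<Longrightarrow> x * y \<in> C"
    "\<And>x y. x \<in> G1 \<Longrightarrow> y \<in> G2 \<Longrightarrow> x + y \<in> G"
  shows "(\<lambda>t. (c * cis (l * t)) * g t) \<in> trigs C G"
  using assms(1)
proof induction
  case (step c' l' g)
  have "(\<lambda>t. (c * cis (l * t)) * (c' * cis (l' * t) + g t)) =
        (\<lambda>t. (c * c') * cis ((l + l') * t) + (c * cis (l * t)) * g t)"
    by (auto simp: algebra_simps cis_mult[symmetric])
  then show ?case
    using step assms by (auto intro!: trigs.step)
qed (auto intro: trigs.zero)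

lemma trigs_mult:
  assumes "f \<in> trigs C G1" "g \<in> trigs C G2" "\<And>x y. x \<in> C \<Longrightarrow> y \<in> C \<Longrightarrow> x * y \<in> C"
    "\<And>x y. x \<in> G1 \<Longrightarrow> y \<in> G2 \<Longrightarrow> x + y \<in> G"
  shows "(\<lambda>t. f t * g t) \<in> trigs C G"
  using assms(1)
proof induction
  case (step c l f)
  then show ?case
    using trigs_add[OF trigs_mult_monom[OF assms(2) step(1,2) assms(3,4)] step(4)]
    by (simp add: algebra_simps)
qed (auto intro: trigs.zero)

lemma trigs_cnj: "f \<in> trigs C G \<Longrightarrow> (\<lambda>t. cnj (f t)) \<in> trigs (cnj ` C) (uminus ` G)"
proof (induction rule: trigs.induct)
  case (step c l g)
  have "(\<lambda>t. cnj (c * cis (l * t) + g t)) = (\<lambda>t. cnj c * cis ((- l) * t) + cnj (g t))"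
    by (auto simp: cis_cnj)
  then show ?case using trigs.step[OF imageI[OF step(1), of cnj] imageI[OF step(2), of uminus] step(4)] by simp
qed (auto intro: trigs.zero)

lemma trigs_bounded: "f \<in> trigs C G \<Longrightarrow> \<exists>B. \<forall>t. norm (f t) \<le> B"
proof (induction rule: trigs.induct)
  case (step c l g)
  then obtain B where "\<And>t. norm (g t) \<le> B" by auto
  then have "norm (c * cis (l * t) + g t) \<le> norm c + B" for t
    by (intro order_trans[OF norm_triangle_ineq] add_mono) (auto simp: norm_mult)
  then show ?case by blast
qed auto

lemma trigs_has_mean: "f \<in> trigs C G \<Longrightarrow> has_mean f (mean f)"
proof (induction rule: trigs.induct)
  case zero
  then show ?case using has_mean_const[of "0::complex"] has_mean_imp_mean by fastforce
next
  case (step c l g)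
  from has_mean_add[OF has_mean_cmult[OF has_mean_cis[of l], of c] step(4)]
  show ?case using has_mean_imp_mean by fastforce
qed

lemma trigs_mean_term:
  "g \<in> trigs C G \<Longrightarrow> mean (\<lambda>t. c * cis (l * t) + g t) = (if l = 0 then c else 0) + mean g"
  by (rule has_mean_imp_mean)
    (use has_mean_add[OF has_mean_cmult[OF has_mean_cis[of l], of c] trigs_has_mean, of g] in auto)

lemma trigs_mean_zero: "mean (\<lambda>t. 0) = 0"
  using has_mean_imp_mean[OF has_mean_const] by blast

lemma trigs_mean_add:
  "f \<in> trigs C G \<Longrightarrow> g \<in> trigs C' G' \<Longrightarrow> mean (\<lambda>t. f t + g t) = mean f + mean g"
  by (rule has_mean_imp_mean) (auto intro: has_mean_add trigs_has_mean)

lemma trigs_mean_nonzero_freq: "f \<in> trigs C G \<Longrightarrow> 0 \<notin> G \<Longrightarrow> mean f = 0"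
  by (induction rule: trigs.induct) (auto simp: trigs_mean_zero trigs_mean_term)

lemma trigs_mean_nonneg: "f \<in> trigs \<real>\<^sub>\<ge>\<^sub>0 G \<Longrightarrow> mean f \<in> \<real>\<^sub>\<ge>\<^sub>0"
  by (induction rule: trigs.induct) (auto simp: trigs_mean_zero trigs_mean_term intro!: nonneg_Reals_add_I)

text \<open>Frequency groups that meet only in \<open>0\<close> behave like independent random variables.\<close>

lemma trigs_mean_mult:
  assumes "f \<in> trigs UNIV G1" "g \<in> trigs UNIV G2"
    "\<And>x y. x \<in> G1 \<Longrightarrow> y \<in> G2 \<Longrightarrow> x + y = 0 \<Longrightarrow> x = 0"
  shows "mean (\<lambda>t. f t * g t) = mean f * mean g"
  using assms(1)
proof induction
  case zero
  then show ?case by (simp add: trigs_mean_zero)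
next
  case (step c l f)
  have 1: "mean (\<lambda>t. c * cis (l * t) * g t) = (if l = 0 then c else 0) * mean g"
    using assms(2)
  proof induction
    case zero
    then show ?case by (simp add: trigs_mean_zero)
  next
    case (step d m g)
    have "(\<lambda>t. c * cis (l * t) * (d * cis (m * t) + g t)) =
          (\<lambda>t. (c * d) * cis ((l + m) * t) + c * cis (l * t) * g t)"
      by (auto simp: algebra_simps cis_mult[symmetric])
    moreover have "l + m = 0 \<longleftrightarrow> l = 0 \<and> m = 0"
      using assms(3)[of l m] step \<open>l \<in> G1\<close> by auto
    moreover have "(\<lambda>t. c * cis (l * t) * g t) \<in> trigs UNIV UNIV"
      by (rule trigs_mult_monom[OF step(3), of _ _ UNIV]) auto
    ultimately show ?case
      using step by (auto simp: trigs_mean_term distrib_left)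
  qed
  have 2: "(\<lambda>t. c * cis (l * t) * g t) \<in> trigs UNIV UNIV" "(\<lambda>t. f t * g t) \<in> trigs UNIV UNIV"
    by (rule trigs_mult_monom[OF assms(2), of _ _ UNIV] trigs_mult[OF step(3) assms(2)]; simp)+
  have "(\<lambda>t. (c * cis (l * t) + f t) * g t) = (\<lambda>t. c * cis (l * t) * g t + f t * g t)"
    by (auto simp: algebra_simps)
  then show ?case
    using step by (simp add: trigs_mean_add[OF 2] 1 trigs_mean_term distrib_right)
qed

text \<open>Bohr's uniformly almost periodic functions, with the approximating polynomials confined
  to coefficients in \<open>C\<close> and frequencies in \<open>G\<close>.\<close>

definition ap :: "complex set \<Rightarrow> real set \<Rightarrow> (real \<Rightarrow> complex) \<Rightarrow> bool" where
  "ap C G f \<longleftrightarrow> (\<forall>e>0. \<exists>g\<in>trigs C G. \<forall>t. norm (f t - g t) < e)"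

lemma uniform_limit_inverse_Suc:
  assumes "\<And>n t. dist (g n t) (f t) < 1 / real (Suc n)"
  shows "uniform_limit A g f sequentially"
proof (rule uniform_limitI)
  fix e :: real assume "e > 0"
  then have "\<forall>\<^sub>F n in sequentially. 1 / real (Suc n) < e"
    using LIMSEQ_inverse_real_of_nat by (auto dest: order_tendstoD(2) simp: inverse_eq_divide)
  then show "\<forall>\<^sub>F n in sequentially. \<forall>x\<in>A. dist (g n x) (f x) < e"
    by eventually_elim (use assms less_trans in blast)
qed

lemma ap_sequence:
  assumes "ap C G f"
  obtains g where "\<And>n::nat. g n \<in> trigs C G" "uniform_limit UNIV g f sequentially"
proof -
  have "\<forall>n::nat. \<exists>g. g \<in> trigs C G \<and> (\<forall>t. norm (f t - g t) < 1 / Suc n)"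
    using assms unfolding ap_def by (metis zero_less_divide_1_iff of_nat_0_less_iff zero_less_Suc)
  then obtain g where g: "\<And>n. g n \<in> trigs C G" "\<And>n t. norm (f t - g n t) < 1 / Suc n"
    by metis
  have "uniform_limit UNIV g f sequentially"
    using g(2) by (intro uniform_limit_inverse_Suc) (simp add: dist_norm norm_minus_commute)
  with g(1) show thesis using that by blast
qed

lemma ap_uniform_limit:
  assumes "\<And>n::nat. ap C G (g n)" "uniform_limit UNIV g f sequentially"
  shows "ap C G f"
  unfolding ap_def
proof (intro allI impI)
  fix e :: real assume e: "e > 0"
  obtain n where n: "\<And>t. dist (g n t) (f t) < e / 2"
    using uniform_limitD[OF assms(2), of "e / 2"] e by (auto simp: eventually_sequentially)
  obtain h where h: "h \<in> trigs C G" "\<And>t. norm (g n t - h t) < e / 2"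
    using assms(1)[of n] half_gt_zero[OF e] unfolding ap_def by blast
  have "norm (f t - h t) < e" for t
    using n[of t] h(2)[of t] by (simp add: dist_norm) norm
  with h(1) show "\<exists>g\<in>trigs C G. \<forall>t. norm (f t - g t) < e" by blast
qed

lemma trigs_ap: "f \<in> trigs C G \<Longrightarrow> ap C G f"
  unfolding ap_def by (metis diff_self norm_zero)

lemma ap_mono: "ap C G f \<Longrightarrow> C \<subseteq> C' \<Longrightarrow> G \<subseteq> G' \<Longrightarrow> ap C' G' f"
  unfolding ap_def by (meson trigs_mono)

lemma ap_bounded:
  assumes "ap C G f" obtains B where "B > 0" "\<And>t. norm (f t) \<le> B"
proof -
  obtain g where g: "g \<in> trigs C G" "\<And>t. norm (f t - g t) < 1"
    using assms unfolding ap_def by (meson zero_less_one)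
  obtain B where "\<And>t. norm (g t) \<le> B" using trigs_bounded[OF g(1)] by auto
  then have "norm (f t) \<le> \<bar>B\<bar> + 1" for t
    using g(2)[of t] by (smt (verit) norm_triangle_sub)
  then show thesis using that[of "\<bar>B\<bar> + 1"] by auto
qed

lemma ap_bounded_range: "ap C G f \<Longrightarrow> bounded (range f)"
  by (rule ap_bounded[of C G f]) (auto simp: bounded_iff)

lemma ap_has_mean: assumes "ap C G f" shows "has_mean f (mean f)"
proof -
  obtain g where "\<And>n::nat. g n \<in> trigs C G" "uniform_limit UNIV g f sequentially"
    using ap_sequence[OF assms] by blast
  from has_mean_uniform_limit[OF trigs_has_mean[OF this(1)] this(2)]
  show ?thesis using has_mean_imp_mean by auto
qed

lemma mean_uniform_limit:
  assumes "\<And>n::nat. ap C G (g n)" "uniform_limit UNIV g f sequentially"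
  shows "(\<lambda>n. mean (g n)) \<longlonglongrightarrow> mean f"
  using has_mean_uniform_limit[OF ap_has_mean[OF assms(1)] assms(2)] has_mean_imp_mean by metis

lemma ap_add:
  assumes "ap C G f" "ap C G g" shows "ap C G (\<lambda>t. f t + g t)"
proof -
  obtain f' where f': "\<And>n::nat. f' n \<in> trigs C G" "uniform_limit UNIV f' f sequentially"
    using ap_sequence[OF assms(1)] by blast
  obtain g' where g': "\<And>n::nat. g' n \<in> trigs C G" "uniform_limit UNIV g' g sequentially"
    using ap_sequence[OF assms(2)] by blast
  show ?thesis
    by (rule ap_uniform_limit[OF trigs_ap[OF trigs_add[OF f'(1) g'(1)]] uniform_limit_add[OF f'(2) g'(2)]])
qed

lemma ap_mult:
  assumes "ap C G1 f" "ap C G2 g" "\<And>x y. x \<in> C \<Longrightarrow> y \<in> C \<Longrightarrow> x * y \<in> C"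
    "\<And>x y. x \<in> G1 \<Longrightarrow> y \<in> G2 \<Longrightarrow> x + y \<in> G"
  shows "ap C G (\<lambda>t. f t * g t)"
proof -
  obtain f' where f': "\<And>n::nat. f' n \<in> trigs C G1" "uniform_limit UNIV f' f sequentially"
    using ap_sequence[OF assms(1)] by blast
  obtain g' where g': "\<And>n::nat. g' n \<in> trigs C G2" "uniform_limit UNIV g' g sequentially"
    using ap_sequence[OF assms(2)] by blast
  show ?thesis
    by (rule ap_uniform_limit[OF trigs_ap[OF trigs_mult[OF f'(1) g'(1) assms(3,4)]] uniform_lim_mult[OF f'(2) g'(2)]])
      (use ap_bounded_range[OF assms(1)] ap_bounded_range[OF assms(2)] in auto)
qed

lemma ap_cnj:
  fixes f :: "real \<Rightarrow> complex"
  assumes "ap C G f" shows "ap (cnj ` C) (uminus ` G) (\<lambda>t. cnj (f t))"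
proof -
  obtain f' where f': "\<And>n::nat. f' n \<in> trigs C G" "uniform_limit UNIV f' f sequentially"
    using ap_sequence[OF assms(1)] by blast
  have "uniform_limit UNIV (\<lambda>n t. cnj (f' n t)) (\<lambda>t. cnj (f t)) sequentially"
    by (rule bounded_linear.uniform_limit[OF bounded_linear_cnj f'(2)])
  then show ?thesis
    by (rule ap_uniform_limit[OF trigs_ap[OF trigs_cnj[OF f'(1)]]])
qed

lemma ap_mean_mult:
  assumes "ap UNIV G1 f" "ap UNIV G2 g"
    "\<And>x y. x \<in> G1 \<Longrightarrow> y \<in> G2 \<Longrightarrow> x + y = 0 \<Longrightarrow> x = 0"
  shows "mean (\<lambda>t. f t * g t) = mean f * mean g"
proof -
  obtain f' where f': "\<And>n::nat. f' n \<in> trigs UNIV G1" "uniform_limit UNIV f' f sequentially"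
    using ap_sequence[OF assms(1)] by blast
  obtain g' where g': "\<And>n::nat. g' n \<in> trigs UNIV G2" "uniform_limit UNIV g' g sequentially"
    using ap_sequence[OF assms(2)] by blast
  have "ap UNIV UNIV (\<lambda>t. f' n t * g' n t)" for n
    by (intro trigs_ap trigs_mult[OF f'(1) g'(1)]) auto
  then have "(\<lambda>n. mean (\<lambda>t. f' n t * g' n t)) \<longlonglongrightarrow> mean (\<lambda>t. f t * g t)"
    by (rule mean_uniform_limit[OF _ uniform_lim_mult[OF f'(2) g'(2)]])
      (use ap_bounded_range[OF assms(1)] ap_bounded_range[OF assms(2)] in auto)
  moreover have "(\<lambda>n. mean (f' n) * mean (g' n)) \<longlonglongrightarrow> mean f * mean g"
    by (intro tendsto_mult mean_uniform_limit[OF trigs_ap[OF f'(1)] f'(2)] mean_uniform_limit[OF trigs_ap[OF g'(1)] g'(2)])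
  ultimately show ?thesis
    using trigs_mean_mult[OF f'(1) g'(1) assms(3)] LIMSEQ_unique by fastforce
qed

lemma ap_mean_nonneg: assumes "ap \<real>\<^sub>\<ge>\<^sub>0 G f" shows "mean f \<in> \<real>\<^sub>\<ge>\<^sub>0"
proof -
  obtain g where g: "\<And>n::nat. g n \<in> trigs \<real>\<^sub>\<ge>\<^sub>0 G" "uniform_limit UNIV g f sequentially"
    using ap_sequence[OF assms] by blast
  then have "(\<lambda>n. mean (g n)) \<longlonglongrightarrow> mean f"
    by (intro mean_uniform_limit[OF trigs_ap])
  then show ?thesis
    using closed_sequentially[OF closed_nonneg_Reals_complex, of "\<lambda>n. mean (g n)"] trigs_mean_nonneg[OF g(1)] by blast
qed

definition add_subgroup :: "real set \<Rightarrow> bool" where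
  "add_subgroup G \<longleftrightarrow> 0 \<in> G \<and> (\<forall>x\<in>G. \<forall>y\<in>G. x + y \<in> G) \<and> (\<forall>x\<in>G. - x \<in> G)"

lemma add_subgroup_UNIV [simp]: "add_subgroup UNIV"
  by (simp add: add_subgroup_def)

lemma ap_const: "add_subgroup G \<Longrightarrow> ap UNIV G (\<lambda>t. c)"
  by (intro trigs_ap trigs_const) (auto simp: add_subgroup_def)

lemma ap_group_mult: "add_subgroup G \<Longrightarrow> ap UNIV G f \<Longrightarrow> ap UNIV G g \<Longrightarrow> ap UNIV G (\<lambda>t. f t * g t)"
  by (rule ap_mult) (auto simp: add_subgroup_def)

lemma ap_group_cnj: "add_subgroup G \<Longrightarrow> ap UNIV G f \<Longrightarrow> ap UNIV G (\<lambda>t. cnj (f t))"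
  using ap_cnj[of UNIV G f] by (rule ap_mono) (auto simp: add_subgroup_def)

lemma ap_group_power: "add_subgroup G \<Longrightarrow> ap UNIV G f \<Longrightarrow> ap UNIV G (\<lambda>t. f t ^ n)"
  by (induction n) (auto intro: ap_const ap_group_mult)

lemma ap_UNIV: "ap C G f \<Longrightarrow> ap UNIV UNIV f"
  by (erule ap_mono) auto

lemma ap_real_polynomial:
  assumes "add_subgroup G" "ap UNIV G (\<lambda>t. of_real (g t))" "real_polynomial_function h"
  shows "ap UNIV G (\<lambda>t. of_real (h (g t)))"
  using assms(3)
proof induction
  case (linear h)
  then have "h (g t) = h 1 * g t" for t
    using linear_simps(5)[OF linear, of "g t" 1] by simp
  then show ?case
    using ap_group_mult[OF assms(1) ap_const[OF assms(1), of "of_real (h 1)"] assms(2)] by simp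
next
  case (const c)
  then show ?case using ap_const[OF assms(1)] by simp
next
  case (add h1 h2)
  then show ?case using ap_add[of UNIV G "\<lambda>t. of_real (h1 (g t))" "\<lambda>t. of_real (h2 (g t))"] by simp
next
  case (mult h1 h2)
  then show ?case
    using ap_group_mult[of G "\<lambda>t. of_real (h1 (g t))" "\<lambda>t. of_real (h2 (g t))"] assms by simp
qed

text \<open>The square of the norm is \<open>f\<close> times its conjugate and therefore almost
  periodic; Weierstrass approximation of \<open>phi (sqrt x)\<close> on a compact interval then
  gives every continuous function of the norm. The frequencies stay in the group \<open>G\<close>,
  so non-even powers of functions of different primes remain independent.\<close>

lemma ap_continuous_norm:
  fixes phi :: "real \<Rightarrow> real"
  assumes G: "add_subgroup G" and f: "ap UNIV G f" and phi: "continuous_on {0..} phi"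
  shows "ap UNIV G (\<lambda>t. of_real (phi (norm (f t))))"
proof -
  obtain B where B: "B > 0" "\<And>t. norm (f t) \<le> B" using ap_bounded[OF f] by blast
  have sq: "ap UNIV G (\<lambda>t. of_real ((norm (f t))\<^sup>2))"
    using ap_group_mult[OF G f ap_group_cnj[OF G f]] by (simp only: complex_norm_square)
  have cont: "continuous_on {0..B\<^sup>2} (\<lambda>x. phi (sqrt x))"
    by (rule continuous_on_compose2[OF phi]) (auto intro!: continuous_intros)
  have "\<exists>h. ap UNIV G h \<and> (\<forall>t. norm (h t - of_real (phi (norm (f t)))) < e)" if e: "e > 0" for e
  proof -
    obtain h where h: "real_polynomial_function h" "\<And>x. x \<in> {0..B\<^sup>2} \<Longrightarrow> \<bar>phi (sqrt x) - h x\<bar> < e"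
      using Stone_Weierstrass_real_polynomial_function[OF compact_Icc cont e] by blast
    have "norm (complex_of_real (h ((norm (f t))\<^sup>2)) - of_real (phi (norm (f t)))) < e" for t
    proof -
      have "\<bar>phi (sqrt ((norm (f t))\<^sup>2)) - h ((norm (f t))\<^sup>2)\<bar> < e"
        by (rule h(2)) (use B(2)[of t] in \<open>auto intro: power_mono\<close>)
      then show ?thesis
        by (simp flip: of_real_diff)
    qed
    with ap_real_polynomial[OF G sq h(1)] show ?thesis by blast
  qed
  then have "\<forall>n. \<exists>h. ap UNIV G h \<and> (\<forall>t. norm (h t - of_real (phi (norm (f t)))) < 1 / real (Suc n))"
    by auto
  then obtain h where h: "\<And>n. ap UNIV G (h n)"
      "\<And>n t. norm (h n t - of_real (phi (norm (f t)))) < 1 / real (Suc n)"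
    by metis
  have "uniform_limit UNIV h (\<lambda>t. of_real (phi (norm (f t)))) sequentially"
    using h(2) by (intro uniform_limit_inverse_Suc) (simp add: dist_norm)
  from ap_uniform_limit[OF h(1) this] show ?thesis .
qed

lemma uniform_limit_continuous_norm:
  fixes phi :: "real \<Rightarrow> real" and f :: "real \<Rightarrow> complex"
  assumes lim: "uniform_limit UNIV g f sequentially" and bd: "bounded (range f)"
    and phi: "continuous_on {0..} phi"
  shows "uniform_limit UNIV (\<lambda>n t. phi (norm (g n t))) (\<lambda>t. phi (norm (f t))) sequentially"
proof -
  obtain B where B: "\<And>t. norm (f t) \<le> B" using bd by (auto simp: bounded_iff)
  have uc: "uniformly_continuous_on {0..B + 1} phi"
    by (rule compact_uniformly_continuous) (use continuous_on_subset[OF phi] in auto)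
  have 1: "uniform_limit UNIV (\<lambda>n t. norm (g n t)) (\<lambda>t. norm (f t)) sequentially"
    by (rule uniform_limitI, rule eventually_mono[OF uniform_limitD[OF lim]])
      (auto simp: dist_norm intro: le_less_trans[OF norm_triangle_ineq3])
  have "\<forall>\<^sub>F n in sequentially. \<forall>t\<in>UNIV. norm (g n t) \<in> {0..B + 1}"
    using uniform_limitD[OF lim zero_less_one]
  proof eventually_elim
    case (elim n)
    have "norm (g n t) \<le> B + 1" for t
      using elim B[of t] norm_triangle_sub[of "g n t" "f t"] by (auto simp: dist_norm intro: less_imp_le) (smt (verit) UNIV_I)
    then show ?case by auto
  qed
  then show ?thesis
    using uniform_limit_compose_uniformly_continuous_on[OF 1 uc] by auto
qed

lemma continuous_on_powr_const: "r > 0 \<Longrightarrow> continuous_on {0..} (\<lambda>x::real. x powr r)"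
  by (intro continuous_on_powr') (auto intro: continuous_intros)

text \<open>Inequalities between means need real-valued functions, whereas frequencies are recorded
  for complex ones; this predicate connects the two.\<close>

definition rap :: "(real \<Rightarrow> real) \<Rightarrow> bool" where
  "rap g \<longleftrightarrow> ap UNIV UNIV (\<lambda>t. of_real (g t))"

lemma has_mean_of_real: "has_mean (\<lambda>t. complex_of_real (g t)) m \<Longrightarrow> has_mean g (Re m)"
  using has_mean_linear[OF _ bounded_linear_Re] by fastforce

lemma rap_has_mean: "rap g \<Longrightarrow> has_mean g (mean g)"
  unfolding rap_def by (metis ap_has_mean has_mean_of_real has_mean_imp_mean)

lemma mean_of_real: "rap g \<Longrightarrow> mean (\<lambda>t. complex_of_real (g t)) = of_real (mean g)"
  by (rule has_mean_imp_mean) (rule has_mean_linear[OF rap_has_mean bounded_linear_of_real])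

lemma rap_const: "rap (\<lambda>t. c)"
  unfolding rap_def by (rule ap_const) simp

lemma rap_add: "rap f \<Longrightarrow> rap g \<Longrightarrow> rap (\<lambda>t. f t + g t)"
  unfolding rap_def of_real_add by (rule ap_add)

lemma rap_mult: "rap f \<Longrightarrow> rap g \<Longrightarrow> rap (\<lambda>t. f t * g t)"
  unfolding rap_def of_real_mult by (rule ap_group_mult) auto

lemma rap_cmult: "rap f \<Longrightarrow> rap (\<lambda>t. c * f t)"
  by (intro rap_mult rap_const)

lemma rap_sum: "(\<And>i. i \<in> I \<Longrightarrow> rap (f i)) \<Longrightarrow> rap (\<lambda>t. \<Sum>i\<in>I. f i t)"
  by (induction I rule: infinite_finite_induct) (auto intro: rap_const rap_add)

lemma rap_Re: assumes "ap UNIV UNIV f" shows "rap (\<lambda>t. Re (f t))"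
proof -
  have "ap UNIV UNIV (\<lambda>t. 1 / 2 * (f t + cnj (f t)))"
    using assms by (intro ap_group_mult ap_const ap_add ap_group_cnj) auto
  moreover have "1 / 2 * (f t + cnj (f t)) = of_real (Re (f t))" for t
    by (simp add: complex_eq_iff)
  ultimately show ?thesis by (simp add: rap_def)
qed

lemma mean_Re: "ap UNIV UNIV f \<Longrightarrow> mean (\<lambda>t. Re (f t)) = Re (mean f)"
  by (rule has_mean_imp_mean) (rule has_mean_linear[OF ap_has_mean bounded_linear_Re])

lemma rap_continuous_norm:
  fixes phi :: "real \<Rightarrow> real"
  shows "ap UNIV UNIV f \<Longrightarrow> continuous_on {0..} phi \<Longrightarrow> rap (\<lambda>t. phi (norm (f t)))"
  unfolding rap_def by (rule ap_continuous_norm) auto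

lemma rap_norm_powr: "ap UNIV UNIV f \<Longrightarrow> r > 0 \<Longrightarrow> rap (\<lambda>t. norm (f t) powr r)"
  by (rule rap_continuous_norm) (auto intro: continuous_on_powr_const)

lemma rap_norm_power: "ap UNIV UNIV f \<Longrightarrow> rap (\<lambda>t. norm (f t) ^ n)"
  by (rule rap_continuous_norm) (auto intro: continuous_intros)

lemma mean_const: "mean (\<lambda>t. c) = c"
  by (rule has_mean_imp_mean[OF has_mean_const])

lemma mean_add: "rap f \<Longrightarrow> rap g \<Longrightarrow> mean (\<lambda>t. f t + g t) = mean f + mean g"
  by (intro has_mean_imp_mean has_mean_add rap_has_mean)

lemma mean_cmult: "rap f \<Longrightarrow> mean (\<lambda>t. c * f t) = c * mean f"
  by (intro has_mean_imp_mean has_mean_cmult rap_has_mean)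

lemma mean_sum: "(\<And>i. i \<in> I \<Longrightarrow> rap (f i)) \<Longrightarrow> mean (\<lambda>t. \<Sum>i\<in>I. f i t) = (\<Sum>i\<in>I. mean (f i))"
  by (induction I rule: infinite_finite_induct) (auto simp: mean_const mean_add rap_sum)

lemma mean_mono: "rap f \<Longrightarrow> rap g \<Longrightarrow> (\<And>t. f t \<le> g t) \<Longrightarrow> mean f \<le> mean g"
  by (meson has_mean_mono rap_has_mean)

lemma mean_nonneg: "rap f \<Longrightarrow> (\<And>t. 0 \<le> f t) \<Longrightarrow> 0 \<le> mean f"
  using mean_mono[OF rap_const, of f 0] by (simp add: mean_const)

lemma ap_mean_add: "ap UNIV UNIV f \<Longrightarrow> ap UNIV UNIV g \<Longrightarrow> mean (\<lambda>t. f t + g t) = mean f + mean g"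
  by (intro has_mean_imp_mean has_mean_add ap_has_mean)

lemma ap_mean_cmult:
  fixes f :: "real \<Rightarrow> complex"
  shows "ap C G f \<Longrightarrow> mean (\<lambda>t. c * f t) = c * mean f"
  by (intro has_mean_imp_mean has_mean_cmult ap_has_mean)

text \<open>Uniform continuity of \<open>x powr r\<close> on bounded sets carries the uniform
  convergence over to the powers. Its use is to replace truncated Euler factors by complete
  ones.\<close>

lemma mean_norm_powr_limit:
  assumes "\<And>n::nat. ap UNIV UNIV (g n)" "uniform_limit UNIV g f sequentially" "r > 0"
  shows "(\<lambda>n. mean (\<lambda>t. norm (g n t) powr r)) \<longlonglongrightarrow> mean (\<lambda>t. norm (f t) powr r)"
proof -
  have f: "ap UNIV UNIV f" using ap_uniform_limit[OF assms(1,2)] .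
  have "\<exists>l. (\<lambda>n. mean (\<lambda>t. norm (g n t) powr r)) \<longlonglongrightarrow> l \<and> has_mean (\<lambda>t. norm (f t) powr r) l"
    using assms
    by (intro has_mean_uniform_limit[where g = "\<lambda>n t. norm (g n t) powr r"] rap_has_mean rap_norm_powr
        uniform_limit_continuous_norm[where phi = "\<lambda>x. x powr r"] continuous_on_powr_const ap_bounded_range[OF f])
  then show ?thesis
    using has_mean_imp_mean by blast
qed

lemma dirpoly_conv_cis:
  "dirpoly N t = (\<Sum>n=1..N. of_real (real n powr (- 1 / 2)) * cis (- ln (real n) * t))"
  unfolding dirpoly_def
proof (rule sum.cong[OF refl])
  fix n assume n: "n \<in> {1..N}"
  have "(of_nat n :: complex) powr (- (1 / 2 + \<i> * of_real t)) = exp (of_real (- 1 / 2 * ln n) + \<i> * of_real (- ln n * t))"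
    using n by (auto simp: powr_def Ln_of_nat algebra_simps intro!: arg_cong[where f = exp])
  also have "\<dots> = of_real (real n powr (- 1 / 2)) * cis (- ln n * t)"
    using n unfolding exp_add cis_conv_exp powr_def by (simp flip: exp_of_real)
  finally show "(of_nat n :: complex) powr (- (1 / 2 + \<i> * of_real t)) = \<dots>" .
qed

lemma pseudomoment_eq_mean: "pseudomoment k N = mean (\<lambda>t. norm (dirpoly N t) powr (2 * k))"
  by (simp add: pseudomoment_def mean_def)

section \<open>The theorem of M. Riesz\<close>

lemma one_plus_power_le:
  fixes x :: real
  assumes "0 \<le> x" "x * real m \<le> 1 / 2"
  shows "(1 + x) ^ m \<le> 5 / 3"
proof -
  have "(1 + x) ^ m \<le> exp x ^ m"
    using assms by (intro power_mono) (auto simp: exp_ge_add_one_self)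
  also have "\<dots> = exp (x * m)"
    using exp_of_nat_mult[of m x] by (simp add: mult.commute)
  also have "\<dots> \<le> exp (1 / 2)"
    using assms by simp
  also have "exp (1 / 2 :: real) \<le> 5 / 3"
  proof -
    have "(exp (1 / 2 :: real))\<^sup>2 = exp 1"
      by (simp flip: exp_double)
    also have "\<dots> \<le> (5 / 3)\<^sup>2"
      using e_less_272 by (simp add: power2_eq_square)
    finally show ?thesis by (simp add: power2_le_iff_abs_le)
  qed
  finally show ?thesis .
qed

lemma norm_one_plus_power_minus_one_le:
  fixes z :: complex
  shows "norm ((1 + z) ^ m - 1) \<le> (1 + norm z) ^ m - 1"
proof (induction m)
  case (Suc m)
  have "norm ((1 + z) ^ Suc m - 1) = norm (((1 + z) ^ m - 1) * (1 + z) + z)"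
    by (simp add: algebra_simps)
  also have "\<dots> \<le> ((1 + norm z) ^ m - 1) * (1 + norm z) + norm z"
    by (intro norm_triangle_le add_mono order.refl)
      (auto simp: norm_mult intro!: mult_mono Suc norm_triangle_le)
  also have "\<dots> = (1 + norm z) ^ Suc m - 1"
    by (simp add: algebra_simps)
  finally show ?case .
qed simp

text \<open>If \<open>a + cnj b\<close> is small compared with \<open>a\<close>, then \<open>a b\<close> is close to the negative number
  \<open>- \<bar>a\<bar>\<^sup>2\<close>, so that \<open>(- a b) ^ m\<close> has a large real part.\<close>

lemma riesz_pointwise:
  fixes a b :: complex
  assumes "m \<ge> 1"
  shows "norm a ^ (2 * m) \<le> 3 * (-1) ^ m * Re ((a * b) ^ m)
           + 4 * (3 * real m) ^ (2 * m) * norm (a + cnj b) ^ (2 * m)"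
proof (cases "2 * real m * norm (a + cnj b) \<le> norm a")
  case True
  show ?thesis
  proof (cases "a = 0")
    case True
    then show ?thesis using assms by (simp add: power_0_left)
  next
    case False
    \<comment> \<open>\<open>w\<close> measures the deviation of \<open>a * b\<close> from
      \<open>- (norm a)^2\<close>. In this case \<open>norm w <= 1 / (2 m)\<close>, which keeps
      \<open>(1 + w) ^ m\<close> within 5/3 - 1 = 2/3 of 1, so its real part is at least 1/3. This
      is the origin of the factor 3 in the inequality.\<close>
    define w where "w = - cnj (a + cnj b) / cnj a"
    have ab: "a * b = - of_real ((norm a)\<^sup>2) * (1 + w)"
    proof -
      have "- of_real ((norm a)\<^sup>2) * (1 + w) = - (a * cnj a) * (1 + w)"
        by (simp only: complex_norm_square)
      also have "\<dots> = a * b"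
        using False by (simp add: w_def field_simps)
      finally show ?thesis by simp
    qed
    have w: "norm w * real m \<le> 1 / 2"
    proof -
      have "norm w = norm (a + cnj b) / norm a"
        unfolding w_def by (simp only: norm_divide norm_minus_cancel complex_mod_cnj)
      moreover have "norm a > 0" using False by simp
      ultimately show ?thesis
        using True by (simp only: times_divide_eq_left divide_le_eq) (simp add: mult.commute mult.left_commute)
    qed
    have "norm ((1 + w) ^ m - 1) \<le> 2 / 3"
      using norm_one_plus_power_minus_one_le[of w m] one_plus_power_le[OF _ w] by simp
    then have "Re ((1 + w) ^ m) \<ge> 1 / 3"
      using abs_Re_le_cmod[of "(1 + w) ^ m - 1"] by simp
    moreover have "(-1) ^ m * Re ((a * b) ^ m) = norm a ^ (2 * m) * Re ((1 + w) ^ m)"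
    proof -
      have "(a * b) ^ m = of_real ((-1) ^ m * norm a ^ (2 * m)) * (1 + w) ^ m"
        unfolding ab mult_minus_left power_minus[of "_ * _"]
        by (simp only: power_mult_distrib power_mult of_real_mult of_real_power of_real_minus of_real_1 mult.assoc)
      then show ?thesis
        by (cases "even m") auto
    qed
    moreover from calculation(1) have "norm a ^ (2 * m) * (1 / 3) \<le> norm a ^ (2 * m) * Re ((1 + w) ^ m)"
      by (intro mult_left_mono) auto
    moreover have "0 \<le> 4 * (3 * real m) ^ (2 * m) * norm (a + cnj b) ^ (2 * m)"
      by simp
    ultimately show ?thesis
      by linarith
  qed
next
  case False
  \<comment> \<open>Now \<open>e\<close> is not small, and both \<open>norm a\<close> and
    \<open>norm b\<close> are at most \<open>3 * m * e\<close>. The constant 4 is 1 + 3: once for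
    \<open>norm a ^ (2 * m)\<close> and three times for a possibly negative real part.\<close>
  define e where "e = norm (a + cnj b)"
  have e: "norm a \<le> 2 * real m * e" "e \<ge> 0" using False by (auto simp: e_def)
  have "norm b \<le> norm a + e"
    using norm_triangle_ineq4[of "a + cnj b" a] by (simp add: e_def)
  also have "\<dots> \<le> 3 * real m * e"
    using e assms mult_right_mono[of 1 "real m" e] by simp
  finally have b: "norm b \<le> 3 * real m * e" .
  have a: "norm a \<le> 3 * real m * e"
    using e assms by (smt (verit, best) mult_nonneg_nonneg mult_right_mono of_nat_0_le_iff)
  have "- ((-1) ^ m * Re ((a * b) ^ m)) \<le> norm ((a * b) ^ m)"
    using abs_Re_le_cmod[of "(a * b) ^ m"] by (cases "even m") auto
  also have "\<dots> \<le> (3 * real m * e) ^ m * (3 * real m * e) ^ m"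
    unfolding norm_mult norm_power power_mult_distrib[of a b]
    using a b e(2) by (intro mult_mono power_mono zero_le_power) auto
  also have "\<dots> = (3 * real m) ^ (2 * m) * e ^ (2 * m)"
    by (simp add: power_mult_distrib power_add mult_2)
  finally have 1: "- ((-1) ^ m * Re ((a * b) ^ m)) \<le> (3 * real m) ^ (2 * m) * e ^ (2 * m)" .
  have "norm a ^ (2 * m) \<le> (3 * real m * e) ^ (2 * m)"
    using a by (intro power_mono) auto
  then have 2: "norm a ^ (2 * m) \<le> (3 * real m) ^ (2 * m) * e ^ (2 * m)"
    by (simp add: power_mult_distrib)
  from 1 2 show ?thesis unfolding e_def[symmetric] by (simp add: mult.assoc)
qed

lemma trigs_power:
  assumes "f \<in> trigs UNIV {0<..}" "m \<ge> 1"
  shows "(\<lambda>t. f t ^ m) \<in> trigs UNIV {0<..}"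
  using assms(2)
proof (induction m rule: dec_induct)
  case (step m)
  from trigs_mult[OF assms(1) step(3), of "{0<..}"] show ?case by simp
qed (use assms in simp)

text \<open>After a shift by \<open>\<theta>\<close>, \<open>a\<close> has frequencies at least 0
  and \<open>b\<close>, the conjugate of the shifted \<open>V\<close>, has frequencies above 0. Thus
  \<open>(a * b) ^ m\<close> has only positive frequencies and mean 0, and averaging the pointwise
  inequality leaves just the term with \<open>norm (a + cnj b) = norm (U + V)\<close>.\<close>

lemma riesz_even:
  assumes "U \<in> trigs UNIV {\<theta>..}" "V \<in> trigs UNIV {..<\<theta>}" "m \<ge> 1"
  shows "mean (\<lambda>t. norm (U t) ^ (2 * m)) \<le> 4 * (3 * real m) ^ (2 * m) * mean (\<lambda>t. norm (U t + V t) ^ (2 * m))"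
proof -
  define a where "a = (\<lambda>t. 1 * cis (- \<theta> * t) * U t)"
  define b where "b = (\<lambda>t. cnj (1 * cis (- \<theta> * t) * V t))"
  have a: "a \<in> trigs UNIV {0..}"
    unfolding a_def by (rule trigs_mult_monom[OF assms(1), where ?G1.0 = "{-\<theta>}"]) auto
  have "(\<lambda>t. 1 * cis (- \<theta> * t) * V t) \<in> trigs UNIV {..<0}"
    by (rule trigs_mult_monom[OF assms(2), where ?G1.0 = "{-\<theta>}"]) auto
  from trigs_cnj[OF this] have b: "b \<in> trigs UNIV {0<..}"
    unfolding b_def by (rule trigs_mono) auto
  have "(\<lambda>t. a t * b t) \<in> trigs UNIV {0<..}"
    by (rule trigs_mult[OF a b]) auto
  from trigs_power[OF this assms(3)] have abm: "(\<lambda>t. (a t * b t) ^ m) \<in> trigs UNIV {0<..}" .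
  then have 0: "mean (\<lambda>t. Re ((a t * b t) ^ m)) = 0" and R: "rap (\<lambda>t. Re ((a t * b t) ^ m))"
    using mean_Re[OF ap_UNIV[OF trigs_ap[OF abm]]] trigs_mean_nonzero_freq[OF abm]
      rap_Re[OF ap_UNIV[OF trigs_ap[OF abm]]] by auto
  have UV: "ap UNIV UNIV U" "ap UNIV UNIV (\<lambda>t. U t + V t)"
    using ap_UNIV[OF trigs_ap[OF assms(1)]] ap_UNIV[OF trigs_ap[OF assms(2)]] ap_add by auto
  have n: "norm (a t) = norm (U t)" "norm (a t + cnj (b t)) = norm (U t + V t)" for t
    by (simp_all add: a_def b_def norm_mult flip: distrib_left)
  have "mean (\<lambda>t. norm (U t) ^ (2 * m)) \<le>
     mean (\<lambda>t. 3 * (-1) ^ m * Re ((a t * b t) ^ m) + 4 * (3 * real m) ^ (2 * m) * norm (U t + V t) ^ (2 * m))"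
  proof (intro mean_mono rap_add rap_cmult R rap_norm_power UV)
    fix t
    show "norm (U t) ^ (2 * m) \<le> 3 * (-1) ^ m * Re ((a t * b t) ^ m) + 4 * (3 * real m) ^ (2 * m) * norm (U t + V t) ^ (2 * m)"
      using riesz_pointwise[OF assms(3), of "a t" "b t"] unfolding n .
  qed
  also have "\<dots> = 4 * (3 * real m) ^ (2 * m) * mean (\<lambda>t. norm (U t + V t) ^ (2 * m))"
    by (subst mean_add) (auto intro!: rap_cmult R rap_norm_power UV simp: mean_cmult R 0 rap_norm_power UV)
  finally show ?thesis .
qed

lemma trigs_split:
  assumes "f \<in> trigs C UNIV"
  shows "\<exists>U\<in>trigs C {\<theta>..}. \<exists>V\<in>trigs C {..<\<theta>}. \<forall>t. f t = U t + V t"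
  using assms
proof induction
  case zero
  then show ?case by (intro bexI[of _ "\<lambda>t. 0"]) (auto intro: trigs.zero)
next
  case (step c l g)
  then obtain U V where UV: "U \<in> trigs C {\<theta>..}" "V \<in> trigs C {..<\<theta>}" "\<And>t. g t = U t + V t"
    by blast
  show ?case
  proof (cases "l \<ge> \<theta>")
    case True
    then have "(\<lambda>t. c * cis (l * t) + U t) \<in> trigs C {\<theta>..}"
      using UV step by (intro trigs.step) auto
    then show ?thesis using UV by (intro bexI[of _ "\<lambda>t. c * cis (l * t) + U t"] bexI[of _ V]) auto
  next
    case False
    then have "(\<lambda>t. c * cis (l * t) + V t) \<in> trigs C {..<\<theta>}"
      using UV step by (intro trigs.step) auto
    then show ?thesis using UV by (intro bexI[of _ U] bexI[of _ "\<lambda>t. c * cis (l * t) + V t"]) auto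
  qed
qed

section \<open>Dyadic layers and interpolation to real exponents\<close>

lemma dyadic_powr_Suc: "(2 ^ Suc j :: real) powr a = 2 powr a * (2 ^ j) powr a"
  by (simp add: powr_mult)

lemma two_le_two_powr: "a \<ge> 1 \<Longrightarrow> (2::real) \<le> 2 powr a"
  using powr_mono[of 1 a "2::real"] by simp

lemma dyadic_sum_le:
  fixes a :: real assumes "a \<ge> 1"
  shows "(\<Sum>j\<le>L. (2 ^ j :: real) powr a) \<le> 2 * (2 ^ L) powr a"
proof (induction L)
  case (Suc L)
  have "2 * (2 ^ L :: real) powr a \<le> (2 ^ Suc L) powr a"
    unfolding dyadic_powr_Suc using two_le_two_powr[OF assms] by (intro mult_right_mono) auto
  with Suc show ?case by simp
qed simp

lemma dyadic_sum_below:
  fixes a r :: real assumes "a \<ge> 1" "r \<ge> 0"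
  shows "(\<Sum>j\<le>L. if 2 ^ j \<le> r then (2 ^ j) powr a else 0) \<le> 2 * r powr a"
proof (induction L)
  case (Suc L)
  show ?case
  proof (cases "2 ^ Suc L \<le> r")
    case True
    have "(\<Sum>j\<le>Suc L. if 2 ^ j \<le> r then (2 ^ j) powr a else 0) \<le> (\<Sum>j\<le>Suc L. (2 ^ j :: real) powr a)"
      by (intro sum_mono) auto
    also have "\<dots> \<le> 2 * (2 ^ Suc L) powr a"
      by (rule dyadic_sum_le[OF assms(1)])
    also have "\<dots> \<le> 2 * r powr a"
      using True assms by (intro mult_left_mono powr_mono2) auto
    finally show ?thesis .
  qed (use Suc in simp)
next
  case 0
  then show ?case using assms ge_one_powr_ge_zero[of r a] by (cases "1 \<le> r") auto
qed

lemma dyadic_sum_above: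
  fixes d r :: real assumes "d \<ge> 1" "r > 0"
  shows "(\<Sum>j\<le>L. if r < 2 ^ j then (2 ^ j) powr (- d) else 0) \<le> 2 * r powr (- d)"
proof -
  let ?S = "\<lambda>L. (\<Sum>j\<le>L. if r < 2 ^ j then (2 ^ j) powr (- d) else 0)"
  have anti: "x powr (- d) \<le> r powr (- d)" if "r < x" for x
    using assms that by (intro powr_mono2') auto
  \<comment> \<open>Subtracting the last term makes the induction work: each term is at least twice
    its successor, so the new term is paid for by the old one.\<close>
  have "(r < 2 ^ L \<longrightarrow> ?S L \<le> 2 * r powr (- d) - (2 ^ L) powr (- d)) \<and> (2 ^ L \<le> r \<longrightarrow> ?S L = 0)"
  proof (induction L)
    case 0
    then show ?case using anti[of 1] by auto
  next
    case (Suc L)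
    have half: "2 * (2 ^ Suc L :: real) powr (- d) \<le> (2 ^ L) powr (- d)"
    proof -
      have "2 * (2 powr (- d)) \<le> (1::real)"
        using two_le_two_powr[OF assms(1)] by (simp add: powr_minus divide_simps)
      then have "(2 * 2 powr (- d)) * (2 ^ L :: real) powr (- d) \<le> 1 * (2 ^ L) powr (- d)"
        by (intro mult_right_mono) auto
      then show ?thesis unfolding dyadic_powr_Suc by (simp add: mult.assoc)
    qed
    show ?case
    proof (intro conjI impI)
      assume r: "r < 2 ^ Suc L"
      show "?S (Suc L) \<le> 2 * r powr (- d) - (2 ^ Suc L) powr (- d)"
        using Suc half anti[OF r] r by (cases "r < 2 ^ L") auto
    next
      assume "2 ^ Suc L \<le> r"
      then show "?S (Suc L) = 0" using Suc assms by simp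
    qed
  qed
  then show ?thesis
    using powr_ge_zero[of "2 ^ L" "- d"] powr_ge_zero[of r "- d"] by linarith
qed

text \<open>The contribution of the bounded parts, measured in the upper exponent
  \<open>2 * m\<close>. Heights below \<open>r\<close> give a geometric series increasing with
  exponent \<open>p\<close>; heights above \<open>r\<close> give one decreasing with exponent
  \<open>2 * m - p\<close>, which is at least 1. Both are dominated by the term near
  \<open>r\<close>.\<close>

lemma layer_low:
  fixes p r :: real
  assumes p: "p \<ge> 1" "p + 1 \<le> 2 * real m" and r: "r \<ge> 0"
  shows "(\<Sum>j\<le>L. (2 ^ j) powr (p - 2 * real m) * min r (2 ^ j) ^ (2 * m)) \<le> 4 * r powr p"
proof (cases "r = 0")
  case True
  have "m > 0" using p by (cases m) auto
  then show ?thesis using True by (simp add: min_def power_0_left)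
next
  case False
  with r have r: "r > 0" by simp
  have "(2 ^ j) powr (p - 2 * real m) * min r (2 ^ j) ^ (2 * m) \<le>
      (if 2 ^ j \<le> r then (2 ^ j) powr p else 0) +
      r ^ (2 * m) * (if r < 2 ^ j then (2 ^ j) powr (- (2 * real m - p)) else 0)" for j
  proof (cases "2 ^ j \<le> r")
    case True
    have "(2 ^ j) powr (p - 2 * real m) * (2 ^ j) ^ (2 * m) = (2 ^ j :: real) powr p"
      by (simp add: powr_realpow[symmetric] powr_add[symmetric] del: power_mult)
    then show ?thesis using True by (simp add: min_def)
  qed (use r in auto)
  then have "(\<Sum>j\<le>L. (2 ^ j) powr (p - 2 * real m) * min r (2 ^ j) ^ (2 * m)) \<le>
     (\<Sum>j\<le>L. (if 2 ^ j \<le> r then (2 ^ j) powr p else 0)) +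
     r ^ (2 * m) * (\<Sum>j\<le>L. if r < 2 ^ j then (2 ^ j) powr (- (2 * real m - p)) else 0)"
    unfolding sum_distrib_left sum.distrib[symmetric] by (intro sum_mono)
  also have "\<dots> \<le> 2 * r powr p + r ^ (2 * m) * (2 * r powr (- (2 * real m - p)))"
    using p r by (intro add_mono mult_left_mono dyadic_sum_below dyadic_sum_above) auto
  also have "r ^ (2 * m) * (2 * r powr (- (2 * real m - p))) = 2 * r powr p"
    using r by (simp add: powr_realpow[symmetric] powr_add[symmetric])
  finally show ?thesis by simp
qed

text \<open>The contribution of the excess over the height \<open>2 ^ j\<close>, measured in
  exponent 2. Only heights below \<open>r\<close> occur, and \<open>p - 2 >= 1\<close> makes the
  series geometric.\<close>

lemma layer_high:
  fixes p r :: real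
  assumes p: "p \<ge> 3" and r: "r \<ge> 0"
  shows "(\<Sum>j\<le>L. (2 ^ j) powr (p - 2) * (max 0 (r - 2 ^ j))\<^sup>2) \<le> 2 * r powr p"
proof -
  have "(2 ^ j) powr (p - 2) * (max 0 (r - 2 ^ j))\<^sup>2 \<le> r\<^sup>2 * (if 2 ^ j \<le> r then (2 ^ j) powr (p - 2) else 0)" for j
  proof (cases "2 ^ j \<le> r")
    case True
    have "(max 0 (r - 2 ^ j))\<^sup>2 \<le> r\<^sup>2" using True r by (intro power_mono) auto
    then show ?thesis using True by (simp add: mult.commute mult_left_mono)
  qed auto
  then have "(\<Sum>j\<le>L. (2 ^ j) powr (p - 2) * (max 0 (r - 2 ^ j))\<^sup>2) \<le>
      r\<^sup>2 * (\<Sum>j\<le>L. if 2 ^ j \<le> r then (2 ^ j) powr (p - 2) else 0)"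
    unfolding sum_distrib_left by (intro sum_mono)
  also have "\<dots> \<le> r\<^sup>2 * (2 * r powr (p - 2))"
    using p r by (intro mult_left_mono dyadic_sum_below) auto
  also have "\<dots> = 2 * r powr p"
  proof (cases "r = 0")
    case False
    then have "r\<^sup>2 = r powr 2" using r by (simp add: powr_numeral)
    then show ?thesis by (simp add: powr_add[symmetric])
  qed simp
  finally show ?thesis .
qed

text \<open>At the dyadic level just below \<open>x / 2\<close>, one of \<open>u\<close>, \<open>v\<close> is at least as large as the level.\<close>

lemma weak_type_pointwise:
  fixes x p :: real
  assumes x: "0 \<le> x" "x < 2 ^ (L + 2)" and p: "p \<ge> 0"
    and uv: "\<And>j. j \<le> L \<Longrightarrow> x \<le> u j + v j" and nn: "\<And>j. u j \<ge> 0" "\<And>j. v j \<ge> 0"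
  shows "x powr p \<le> 2 powr p + 4 powr p * (\<Sum>j\<le>L. (2 ^ j) powr (p - 2 * real m) * u j ^ (2 * m)
                                                + (2 ^ j) powr (p - 2) * (v j)\<^sup>2)"
    (is "_ \<le> _ + _ * ?S")
proof -
  have S0: "?S \<ge> 0" using nn by (intro sum_nonneg) auto
  show ?thesis
  proof (cases "x \<le> 2")
    case True
    then have "x powr p \<le> 2 powr p" using x p by (intro powr_mono2) auto
    with S0 show ?thesis by (simp add: add_increasing2)
  next
    case False
    define j where "j = (LEAST j. x < 2 ^ (j + 2))"
    have j: "x < 2 ^ (j + 2)" "j \<le> L"
      using LeastI[of "\<lambda>j. x < 2 ^ (j + 2)", OF x(2)] Least_le[of "\<lambda>j. x < 2 ^ (j + 2)", OF x(2)]
      unfolding j_def by auto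
    have lo: "2 ^ (j + 1) \<le> x"
    proof (cases j)
      case 0 then show ?thesis using False by simp
    next
      case (Suc i)
      then have "\<not> x < 2 ^ (i + 2)" unfolding j_def using not_less_Least by (metis lessI)
      then show ?thesis using Suc by simp
    qed
    define q where "q = (2 ^ j :: real)"
    have q: "q > 0" by (simp add: q_def)
    have lev: "q powr p \<le> q powr (p - 2 * real m) * u j ^ (2 * m) + q powr (p - 2) * (v j)\<^sup>2"
    proof (cases "u j \<ge> q")
      case True
      have "q powr p = q powr (p - 2 * real m) * q ^ (2 * m)"
        using q by (simp add: powr_realpow[symmetric] powr_add[symmetric])
      also have "\<dots> \<le> q powr (p - 2 * real m) * u j ^ (2 * m)"
        using True q by (intro mult_left_mono power_mono) auto
      finally show ?thesis by (simp add: add_increasing2)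
    next
      case False
      then have "v j \<ge> q" using uv[OF j(2)] lo by (simp add: q_def)
      have "q powr p = q powr (p - 2) * q\<^sup>2"
        using q powr_add[of q "p - 2" 2] by (simp add: powr_numeral)
      also have "\<dots> \<le> q powr (p - 2) * (v j)\<^sup>2"
        using \<open>v j \<ge> q\<close> q by (intro mult_left_mono power_mono) auto
      finally show ?thesis using nn by (simp add: add_increasing)
    qed
    have "x powr p \<le> (4 * q) powr p"
      using x j p by (intro powr_mono2) (auto simp: q_def)
    also have "\<dots> = 4 powr p * q powr p" using q by (simp add: powr_mult)
    also have "\<dots> \<le> 4 powr p * ?S"
    proof (rule mult_left_mono)
      have "q powr (p - 2 * real m) * u j ^ (2 * m) + q powr (p - 2) * (v j)\<^sup>2 \<le> ?S"
        unfolding q_def by (rule member_le_sum) (use j(2) nn in auto)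
      with lev show "q powr p \<le> ?S" by linarith
    qed simp
    finally show ?thesis using powr_ge_zero[of 2 p] by linarith
  qed
qed

lemma add_power_le:
  fixes x y :: real assumes "x \<ge> 0" "y \<ge> 0"
  shows "(x + y) ^ n \<le> 2 ^ n * (x ^ n + y ^ n)"
proof -
  have "(x + y) ^ n \<le> (2 * max x y) ^ n" using assms by (intro power_mono) auto
  also have "\<dots> \<le> 2 ^ n * (x ^ n + y ^ n)"
    using assms by (simp add: power_mult_distrib max_def)
  finally show ?thesis .
qed

lemma trigs_uminus: "f \<in> trigs UNIV G \<Longrightarrow> (\<lambda>t. - f t) \<in> trigs UNIV G"
  using trigs_mult_monom[of f UNIV G "-1" 0 "{0}" G] by simp

lemma trigs_diff: "f \<in> trigs UNIV G \<Longrightarrow> g \<in> trigs UNIV G \<Longrightarrow> (\<lambda>t. f t - g t) \<in> trigs UNIV G"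
  using trigs_add[OF _ trigs_uminus] by force

text \<open>Marcinkiewicz interpolation between the exponents \<open>2\<close> and \<open>2 m\<close>.\<close>

lemma riesz_interpolation:
  assumes P: "P \<in> trigs UNIV {\<theta>..}" and R: "R \<in> trigs UNIV {..<\<theta>}"
    and p: "p \<ge> 3" "p + 1 \<le> 2 * real m"
  shows "mean (\<lambda>t. norm (P t) powr p) \<le>
    2 powr p + 4 powr p * (4 * (3 * real m) ^ (2 * m) * 4 ^ m * (4 * mean (\<lambda>t. norm (P t + R t) powr p) + 1)
                           + 144 * (2 * mean (\<lambda>t. norm (P t + R t) powr p) + 1))"
proof -
  define F where "F = (\<lambda>t. P t + R t)"
  define Km where "Km = 4 * (3 * real m) ^ (2 * m)"
  have Km0: "Km \<ge> 0" by (simp add: Km_def)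
  have m: "m \<ge> 1" using p by (cases m) auto
  have apP: "ap UNIV UNIV P" by (rule ap_UNIV[OF trigs_ap[OF P]])
  have apF: "ap UNIV UNIV F" unfolding F_def by (intro ap_add apP ap_UNIV[OF trigs_ap[OF R]])
  obtain B where B: "\<And>t. norm (P t) \<le> B" using ap_bounded[OF apP] by blast
  \<comment> \<open>\<open>P\<close> is bounded, so finitely many truncation heights
    \<open>2 ^ j\<close> with \<open>j <= L\<close> are enough.\<close>
  obtain L0 where "B < 2 ^ L0" using real_arch_pow[of 2 B] by auto
  moreover define L where "L = L0"
  ultimately have L: "norm (P t) < 2 ^ (L + 2)" for t
    using B[of t] by (simp add: le_less_trans[of _ B]) (smt (verit) zero_less_power)
  \<comment> \<open>The precision \<open>e\<close> is chosen so that approximation errors, weighted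
    by at most \<open>(2 ^ L) powr p\<close> and summed over the \<open>L + 1\<close> layers, total
    at most 1. They produce the two summands \<open>+ 1\<close> in the conclusion.\<close>
  define e where "e = 1 / ((real L + 1) * (2 ^ L) powr p)"
  have pos: "(real L + 1) * (2 ^ L) powr p \<ge> 1 * 1"
    using p by (intro mult_mono ge_one_powr_ge_zero) auto
  then have e: "0 < e" "e \<le> 1" unfolding e_def by (auto simp: divide_simps)
  \<comment> \<open>Multiplication by \<open>phi j (norm (F t))\<close> caps the modulus of
    \<open>F t\<close> at \<open>2 ^ j\<close> and keeps its argument. Being a continuous function
    of the norm, it preserves almost periodicity.\<close>
  define phi where "phi = (\<lambda>j::nat. \<lambda>r::real. 2 ^ j / max (2 ^ j) r)"
  have max0: "max (2 ^ j) r \<noteq> (0 :: real)" for j :: nat and r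
    by (metis less_max_iff_disj less_irrefl zero_less_power zero_less_numeral)
  have phi_ap: "ap UNIV UNIV (\<lambda>t. F t * of_real (phi j (norm (F t))))" for j
    unfolding phi_def
    by (intro ap_group_mult ap_continuous_norm apF) (auto intro!: continuous_intros max0)
  \<comment> \<open>The capped function is only almost periodic. It is replaced by a nearby
    trigonometric polynomial, which can be split at \<open>\<theta>\<close> and to which the
    even-exponent inequality applies.\<close>
  have "\<exists>\<tau>. \<tau> \<in> trigs UNIV UNIV \<and> (\<forall>t. norm (F t * of_real (phi j (norm (F t))) - \<tau> t) < e)" for j
    using phi_ap[of j] e unfolding ap_def by blast
  then obtain \<tau> where \<tau>: "\<And>j. \<tau> j \<in> trigs UNIV UNIV"
      "\<And>j t. norm (F t * of_real (phi j (norm (F t))) - \<tau> j t) < e" by metis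
  obtain U V where UV: "\<And>j. U j \<in> trigs UNIV {\<theta>..}" "\<And>j. V j \<in> trigs UNIV {..<\<theta>}"
      "\<And>j t. \<tau> j t = U j t + V j t"
    using trigs_split[OF \<tau>(1), of \<theta>] by metis
  have ap\<tau>: "ap UNIV UNIV (\<tau> j)" "ap UNIV UNIV (\<lambda>t. F t - \<tau> j t)"
      "ap UNIV UNIV (U j)" "ap UNIV UNIV (\<lambda>t. P t - U j t)" for j
    using ap_add[OF apF ap_UNIV[OF trigs_ap[OF trigs_uminus[OF \<tau>(1)[of j]]]]]
      ap_UNIV[OF trigs_ap[OF trigs_diff[OF P UV(1)]]] trigs_ap[OF \<tau>(1)]
      ap_UNIV[OF trigs_ap[OF UV(1)]] by auto
  have even1: "mean (\<lambda>t. norm (U j t) ^ (2 * m)) \<le> Km * mean (\<lambda>t. norm (\<tau> j t) ^ (2 * m))" for j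
    using riesz_even[OF UV(1,2) m, of j j] by (simp add: Km_def UV(3))
  \<comment> \<open>\<open>P - U j\<close> is the upper part of \<open>F - \<tau> j\<close>. The
    constant is \<open>4 * (3 * m) ^ (2 * m)\<close> at \<open>m = 1\<close>.\<close>
  have even2: "mean (\<lambda>t. (norm (P t - U j t))\<^sup>2) \<le> 36 * mean (\<lambda>t. (norm (F t - \<tau> j t))\<^sup>2)" for j
    using riesz_even[OF trigs_diff[OF P UV(1)] trigs_diff[OF R UV(2)], of 1 j j]
    by (simp add: UV(3) F_def add_diff_add)
  have trunc: "norm (F t * of_real (phi j (norm (F t)))) = min (norm (F t)) (2 ^ j)"
      "norm (F t - F t * of_real (phi j (norm (F t)))) = max 0 (norm (F t) - 2 ^ j)" for j t
  proof -
    define r where "r = norm (F t)"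
    have r0: "r \<ge> 0" by (simp add: r_def)
    have "max (2 ^ j) r > 0" using max0[of j r] by (simp add: less_max_iff_disj)
    then have 1: "0 \<le> phi j r" "phi j r \<le> 1" by (auto simp: phi_def divide_le_eq_1)
    have 2: "r * phi j r = min r (2 ^ j)"
      by (auto simp: phi_def max_def min_def field_simps)
    show "norm (F t * of_real (phi j (norm (F t)))) = min (norm (F t)) (2 ^ j)"
      using 1 2 by (simp add: norm_mult r_def)
    have "F t - F t * of_real (phi j (norm (F t))) = F t * of_real (1 - phi j r)"
      by (simp add: r_def algebra_simps)
    moreover have "norm (F t * of_real (1 - phi j r)) = r * (1 - phi j r)"
      using 1 by (simp add: norm_mult r_def del: of_real_diff)
    ultimately have "norm (F t - F t * of_real (phi j (norm (F t)))) = r - r * phi j r"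
      by (simp only: right_diff_distrib mult_1_right)
    then show "norm (F t - F t * of_real (phi j (norm (F t)))) = max 0 (norm (F t) - 2 ^ j)"
      unfolding 2 by (auto simp: r_def)
  qed
  have low: "norm (\<tau> j t) ^ (2 * m) \<le> 4 ^ m * (min (norm (F t)) (2 ^ j) ^ (2 * m) + e)" for j t
  proof -
    have "norm (\<tau> j t) \<le> min (norm (F t)) (2 ^ j) + e"
      using \<tau>(2)[of t j] norm_triangle_sub[of "\<tau> j t" "F t * of_real (phi j (norm (F t)))"]
      unfolding trunc by (simp add: norm_minus_commute)
    then have "norm (\<tau> j t) ^ (2 * m) \<le> (min (norm (F t)) (2 ^ j) + e) ^ (2 * m)"
      by (intro power_mono) auto
    also have "\<dots> \<le> 2 ^ (2 * m) * (min (norm (F t)) (2 ^ j) ^ (2 * m) + e ^ (2 * m))"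
      using e by (intro add_power_le) auto
    also have "e ^ (2 * m) \<le> e"
      using e m power_decreasing[of 1 "2 * m" e] by simp
    finally show ?thesis by (simp add: power_mult)
  qed
  have high: "(norm (F t - \<tau> j t))\<^sup>2 \<le> 4 * ((max 0 (norm (F t) - 2 ^ j))\<^sup>2 + e)" for j t
  proof -
    have "norm (F t - \<tau> j t) \<le> max 0 (norm (F t) - 2 ^ j) + e"
      using \<tau>(2)[of t j] norm_triangle_ineq[of "F t - F t * of_real (phi j (norm (F t)))" "F t * of_real (phi j (norm (F t))) - \<tau> j t"]
      unfolding trunc by simp
    then have "(norm (F t - \<tau> j t))\<^sup>2 \<le> (max 0 (norm (F t) - 2 ^ j) + e)\<^sup>2"
      by (intro power_mono) auto
    also have "\<dots> \<le> 2\<^sup>2 * ((max 0 (norm (F t) - 2 ^ j))\<^sup>2 + e\<^sup>2)"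
      using e by (intro add_power_le) auto
    also have "e\<^sup>2 \<le> e"
      using e power_decreasing[of 1 2 e] by simp
    finally show ?thesis by simp
  qed
  have coef1: "(2 ^ j :: real) powr (p - 2 * real m) * e \<le> 1 / (real L + 1)"
    and coef2: "(2 ^ j :: real) powr (p - 2) * e \<le> 1 / (real L + 1)" if "j \<le> L" for j
  proof -
    have 1: "(2 ^ j :: real) powr q \<le> (2 ^ L) powr p" if "q \<le> p" for q
    proof -
      have "(2 ^ j :: real) powr q \<le> (2 ^ j) powr p" using that by (intro powr_mono) auto
      also have "\<dots> \<le> (2 ^ L) powr p" using p \<open>j \<le> L\<close> by (intro powr_mono2) auto
      finally show ?thesis .
    qed
    have "(2 ^ j :: real) powr q * e \<le> 1 / (real L + 1)" if "q \<le> p" for q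
      using 1[OF that] by (simp add: e_def divide_simps)
    then show "(2 ^ j :: real) powr (p - 2 * real m) * e \<le> 1 / (real L + 1)"
      "(2 ^ j :: real) powr (p - 2) * e \<le> 1 / (real L + 1)" by auto
  qed
  let ?c = "\<lambda>j::nat. (2 ^ j :: real) powr (p - 2 * real m)" and ?d = "\<lambda>j::nat. (2 ^ j :: real) powr (p - 2)"
  let ?M = "mean (\<lambda>t. norm (F t) powr p)"
  have rF: "rap (\<lambda>t. norm (F t) powr p)" using p by (intro rap_norm_powr apF) auto
  let ?q = "1 / (real L + 1)" and ?lo = "\<lambda>j t. min (norm (F t)) (2 ^ j) ^ (2 * m)"
    and ?hi = "\<lambda>j t. (max 0 (norm (F t) - 2 ^ j))\<^sup>2"
  have sum1: "(\<Sum>j\<le>L. ?c j * norm (\<tau> j t) ^ (2 * m)) \<le> 4 ^ m * (4 * norm (F t) powr p + 1)" for t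
  proof -
    have "(\<Sum>j\<le>L. ?c j * norm (\<tau> j t) ^ (2 * m)) \<le>
       (\<Sum>j\<le>L. 4 ^ m * (?c j * ?lo j t + ?q))"
    proof (rule sum_mono)
      fix j assume "j \<in> {..L}"
      then have "?c j * norm (\<tau> j t) ^ (2 * m) \<le>
          ?c j * (4 ^ m * (?lo j t + e))"
        using low[of j t] by (intro mult_left_mono) auto
      also have "\<dots> = 4 ^ m * (?c j * ?lo j t + ?c j * e)"
        by (simp add: algebra_simps)
      also have "\<dots> \<le> 4 ^ m * (?c j * ?lo j t + ?q)"
        using coef1[of j] \<open>j \<in> {..L}\<close> by (intro mult_left_mono add_left_mono) auto
      finally show "?c j * norm (\<tau> j t) ^ (2 * m) \<le> \<dots>" .
    qed
    also have "\<dots> = 4 ^ m * ((\<Sum>j\<le>L. ?c j * ?lo j t) + 1)"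
      by (simp add: sum_distrib_left[symmetric] sum.distrib)
    also have "\<dots> \<le> 4 ^ m * (4 * norm (F t) powr p + 1)"
      using p by (intro mult_left_mono add_right_mono layer_low) auto
    finally show ?thesis .
  qed
  have sum2: "(\<Sum>j\<le>L. ?d j * (norm (F t - \<tau> j t))\<^sup>2) \<le> 4 * (2 * norm (F t) powr p + 1)" for t
  proof -
    have "(\<Sum>j\<le>L. ?d j * (norm (F t - \<tau> j t))\<^sup>2) \<le>
       (\<Sum>j\<le>L. 4 * (?d j * ?hi j t + ?q))"
    proof (rule sum_mono)
      fix j assume "j \<in> {..L}"
      then have "?d j * (norm (F t - \<tau> j t))\<^sup>2 \<le>
          ?d j * (4 * (?hi j t + e))"
        using high[of t j] by (intro mult_left_mono) auto
      also have "\<dots> = 4 * (?d j * ?hi j t + ?d j * e)"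
        by (simp add: algebra_simps)
      also have "\<dots> \<le> 4 * (?d j * ?hi j t + ?q)"
        using coef2[of j] \<open>j \<in> {..L}\<close> by (intro mult_left_mono add_left_mono) auto
      finally show "?d j * (norm (F t - \<tau> j t))\<^sup>2 \<le> \<dots>" .
    qed
    also have "\<dots> = 4 * ((\<Sum>j\<le>L. ?d j * ?hi j t) + 1)"
      by (simp add: sum_distrib_left[symmetric] sum.distrib) (simp add: divide_simps add.commute)
    also have "\<dots> \<le> 4 * (2 * norm (F t) powr p + 1)"
      using p by (intro mult_left_mono add_right_mono layer_high) auto
    finally show ?thesis .
  qed
  note raps = rap_add rap_cmult rap_sum rap_norm_power rap_norm_powr rap_const ap\<tau> apF apP
  have "mean (\<lambda>t. norm (P t) powr p) \<le> mean (\<lambda>t. 2 powr p + 4 powr p *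
     (\<Sum>j\<le>L. ?c j * norm (U j t) ^ (2 * m) + ?d j * (norm (P t - U j t))\<^sup>2))"
    using p L by (intro mean_mono raps weak_type_pointwise) (auto intro: norm_triangle_sub)
  also have "\<dots> = 2 powr p + 4 powr p * (\<Sum>j\<le>L. ?c j * mean (\<lambda>t. norm (U j t) ^ (2 * m)) + ?d j * mean (\<lambda>t. (norm (P t - U j t))\<^sup>2))"
    by (simp add: mean_add mean_cmult mean_sum mean_const raps)
  also have "\<dots> \<le> 2 powr p + 4 powr p * (\<Sum>j\<le>L. ?c j * (Km * mean (\<lambda>t. norm (\<tau> j t) ^ (2 * m))) + ?d j * (36 * mean (\<lambda>t. (norm (F t - \<tau> j t))\<^sup>2)))"
    by (intro add_left_mono mult_left_mono sum_mono add_mono even1 even2) auto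
  also have "\<dots> = 2 powr p + 4 powr p * (Km * mean (\<lambda>t. \<Sum>j\<le>L. ?c j * norm (\<tau> j t) ^ (2 * m)) +
       36 * mean (\<lambda>t. \<Sum>j\<le>L. ?d j * (norm (F t - \<tau> j t))\<^sup>2))"
    by (simp add: mean_cmult mean_sum raps sum.distrib sum_distrib_left mult.left_commute)
  also have "\<dots> \<le> 2 powr p + 4 powr p * (Km * mean (\<lambda>t. 4 ^ m * (4 * norm (F t) powr p + 1)) +
       36 * mean (\<lambda>t. 4 * (2 * norm (F t) powr p + 1)))"
    using p by (intro add_left_mono mult_left_mono add_mono mean_mono sum1 sum2 raps Km0) auto
  also have "\<dots> = 2 powr p + 4 powr p * (Km * 4 ^ m * (4 * ?M + 1) + 144 * (2 * ?M + 1))"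
    using p by (simp add: mean_cmult mean_add mean_const raps rF)
  finally show ?thesis by (simp add: F_def Km_def)
qed

text \<open>The endpoint \<open>m\<close>, the ceiling of \<open>k\<close> plus 1, satisfies both
  \<open>2 * k + 1 <= 2 * m\<close> and \<open>m <= 2 * k\<close>, so that
  \<open>(3 * m) ^ (2 * m)\<close> is at most an exponential of a multiple of \<open>k^2\<close>.
  The inequality is inhomogeneous: the summand 1 absorbs the places where \<open>P\<close> is small
  and the approximation errors.\<close>

lemma riesz_real:
  assumes P: "P \<in> trigs UNIV {\<theta>..}" and R: "R \<in> trigs UNIV {..<\<theta>}" and k: "k \<ge> 2"
  shows "mean (\<lambda>t. norm (P t) powr (2 * k)) \<le> exp (200 * k\<^sup>2) * (1 + mean (\<lambda>t. norm (P t + R t) powr (2 * k)))"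
proof -
  define m where "m = nat \<lceil>k\<rceil> + 1"
  have m: "k + 1 \<le> real m" "real m \<le> 2 * k"
    using k unfolding m_def by linarith+
  define M where "M = mean (\<lambda>t. norm (P t + R t) powr (2 * k))"
  have "ap UNIV UNIV (\<lambda>t. P t + R t)"
    by (intro ap_add ap_UNIV[OF trigs_ap[OF P]] ap_UNIV[OF trigs_ap[OF R]])
  then have M: "M \<ge> 0"
    using k unfolding M_def by (intro mean_nonneg rap_norm_powr) auto
  have kk: "2 * k \<le> k\<^sup>2" "4 \<le> k\<^sup>2"
    using k mult_right_mono[of 2 k k] mult_mono[of 2 k 2 k] by (auto simp: power2_eq_square)
  have e2: "x powr y \<le> exp (x * y)" if "x > 0" "y \<ge> 0" for x y :: real
    using that mult_left_mono[of "ln x" x y] ln_bound[of x] by (simp add: powr_def mult.commute)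
  have a: "(4::real) powr (2 * k) \<le> exp (4 * k\<^sup>2)"
  proof -
    have "(4::real) powr (2 * k) \<le> exp (4 * (2 * k))" using k by (intro e2) auto
    also have "\<dots> \<le> exp (4 * k\<^sup>2)" using kk by simp
    finally show ?thesis .
  qed
  have b: "(2::real) powr (2 * k) \<le> exp (4 * k\<^sup>2)"
    using a powr_mono2[of "2 * k" 2 4] k by linarith
  have c: "(4::real) ^ m \<le> exp (4 * k\<^sup>2)"
  proof -
    have "(4::real) ^ m \<le> 4 powr (2 * k)" using m by (simp flip: powr_realpow)
    with a show ?thesis by linarith
  qed
  have d: "(3 * real m) ^ (2 * m) \<le> exp (24 * k\<^sup>2)"
  proof -
    have "(3 * real m) ^ (2 * m) = (3 * real m) powr (2 * real m)"
      using m k powr_realpow[of "3 * real m" "2 * m"] by simp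
    also have "\<dots> \<le> exp (3 * real m * (2 * real m))" using m k by (intro e2) auto
    also have "\<dots> \<le> exp (6 * (2 * k)\<^sup>2)"
      using m k power_mono[of "real m" "2 * k" 2] by (simp add: power2_eq_square)
    finally show ?thesis by (simp add: power_mult_distrib)
  qed
  have num: "596 \<le> exp (150 * k\<^sup>2)"
    using exp_ge_add_one_self[of "150 * k\<^sup>2"] kk by linarith
  define E where "E = exp (4 * k\<^sup>2)"
  have E: "E \<ge> 1" by (simp add: E_def)
  define D where "D = exp (24 * k\<^sup>2)"
  have D: "D \<ge> 1" by (simp add: D_def)
  have "mean (\<lambda>t. norm (P t) powr (2 * k)) \<le>
      2 powr (2 * k) + 4 powr (2 * k) * (4 * (3 * real m) ^ (2 * m) * 4 ^ m * (4 * M + 1) + 144 * (2 * M + 1))"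
    unfolding M_def using m k by (intro riesz_interpolation[OF P R]) auto
  also have "\<dots> \<le> E + E * (4 * D * E * (4 * M + 1) + 144 * (2 * M + 1))"
    using a b c d M E D unfolding E_def[symmetric] D_def[symmetric]
    by (intro add_mono mult_mono mult_nonneg_nonneg add_nonneg_nonneg) auto
  also have "\<dots> \<le> E * (D * E * (4 * (1 + M))) + E * (4 * D * E * (4 * (1 + M)) + D * E * (144 * (4 * (1 + M))))"
  proof -
    have DE: "1 \<le> D * E" using D E mult_mono[of 1 D 1 E] by simp
    have "1 * 1 \<le> D * E * (4 * (1 + M))" using DE M by (intro mult_mono) auto
    then have "E * 1 \<le> E * (D * E * (4 * (1 + M)))" using E by (intro mult_left_mono) auto
    moreover have "1 * (144 * (2 * M + 1)) \<le> D * E * (144 * (4 * (1 + M)))"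
      using DE M by (intro mult_mono) auto
    moreover have "4 * D * E * (4 * M + 1) \<le> 4 * D * E * (4 * (1 + M))"
      using D E M by (intro mult_left_mono) auto
    ultimately show ?thesis
      using E D by (intro add_mono mult_left_mono) auto
  qed
  \<comment> \<open>The coefficient is 4 + 4 * 4 + 144 * 4.\<close>
  also have "\<dots> = 596 * (E * E * D) * (1 + M)" by (simp add: algebra_simps)
  also have "\<dots> \<le> exp (150 * k\<^sup>2) * (E * E * D) * (1 + M)"
    using num E D M by (intro mult_right_mono) auto
  also have "exp (150 * k\<^sup>2) * (E * E * D) = exp (182 * k\<^sup>2)"
    by (simp add: E_def D_def flip: exp_add)
  also have "exp (182 * k\<^sup>2) * (1 + M) \<le> exp (200 * k\<^sup>2) * (1 + M)"
    using M by (intro mult_right_mono) auto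
  finally show ?thesis by (simp add: M_def)
qed

section \<open>Sums over primes\<close>

definition primes_upto :: "nat \<Rightarrow> nat set" where
  "primes_upto n = {p. prime p \<and> p \<le> n}"

lemma finite_primes_upto [simp]: "finite (primes_upto n)"
  by (rule finite_subset[of _ "{..n}"]) (auto simp: primes_upto_def)

lemma prime_power_dvd_fact:
  "prime (p::nat) \<Longrightarrow> p ^ (n div p) dvd fact n"
proof -
  have *: "p ^ m dvd fact (p * m)" if "p > 0" for m
  proof (induction m)
    case (Suc m)
    have "fact (p * m) * p dvd fact (p * m) * (p * Suc m)" by simp
    moreover have "fact (p * m) * (p * Suc m) dvd (fact (p * Suc m) :: nat)"
    proof -
      have "fact (p * Suc m) = (p * Suc m) * (fact (p * Suc m - 1) :: nat)"
        using that by (simp add: fact_reduce)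
      moreover have "fact (p * m) dvd (fact (p * Suc m - 1) :: nat)"
        using that by (intro fact_dvd) auto
      ultimately show ?thesis by (simp only: mult.commute[of "fact (p * m)"] mult_dvd_mono dvd_refl)
    qed
    ultimately have "fact (p * m) * p dvd (fact (p * Suc m) :: nat)" by (rule dvd_trans)
    moreover have "p ^ Suc m dvd fact (p * m) * p" using Suc by (simp add: mult.commute)
    ultimately show ?case by (rule dvd_trans[rotated])
  qed simp
  assume "prime p"
  then show ?thesis
    using dvd_trans[OF *[of "n div p"] fact_dvd[of "p * (n div p)" n]] prime_gt_0_nat[of p] by simp
qed

lemma prod_dvd_of_pairwise_coprime:
  fixes f :: "'a \<Rightarrow> nat"
  assumes "finite S" "\<And>i. i \<in> S \<Longrightarrow> f i dvd m" "\<And>i j. i \<in> S \<Longrightarrow> j \<in> S \<Longrightarrow> i \<noteq> j \<Longrightarrow> coprime (f i) (f j)"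
  shows "(\<Prod>i\<in>S. f i) dvd m"
  using assms
proof (induction S rule: finite_induct)
  case (insert i S)
  have "coprime (f i) (\<Prod>j\<in>S. f j)"
    using insert.hyps(2) insert.prems(2) by (intro prod_coprime_right) auto
  then show ?case using insert by (simp add: divides_mult)
qed simp

text \<open>The upper half of Mertens' first theorem. The powers \<open>p ^ (n div p)\<close> of
  distinct primes are coprime divisors of \<open>fact n\<close>, which is at most
  \<open>n ^ n\<close>; taking logarithms and using \<open>n div p >= n / (2 p)\<close> for
  \<open>p <= n\<close> gives the bound.\<close>

lemma sum_ln_prime_le: "(\<Sum>p\<in>primes_upto n. ln (real p) / real p) \<le> 2 * ln (real n)"
proof (cases "n \<ge> 2")
  case True
  have "(\<Prod>p\<in>primes_upto n. p ^ (n div p)) dvd (fact n :: nat)"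
  proof (rule prod_dvd_of_pairwise_coprime)
    fix p q assume "p \<in> primes_upto n" "q \<in> primes_upto n" "p \<noteq> q"
    then have "coprime p q" by (simp add: primes_upto_def primes_coprime)
    then show "coprime (p ^ (n div p)) (q ^ (n div q))" by simp
  qed (simp_all add: primes_upto_def prime_power_dvd_fact)
  then have "(\<Prod>p\<in>primes_upto n. p ^ (n div p)) \<le> (fact n :: nat)"
    by (rule dvd_imp_le) (rule fact_gt_zero)
  also have "\<dots> \<le> n ^ n" using fact_le_power[of n, where 'a = nat] by simp
  finally have "real (\<Prod>p\<in>primes_upto n. p ^ (n div p)) \<le> real (n ^ n)" by (rule of_nat_mono)
  then have "ln (\<Prod>p\<in>primes_upto n. real p ^ (n div p)) \<le> ln (real n ^ n)"
  proof (intro ln_mono)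
    show "0 < (\<Prod>p\<in>primes_upto n. real p ^ (n div p))"
      by (intro prod_pos) (simp add: primes_upto_def prime_gt_0_nat)
  qed simp_all
  then have "(\<Sum>p\<in>primes_upto n. real (n div p) * ln p) \<le> real n * ln n"
    using True by (subst (asm) ln_prod) (auto simp: primes_upto_def prime_gt_0_nat ln_realpow)
  moreover have "real n / 2 * (ln p / p) \<le> real (n div p) * ln p" if "p \<in> primes_upto n" for p
  proof -
    have p: "p \<ge> 2" "p \<le> n" using that by (auto simp: primes_upto_def prime_ge_2_nat)
    have "n < p * (n div p) + p" using p dividend_less_times_div[of p n] by simp
    moreover have "n div p \<ge> 1" using p by (simp add: Suc_le_eq div_greater_zero_iff)
    then have "p \<le> p * (n div p)" by simp
    ultimately have "n \<le> 2 * (p * (n div p))" by linarith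
    then have "real n \<le> real (2 * (p * (n div p)))" by (rule of_nat_mono)
    then have "real n \<le> 2 * (real p * real (n div p))" by simp
    then have "real n / 2 / real p \<le> real (n div p)" using p by (simp add: field_simps)
    then have "real n / 2 / real p * ln p \<le> real (n div p) * ln p" using p by (intro mult_right_mono) auto
    then show ?thesis by simp
  qed
  then have "(\<Sum>p\<in>primes_upto n. real n / 2 * (ln p / p)) \<le> (\<Sum>p\<in>primes_upto n. real (n div p) * ln p)"
    by (rule sum_mono)
  ultimately have "real n / 2 * (\<Sum>p\<in>primes_upto n. ln p / p) \<le> real n * ln n"
    unfolding sum_distrib_left[symmetric] by (rule order_trans[rotated])
  then show ?thesis using True by (simp add: field_simps)
next
  case False
  then have "primes_upto n = {}" by (auto simp: primes_upto_def dest: prime_ge_2_nat)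
  then show ?thesis using False by (cases n) auto
qed

text \<open>Exponent tuples bounded by \<open>J\<close> form a finite set, so a truncated Euler
  product expands exactly by distributivity. \<open>PiE\<close> fixes the values outside
  \<open>S\<close>, which makes tuple and integer correspond one to one.\<close>

definition exponents :: "nat set \<Rightarrow> nat \<Rightarrow> (nat \<Rightarrow> nat) set" where
  "exponents S J = PiE S (\<lambda>_. {..J})"

definition from_exponents :: "nat set \<Rightarrow> (nat \<Rightarrow> nat) \<Rightarrow> nat" where
  "from_exponents S g = (\<Prod>p\<in>S. p ^ g p)"

lemma finite_exponents: "finite S \<Longrightarrow> finite (exponents S J)"
  by (simp add: exponents_def finite_PiE)

lemma from_exponents_pos: "(\<And>p. p \<in> S \<Longrightarrow> prime p) \<Longrightarrow> from_exponents S g > 0"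
  unfolding from_exponents_def by (intro prod_pos) (auto simp: prime_gt_0_nat)

lemma from_exponents_powr:
  assumes "\<And>p. p \<in> S \<Longrightarrow> prime p"
  shows "real (from_exponents S g) powr r = (\<Prod>p\<in>S. (real p powr r) ^ g p)"
proof -
  have "real (from_exponents S g) powr r = (\<Prod>p\<in>S. (real p ^ g p) powr r)"
    unfolding from_exponents_def of_nat_prod of_nat_power by (rule prod_powr_distrib)
  also have "\<dots> = (\<Prod>p\<in>S. (real p powr r) ^ g p)"
    using assms by (intro prod.cong refl)
      (simp add: powr_powr powr_realpow[symmetric] mult.commute prime_gt_0_nat)
  finally show ?thesis .
qed

lemma multiplicity_from_exponents:
  assumes "finite S" "\<And>p. p \<in> S \<Longrightarrow> prime p" "p \<in> S"
  shows "multiplicity p (from_exponents S g) = g p"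
  unfolding from_exponents_def using assms by (subst multiplicity_prod_prime_powers) auto

lemma inj_from_exponents:
  assumes "finite S" "\<And>p. p \<in> S \<Longrightarrow> prime p"
  shows "inj_on (from_exponents S) (exponents S J)"
proof (rule inj_onI)
  fix g h assume gh: "g \<in> exponents S J" "h \<in> exponents S J" "from_exponents S g = from_exponents S h"
  show "g = h"
  proof (rule PiE_ext)
    show "g \<in> PiE S (\<lambda>_. {..J})" "h \<in> PiE S (\<lambda>_. {..J})"
      using gh by (auto simp: exponents_def)
    show "g p = h p" if "p \<in> S" for p
      using multiplicity_from_exponents[OF assms that, of g] multiplicity_from_exponents[OF assms that, of h] gh(3) by simp
  qed
qed

lemma from_exponents_surj:
  assumes "1 \<le> n" "n \<le> N" "N \<le> J"
  shows "n \<in> from_exponents (primes_upto N) ` exponents (primes_upto N) J"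
proof
  define g where "g = restrict (\<lambda>p. multiplicity p n) (primes_upto N)"
  have sub: "prime_factors n \<subseteq> primes_upto N"
  proof
    fix p assume "p \<in> prime_factors n"
    then have "prime p" "p \<le> n" using assms by (auto simp: in_prime_factors_iff intro: dvd_imp_le)
    then show "p \<in> primes_upto N" using assms by (simp add: primes_upto_def)
  qed
  have "n = (\<Prod>p\<in>prime_factors n. p ^ multiplicity p n)"
    using assms by (intro prime_factorization_nat) auto
  also have "\<dots> = (\<Prod>p\<in>primes_upto N. p ^ multiplicity p n)"
    using sub assms by (intro prod.mono_neutral_left)
      (auto simp: primes_upto_def in_prime_factors_iff not_dvd_imp_multiplicity_0)
  finally show "n = from_exponents (primes_upto N) g"
    by (simp add: from_exponents_def g_def)
  have "multiplicity p n \<le> J" if "prime p" for p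
  proof -
    have "multiplicity p n < 2 ^ multiplicity p n" by (rule less_exp)
    also have "\<dots> \<le> p ^ multiplicity p n" using prime_ge_2_nat[OF that] by (intro power_mono) auto
    also have "\<dots> \<le> n" using assms by (intro dvd_imp_le multiplicity_dvd) auto
    finally show ?thesis using assms by simp
  qed
  then show "g \<in> exponents (primes_upto N) J"
    by (auto simp: g_def exponents_def primes_upto_def)
qed

lemma harmonic_ge_ln: "ln (real n + 1) \<le> (\<Sum>m=1..n. 1 / real m)"
proof (induction n)
  case (Suc n)
  have "ln (real (Suc n) + 1) - ln (real n + 1) = ln (1 + 1 / real (Suc n))"
  proof -
    have "real (Suc n) + 1 = (real n + 1) * (1 + 1 / real (Suc n))" by (simp add: field_simps)
    then have "ln (real (Suc n) + 1) = ln (real n + 1) + ln (1 + 1 / real (Suc n))"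
      by (simp only: ln_mult_pos add_pos_pos zero_less_one of_nat_0_less_iff zero_less_Suc divide_pos_pos
          add_nonneg_pos of_nat_0_le_iff)
    then show ?thesis by simp
  qed
  also have "\<dots> \<le> 1 / real (Suc n)" by (rule ln_add_one_self_le_self) simp
  finally show ?case using Suc by simp
qed simp

lemma sum_inverse_squares_le:
  assumes "a \<ge> 1"
  shows "(\<Sum>m\<in>{a<..b}. 1 / (real m)\<^sup>2) \<le> 1 / real a"
proof -
  have "(\<Sum>m\<in>{a<..b}. 1 / (real m)\<^sup>2) \<le> 1 / real a - 1 / real (max a b)"
  proof (induction b)
    case (Suc b)
    show ?case
    proof (cases "a \<le> b")
      case True
      have "1 / (real (Suc b))\<^sup>2 \<le> 1 / (real b * real (Suc b))"
        using True assms by (intro divide_left_mono) (auto simp: power2_eq_square)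
      also have "\<dots> = 1 / real b - 1 / real (Suc b)" using True assms by (simp add: field_simps)
      finally show ?thesis using Suc True by (simp add: max_def atLeastSucAtMost_greaterThanAtMost[symmetric] sum.cl_ivl_Suc)
    next
      case False
      then have "{a<..Suc b} = {}" by auto
      moreover have "max a (Suc b) = a" using False by simp
      ultimately show ?thesis by simp
    qed
  qed simp
  moreover have "0 \<le> 1 / real (max a b)" by simp
  ultimately show ?thesis by linarith
qed

lemma sum_prime_inverse_squares_le:
  assumes "Q \<ge> 1"
  shows "(\<Sum>p\<in>primes_upto n - primes_upto Q. 1 / (real p)\<^sup>2) \<le> 1 / real Q"
proof -
  have "(\<Sum>p\<in>primes_upto n - primes_upto Q. 1 / (real p)\<^sup>2) \<le> (\<Sum>m\<in>{Q<..n}. 1 / (real m)\<^sup>2)"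
    by (rule sum_mono2) (auto simp: primes_upto_def)
  then show ?thesis using sum_inverse_squares_le[OF assms, of n] by linarith
qed

lemma primes_upto_1: "primes_upto 1 = {}"
  by (auto simp: primes_upto_def dest: prime_gt_1_nat)

text \<open>Euler's argument: every \<open>m <= n\<close> occurs in the expanded product over
  \<open>p <= n\<close>, so the harmonic sum, at least \<open>ln n\<close>, is at most the product
  of the geometric series. Each series is at most \<open>exp (1 / p + 2 / p^2)\<close>.\<close>

lemma sum_prime_inverse_ge:
  assumes "n \<ge> 2"
  shows "ln (ln (real n)) - 2 \<le> (\<Sum>p\<in>primes_upto n. 1 / real p)"
proof -
  let ?S = "primes_upto n"
  have S: "finite ?S" "\<And>p. p \<in> ?S \<Longrightarrow> prime p" by (auto simp: primes_upto_def)
  have p2: "real p \<ge> 2" if "p \<in> ?S" for p using prime_ge_2_nat[OF S(2)[OF that]] by simp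
  have "ln (real n) \<le> ln (real n + 1)" using assms by simp
  also have "\<dots> \<le> (\<Sum>m=1..n. 1 / real m)" by (rule harmonic_ge_ln)
  also have "\<dots> \<le> (\<Sum>m\<in>from_exponents ?S ` exponents ?S n. 1 / real m)"
    by (rule sum_mono2) (use from_exponents_surj[of _ n n] finite_exponents[OF S(1)] in auto)
  also have "\<dots> = (\<Sum>g\<in>exponents ?S n. \<Prod>p\<in>?S. (1 / real p) ^ g p)"
    by (subst sum.reindex[OF inj_from_exponents[OF S]])
      (simp_all add: from_exponents_def power_one_over prod_dividef flip: prod_inversef)
  also have "\<dots> = (\<Prod>p\<in>?S. \<Sum>j\<le>n. (1 / real p) ^ j)"
    unfolding exponents_def by (rule prod_sum_PiE[symmetric]) auto
  also have "\<dots> \<le> (\<Prod>p\<in>?S. exp (1 / real p + 2 / (real p)\<^sup>2))"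
  proof (intro prod_mono conjI sum_nonneg)
    fix p assume p: "p \<in> ?S"
    define x where "x = 1 / real p"
    have x: "0 < x" "x \<le> 1 / 2" using p2[OF p] by (auto simp: x_def divide_simps)
    have "(\<Sum>j\<le>n. x ^ j) \<le> 1 / (1 - x)"
      using x by (simp add: sum_gp0 divide_right_mono)
    also have "\<dots> \<le> exp (x + 2 * x\<^sup>2)"
    proof -
      have "1 / (1 - x) = exp (- ln (1 - x))" using x by (simp add: exp_minus inverse_eq_divide)
      also have "\<dots> \<le> exp (x + 2 * x\<^sup>2)" using ln_one_minus_pos_lower_bound[of x] x by simp
      finally show ?thesis .
    qed
    finally show "(\<Sum>j\<le>n. (1 / real p) ^ j) \<le> exp (1 / real p + 2 / (real p)\<^sup>2)"
      by (simp add: x_def power_one_over)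
  qed auto
  also have "\<dots> = exp ((\<Sum>p\<in>?S. 1 / real p) + 2 * (\<Sum>p\<in>?S. 1 / (real p)\<^sup>2))"
    by (simp add: exp_sum sum.distrib sum_distrib_left flip: exp_sum)
  finally have "ln (ln n) \<le> (\<Sum>p\<in>?S. 1 / real p) + 2 * (\<Sum>p\<in>?S. 1 / (real p)\<^sup>2)"
    using assms by (subst (asm) ln_le_cancel_iff[symmetric]) auto
  moreover have "(\<Sum>p\<in>?S. 1 / (real p)\<^sup>2) \<le> 1"
    using sum_prime_inverse_squares_le[of 1 n] unfolding primes_upto_1 by simp
  ultimately show ?thesis by linarith
qed

text \<open>Comparison with the integral of \<open>x powr (- 1 - s)\<close>, written as an
  induction. The subtracted last term is the tail of that integral and makes the estimate
  telescope.\<close>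

lemma sum_powr_le:
  assumes "s > 0" "M \<ge> 1"
  shows "(\<Sum>m=1..M. real m powr (- (1 + s))) \<le> 1 + 1 / s - real M powr (- s) / s"
  using assms(2)
proof (induction M rule: dec_induct)
  case (step M)
  define u where "u = real (Suc M)"
  have u: "u > 1" using step by (simp add: u_def)
  have "u powr (- s) * (1 + s / u) \<le> u powr (- s) * (1 - 1 / u) powr (- s)"
  proof (rule mult_left_mono)
    have "1 + s / u \<le> exp (s / u)" by (rule exp_ge_add_one_self)
    also have "\<dots> \<le> exp (- s * ln (1 - 1 / u))"
      using mult_left_mono[OF ln_add_one_self_le_self2[of "- 1 / u"], of s] u assms by simp
    also have "\<dots> = (1 - 1 / u) powr (- s)" using u by (simp add: powr_def)
    finally show "1 + s / u \<le> (1 - 1 / u) powr (- s)" .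
  qed simp
  also have "\<dots> = (u * (1 - 1 / u)) powr (- s)" using u by (subst powr_mult) auto
  also have "u * (1 - 1 / u) = real M" using u by (simp add: field_simps u_def)
  finally have "u powr (- s) + s * (u powr (- s) / u) \<le> real M powr (- s)"
    by (simp add: algebra_simps)
  moreover have "u powr (- s) / u = u powr (- (1 + s))"
    using u by (simp add: powr_diff powr_minus_divide minus_add_distrib[symmetric] divide_simps powr_add del: minus_add_distrib)
  ultimately have "u powr (- (1 + s)) \<le> real M powr (- s) / s - u powr (- s) / s"
    using assms(1) by (simp add: field_simps)
  then show ?case using step by (simp add: u_def)
qed (use assms in simp)

text \<open>The product of \<open>1 + p powr (- 1 - s)\<close> expands into a sum over squarefree
  integers, the tuples with exponents at most 1, and so is at most \<open>1 + 1 / s\<close>. The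
  loss in \<open>f - f^2 <= ln (1 + f)\<close> sums to at most 1.\<close>

lemma sum_prime_powr_le:
  assumes s: "s > 0"
  shows "(\<Sum>p\<in>primes_upto n. real p powr (- (1 + s))) \<le> ln (1 + 1 / s) + 1"
proof -
  let ?S = "primes_upto n"
  have S: "finite ?S" "\<And>p. p \<in> ?S \<Longrightarrow> prime p" by (auto simp: primes_upto_def)
  define f where "f = (\<lambda>p::nat. real p powr (- (1 + s)))"
  have f: "0 < f p" "f p \<le> 1 / real p" if "p \<in> ?S" for p
    using prime_gt_1_nat[OF S(2)[OF that]] s powr_mono[of "- (1 + s)" "- 1" "real p"]
    by (auto simp: f_def powr_minus_divide)
  let ?A = "from_exponents ?S ` exponents ?S 1"
  have fin: "finite ?A" using finite_exponents[OF S(1)] by simp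
  have A: "?A \<subseteq> {1..Suc (Max ?A)}"
    using Max_ge[OF fin] from_exponents_pos[OF S(2)] by (auto simp: Suc_le_eq le_Suc_eq)
  have "exp (\<Sum>p\<in>?S. f p - (f p)\<^sup>2) = (\<Prod>p\<in>?S. exp (f p - (f p)\<^sup>2))"
    by (rule exp_sum[OF S(1)])
  also have "\<dots> \<le> (\<Prod>p\<in>?S. 1 + f p)"
  proof (intro prod_mono conjI)
    fix p assume p: "p \<in> ?S"
    have "f p \<le> 1" using f(2)[OF p] prime_gt_0_nat[OF S(2)[OF p]] using divide_le_eq_1_pos[of "real p" 1] by linarith
    then have "f p - (f p)\<^sup>2 \<le> ln (1 + f p)" using f[OF p] by (intro ln_one_plus_pos_lower_bound) auto
    then show "exp (f p - (f p)\<^sup>2) \<le> 1 + f p"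
      using f[OF p] by (metis add_pos_pos exp_le_cancel_iff exp_ln zero_less_one)
  qed simp
  also have "\<dots> = (\<Prod>p\<in>?S. \<Sum>j\<le>1. f p ^ j)" by simp
  also have "\<dots> = (\<Sum>g\<in>exponents ?S 1. \<Prod>p\<in>?S. f p ^ g p)"
    unfolding exponents_def by (rule prod_sum_PiE) auto
  also have "\<dots> = (\<Sum>m\<in>?A. real m powr (- (1 + s)))"
    by (simp only: sum.reindex[OF inj_from_exponents[OF S]] o_def from_exponents_powr[OF S(2)] f_def)
  also have "\<dots> \<le> (\<Sum>m=1..Suc (Max ?A). real m powr (- (1 + s)))"
    by (rule sum_mono2[OF _ A]) auto
  also have "\<dots> \<le> 1 + 1 / s - real (Suc (Max ?A)) powr (- s) / s"
    by (rule sum_powr_le[OF s]) simp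
  also have "\<dots> \<le> 1 + 1 / s" using s by simp
  finally have "(\<Sum>p\<in>?S. f p - (f p)\<^sup>2) \<le> ln (1 + 1 / s)"
    using s by (subst exp_le_cancel_iff[symmetric]) (simp add: add_pos_pos)
  moreover have "(\<Sum>p\<in>?S. (f p)\<^sup>2) \<le> (\<Sum>p\<in>?S. 1 / (real p)\<^sup>2)"
    using f by (intro sum_mono) (simp add: power_mono less_imp_le flip: power_one_over)
  moreover have "(\<Sum>p\<in>?S. 1 / (real p)\<^sup>2) \<le> 1"
    using sum_prime_inverse_squares_le[of 1 n] unfolding primes_upto_1 by simp
  ultimately show ?thesis
    by (simp add: sum_subtractf f_def)
qed

lemma inverse_diff_powr_le:
  fixes x s :: real
  assumes "x > 0" "s > 0"
  shows "1 / x - x powr (- (1 + s)) \<le> s * (ln x / x)"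
proof -
  have "1 - s * ln x \<le> x powr (- s)"
    using exp_ge_add_one_self[of "- s * ln x"] assms by (simp add: powr_def)
  then have "(1 - s * ln x) / x \<le> x powr (- s) / x" using assms by (intro divide_right_mono) auto
  also have "x powr (- s) / x = x powr (- s - 1)"
    using assms powr_diff[of x "- s" 1] by simp
  also have "- s - 1 = - (1 + s)" by simp
  finally show ?thesis by (simp add: diff_divide_distrib)
qed

text \<open>Damping changes \<open>1 / p\<close> by at most \<open>s * ln p / p\<close>, and these
  changes are summed by the Chebyshev-type bound on \<open>ln p / p\<close>.\<close>

lemma sum_prime_powr_ge:
  assumes s: "s > 0"
  shows "(\<Sum>p\<in>primes_upto n. 1 / real p) - 2 * s * ln n \<le> (\<Sum>p\<in>primes_upto n. real p powr (- (1 + s)))"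
proof -
  have "(\<Sum>p\<in>primes_upto n. 1 / real p - real p powr (- (1 + s))) \<le> (\<Sum>p\<in>primes_upto n. s * (ln p / p))"
    using s by (intro sum_mono inverse_diff_powr_le) (auto simp: primes_upto_def prime_gt_0_nat)
  also have "\<dots> \<le> s * (2 * ln n)"
    unfolding sum_distrib_left[symmetric] using s sum_ln_prime_le[of n] by (intro mult_left_mono) auto
  finally show ?thesis by (simp add: sum_subtractf)
qed

text \<open>With \<open>s = 1 / ln n\<close>, inserting the damping costs only the constant
  \<open>2 * s * ln n = 2\<close>, while the damped sum is at most
  \<open>ln (1 + ln n) + 1\<close>.\<close>

lemma sum_prime_inverse_le:
  assumes "n \<ge> 3"
  shows "(\<Sum>p\<in>primes_upto n. 1 / real p) \<le> ln (ln (real n)) + 4"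
proof -
  have "exp 1 \<le> real n" using exp_le assms by (intro order_trans[OF exp_le]) simp
  then have ln1: "ln (real n) \<ge> 1" using assms by (subst ln_ge_iff) auto
  define s where "s = 1 / ln (real n)"
  have s: "s > 0" using ln1 by (simp add: s_def)
  have "(\<Sum>p\<in>primes_upto n. 1 / real p) \<le> ln (1 + 1 / s) + 1 + 2 * s * ln n"
    using sum_prime_powr_ge[OF s, of n] sum_prime_powr_le[OF s, of n] by linarith
  also have "2 * s * ln n = 2" using ln1 by (simp add: s_def)
  also have "ln (1 + 1 / s) \<le> ln (2 * ln n)" using ln1 by (intro ln_mono) (auto simp: s_def)
  also have "ln (2 * ln n) = ln 2 + ln (ln n)" using ln1 by (intro ln_mult_pos) auto
  also have "ln (2::real) \<le> 1" using ln_le_minus_one[of 2] by simp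
  finally show ?thesis by simp
qed

lemma sum_prime_powr_tail_le:
  assumes s: "s > 0" and Q: "Q \<ge> 2"
  shows "(\<Sum>p\<in>primes_upto n - primes_upto Q. real p powr (- (1 + s)))
           \<le> ln (1 + 1 / s) - ln (ln Q) + 3 + 2 * s * ln Q"
proof -
  let ?f = "\<lambda>p. real p powr (- (1 + s))"
  \<comment> \<open>Enlarging \<open>n\<close> to \<open>max n Q\<close> makes the removed set a
    subset, so the tail becomes a difference of two full sums.\<close>
  have "sum ?f (primes_upto n - primes_upto Q) \<le> sum ?f (primes_upto (max n Q) - primes_upto Q)"
    by (rule sum_mono2) (auto simp: primes_upto_def)
  also have "\<dots> = sum ?f (primes_upto (max n Q)) - sum ?f (primes_upto Q)"
    by (rule sum_diff) (auto simp: primes_upto_def)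
  finally show ?thesis
    using sum_prime_powr_le[OF s, of "max n Q"] sum_prime_powr_ge[OF s, of Q] sum_prime_inverse_ge[OF Q]
    by linarith
qed

lemma sum_prime_inverse_tail_ge:
  assumes n: "n \<ge> 2" and Q: "Q \<ge> 3"
  shows "ln (ln n) - ln (ln Q) - 6 \<le> (\<Sum>p\<in>primes_upto n - primes_upto Q. 1 / real p)"
proof -
  have "sum (\<lambda>p. 1 / real p) (primes_upto n) - sum (\<lambda>p. 1 / real p) (primes_upto Q) \<le>
      sum (\<lambda>p. 1 / real p) (primes_upto n) - sum (\<lambda>p. 1 / real p) (primes_upto n \<inter> primes_upto Q)"
    by (intro diff_left_mono sum_mono2) auto
  also have "\<dots> = (\<Sum>p\<in>primes_upto n - primes_upto Q. 1 / real p)"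
    by (subst sum.Int_Diff[of "primes_upto n" _ "primes_upto Q"]) auto
  finally show ?thesis
    using sum_prime_inverse_ge[OF n] sum_prime_inverse_le[OF Q] by linarith
qed

section \<open>Independence of the primes\<close>

definition osc :: "nat \<Rightarrow> real \<Rightarrow> complex" where
  "osc n t = cis (- ln (real n) * t)"

text \<open>The additive group generated by \<open>ln p\<close> for the primes \<open>p\<close> in
  \<open>S\<close>, presented as logarithms of positive rationals so that unique factorization can
  be applied directly.\<close>

definition freqs :: "nat set \<Rightarrow> real set" where
  "freqs S = {ln (real a) - ln (real b) |a b. a > 0 \<and> b > 0 \<and>
     (\<forall>p. prime p \<longrightarrow> p dvd a \<longrightarrow> p \<in> S) \<and> (\<forall>p. prime p \<longrightarrow> p dvd b \<longrightarrow> p \<in> S)}"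

lemma norm_osc [simp]: "norm (osc n t) = 1"
  by (simp add: osc_def)

lemma osc_mult: "a > 0 \<Longrightarrow> b > 0 \<Longrightarrow> osc (a * b) t = osc a t * osc b t"
  by (simp add: osc_def cis_mult ln_mult_pos algebra_simps)

lemma osc_power: "a > 0 \<Longrightarrow> osc (a ^ n) t = osc a t ^ n"
  by (induction n) (auto simp: osc_mult, simp add: osc_def)

lemma osc_prod: "finite S \<Longrightarrow> (\<And>i. i \<in> S \<Longrightarrow> f i > 0) \<Longrightarrow> osc (\<Prod>i\<in>S. f i) t = (\<Prod>i\<in>S. osc (f i) t)"
  by (induction S rule: finite_induct) (auto simp: osc_mult prod_pos, simp add: osc_def)

lemma osc_from_exponents:
  assumes "finite S" "\<And>p. p \<in> S \<Longrightarrow> prime p"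
  shows "osc (from_exponents S g) t = (\<Prod>p\<in>S. osc p t ^ g p)"
  using assms by (simp add: from_exponents_def osc_prod osc_power prime_gt_0_nat)

lemma subgroup_freqs: "add_subgroup (freqs S)"
  unfolding add_subgroup_def
proof (intro conjI ballI)
  show "0 \<in> freqs S" unfolding freqs_def by (rule CollectI, rule exI[of _ 1], rule exI[of _ 1]) auto
next
  fix x y assume "x \<in> freqs S" "y \<in> freqs S"
  then obtain a b c d where "x = ln (real a) - ln (real b)" "y = ln (real c) - ln (real d)"
    and *: "a > 0" "b > 0" "c > 0" "d > 0"
      "\<And>p. prime p \<Longrightarrow> p dvd a \<Longrightarrow> p \<in> S" "\<And>p. prime p \<Longrightarrow> p dvd b \<Longrightarrow> p \<in> S"
      "\<And>p. prime p \<Longrightarrow> p dvd c \<Longrightarrow> p \<in> S" "\<And>p. prime p \<Longrightarrow> p dvd d \<Longrightarrow> p \<in> S"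
    by (auto simp: freqs_def)
  then have "x + y = ln (real (a * c)) - ln (real (b * d))"
    by (simp add: ln_mult_pos)
  moreover have "a * c > 0" "b * d > 0" "\<And>p. prime p \<Longrightarrow> p dvd a * c \<Longrightarrow> p \<in> S" "\<And>p. prime p \<Longrightarrow> p dvd b * d \<Longrightarrow> p \<in> S"
    using * by (auto simp: prime_dvd_mult_iff)
  ultimately show "x + y \<in> freqs S" unfolding freqs_def by blast
next
  fix x assume "x \<in> freqs S"
  then obtain a b where "x = ln (real a) - ln (real b)"
    and *: "a > 0" "b > 0" "\<forall>p. prime p \<longrightarrow> p dvd a \<longrightarrow> p \<in> S" "\<forall>p. prime p \<longrightarrow> p dvd b \<longrightarrow> p \<in> S"
    by (auto simp: freqs_def)
  then have "- x = ln (real b) - ln (real a)" by simp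
  with * show "- x \<in> freqs S" unfolding freqs_def by blast
qed

lemma freqs_mono: "S \<subseteq> T \<Longrightarrow> freqs S \<subseteq> freqs T"
  unfolding freqs_def by blast

lemma freqs_prime_power:
  assumes "prime p" shows "- (real j * ln (real p)) \<in> freqs {p}"
proof -
  have "- (real j * ln (real p)) = ln (real 1) - ln (real (p ^ j))"
    using prime_gt_0_nat[OF assms] by (simp add: ln_realpow)
  moreover have "q \<in> {p}" if "prime q" "q dvd p ^ j" for q
    using that assms primes_dvd_imp_eq prime_dvd_power by blast
  moreover have "q \<in> {p}" if "prime q" "q dvd 1" for q
    using that not_prime_unit by blast
  ultimately show ?thesis
    unfolding freqs_def using prime_gt_0_nat[OF assms] by (intro CollectI exI[of _ 1] exI[of _ "p ^ j"]) auto
qed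

text \<open>A relation between the two groups reads \<open>a * c = b * d\<close>, where
  \<open>a\<close>, \<open>b\<close> involve primes from \<open>S\<close> only and \<open>c\<close>,
  \<open>d\<close> primes from \<open>T\<close> only. Coprimality forces \<open>a\<close> and
  \<open>b\<close> to divide each other. This is where unique factorization becomes
  independence.\<close>

lemma freqs_independent:
  assumes "x \<in> freqs S" "y \<in> freqs T" "S \<inter> T = {}" "x + y = 0"
  shows "x = 0"
proof -
  obtain a b where x: "x = ln (real a) - ln (real b)" and ab: "a > 0" "b > 0"
      "\<And>p. prime p \<Longrightarrow> p dvd a \<Longrightarrow> p \<in> S" "\<And>p. prime p \<Longrightarrow> p dvd b \<Longrightarrow> p \<in> S"
    using assms(1) by (auto simp: freqs_def)
  obtain c d where y: "y = ln (real c) - ln (real d)" and cd: "c > 0" "d > 0"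
      "\<And>p. prime p \<Longrightarrow> p dvd c \<Longrightarrow> p \<in> T" "\<And>p. prime p \<Longrightarrow> p dvd d \<Longrightarrow> p \<in> T"
    using assms(2) by (auto simp: freqs_def)
  have "ln (real (a * c)) = ln (real (b * d))"
    using assms(4) x y ab cd by (simp add: ln_mult_pos)
  then have "real (a * c) = real (b * d)"
    using ab cd by (subst (asm) ln_inj_iff) auto
  then have eq: "a * c = b * d" by (simp only: of_nat_eq_iff)
  have cop: "coprime m n" if "\<And>p. prime p \<Longrightarrow> p dvd m \<Longrightarrow> p \<in> S" "\<And>p. prime p \<Longrightarrow> p dvd n \<Longrightarrow> p \<in> T" for m n
  proof (rule ccontr)
    assume "\<not> coprime m n"
    then obtain p where "prime p" "p dvd gcd m n"
      using prime_factor_nat[of "gcd m n"] by (auto simp: coprime_iff_gcd_eq_1)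
    then show False using that assms(3) by auto
  qed
  have "coprime a d" "coprime b c" using ab cd by (blast intro: cop)+
  moreover have "a dvd b * d" unfolding eq[symmetric] by simp
  moreover have "b dvd a * c" unfolding eq by simp
  ultimately have "a dvd b" "b dvd a"
    by (simp_all add: coprime_dvd_mult_left_iff)
  then have "a = b" by (rule dvd_antisym)
  then show ?thesis using x by simp
qed

text \<open>Both claims are proved in one induction: multiplicativity of the mean for a new prime
  needs the frequencies of the product over the earlier primes.\<close>

lemma prod_primes:
  assumes "finite S" "\<And>p. p \<in> S \<Longrightarrow> ap UNIV (freqs {p}) (f p)"
  shows "ap UNIV (freqs S) (\<lambda>t. \<Prod>p\<in>S. f p t) \<and> mean (\<lambda>t. \<Prod>p\<in>S. f p t) = (\<Prod>p\<in>S. mean (f p))"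
  using assms
proof (induction S rule: finite_induct)
  case empty
  then show ?case by (simp add: mean_const ap_const subgroup_freqs)
next
  case (insert q S)
  have q: "ap UNIV (freqs {q}) (f q)" using insert by simp
  have IH: "ap UNIV (freqs S) (\<lambda>t. \<Prod>p\<in>S. f p t)" "mean (\<lambda>t. \<Prod>p\<in>S. f p t) = (\<Prod>p\<in>S. mean (f p))"
    using insert by auto
  have "ap UNIV (freqs (insert q S)) (\<lambda>t. f q t * (\<Prod>p\<in>S. f p t))"
    by (intro ap_group_mult subgroup_freqs ap_mono[OF q] ap_mono[OF IH(1)] freqs_mono) auto
  moreover have "mean (\<lambda>t. f q t * (\<Prod>p\<in>S. f p t)) = mean (f q) * (\<Prod>p\<in>S. mean (f p))"
    using ap_mean_mult[OF q IH(1)] freqs_independent[of _ "{q}" _ S] insert(2) IH(2) by auto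
  ultimately show ?case using insert by simp
qed

lemmas ap_prod_primes = prod_primes[THEN conjunct1]
lemmas mean_prod_primes = prod_primes[THEN conjunct2]

section \<open>Power series in the oscillation of a single prime, and Parseval's identity\<close>

definition osc_poly :: "(nat \<Rightarrow> complex) \<Rightarrow> nat \<Rightarrow> nat \<Rightarrow> real \<Rightarrow> complex" where
  "osc_poly a p n t = (\<Sum>i<n. a i * osc p t ^ i)"

definition pser :: "(nat \<Rightarrow> complex) \<Rightarrow> nat \<Rightarrow> real \<Rightarrow> complex" where
  "pser a p t = (\<Sum>i. a i * osc p t ^ i)"

lemma osc_power_cis: "osc p t ^ j = cis (- (real j * ln (real p)) * t)"
  using Complex.DeMoivre[of "- ln (real p) * t" j]
  by (simp only: osc_def mult_minus_left mult_minus_right mult.assoc)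

lemma pser_uniform:
  assumes "summable (\<lambda>i. norm (a i))"
  shows "uniform_limit UNIV (osc_poly a p) (pser a p) sequentially"
  unfolding pser_def osc_poly_def[abs_def] using assms by (intro Weierstrass_m_test) (auto simp: norm_mult norm_power)

lemma trigs_osc_poly:
  assumes "prime p" "\<And>i. a i \<in> C"
  shows "osc_poly a p n \<in> trigs C (freqs {p})"
  unfolding osc_poly_def[abs_def] osc_power_cis by (intro trigs_sum trigs_monom assms freqs_prime_power)

lemma ap_pser:
  assumes "summable (\<lambda>i. norm (a i))" "prime p" "\<And>i. a i \<in> C"
  shows "ap C (freqs {p}) (pser a p)"
  by (rule ap_uniform_limit[OF trigs_ap[OF trigs_osc_poly[OF assms(2,3)]] pser_uniform[OF assms(1)]])

lemma ap_cnj_pser: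
  assumes "summable (\<lambda>i. norm (a i))" "prime p"
  shows "ap UNIV (freqs {p}) (\<lambda>t. cnj (pser a p t))"
  by (intro ap_group_cnj subgroup_freqs ap_pser assms) auto

lemma mean_osc_power:
  assumes "prime p"
  shows "mean (\<lambda>t. osc p t ^ i * cnj (osc p t ^ j)) = (if i = j then 1 else 0)"
proof -
  have "ln (real p) \<noteq> 0" using prime_gt_1_nat[OF assms] by simp
  moreover have "osc p t ^ i * cnj (osc p t ^ j) = cis (((real j - real i) * ln (real p)) * t)" for t
    unfolding osc_power_cis cis_cnj cis_mult by (simp add: algebra_simps)
  ultimately show ?thesis
    using has_mean_imp_mean[OF has_mean_cis[of "(real j - real i) * ln (real p)"]] by auto
qed

lemma mean_osc_poly:
  assumes "prime p"
  shows "mean (\<lambda>t. osc_poly a p n t * cnj (osc_poly b p n t)) = (\<Sum>i<n. a i * cnj (b i))"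
proof -
  have m: "has_mean (\<lambda>t. osc p t ^ i * cnj (osc p t ^ j)) (if i = j then 1 else 0)" for i j
  proof -
    have "ap UNIV UNIV (osc p)"
      using trigs_osc_poly[OF assms, of "\<lambda>i. if i = 1 then 1 else 0" UNIV 2]
      by (auto intro: ap_UNIV[OF trigs_ap] simp: osc_poly_def[abs_def] numeral_2_eq_2)
    then have "ap UNIV UNIV (\<lambda>t. osc p t ^ i * cnj (osc p t ^ j))"
      by (intro ap_group_mult ap_group_cnj ap_group_power) auto
    from ap_has_mean[OF this] show ?thesis unfolding mean_osc_power[OF assms] .
  qed
  have sum: "has_mean (\<lambda>t. \<Sum>i\<in>I. f i t) (\<Sum>i\<in>I. c i)" if "finite I" "\<And>i. i \<in> I \<Longrightarrow> has_mean (f i) (c i)"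
    for I :: "nat set" and f :: "nat \<Rightarrow> real \<Rightarrow> complex" and c
    using that by (induction I rule: finite_induct) (auto simp: has_mean_add intro: has_mean_const[of "0::complex"])
  have "osc_poly a p n t * cnj (osc_poly b p n t) =
      (\<Sum>i<n. \<Sum>j<n. (a i * cnj (b j)) * (osc p t ^ i * cnj (osc p t ^ j)))" for t
    by (simp add: osc_poly_def sum_product mult_ac)
  moreover have "has_mean (\<lambda>t. \<Sum>i<n. \<Sum>j<n. (a i * cnj (b j)) * (osc p t ^ i * cnj (osc p t ^ j)))
      (\<Sum>i<n. \<Sum>j<n. (a i * cnj (b j)) * (if i = j then 1 else 0))"
    by (intro sum has_mean_cmult m) auto
  moreover have "(\<Sum>i<n. \<Sum>j<n. (a i * cnj (b j)) * (if i = j then 1 else 0)) = (\<Sum>i<n. a i * cnj (b i))"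
    by (intro sum.cong refl) (auto simp: if_distrib[of "\<lambda>x. _ * x"] cong: if_cong)
  ultimately show ?thesis
    using has_mean_imp_mean by (simp only:)
qed

text \<open>Parseval's identity for one prime. For partial sums it is orthogonality of the powers of
  \<open>osc p\<close>; absolute summability makes the convergence uniform and allows passage to the
  limit.\<close>

lemma mean_pser_mult_cnj:
  assumes a: "summable (\<lambda>i. norm (a i))" and b: "summable (\<lambda>i. norm (b i))" and p: "prime p"
  shows "(\<lambda>i. a i * cnj (b i)) sums mean (\<lambda>t. pser a p t * cnj (pser b p t))"
proof -
  note ap_a = ap_pser[OF a p UNIV_I] and ap_b = ap_cnj_pser[OF b p]
  have b': "uniform_limit UNIV (\<lambda>n t. cnj (osc_poly b p n t)) (\<lambda>t. cnj (pser b p t)) sequentially"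
    by (rule bounded_linear.uniform_limit[OF bounded_linear_cnj pser_uniform[OF b]])
  have "(\<lambda>n. mean (\<lambda>t. osc_poly a p n t * cnj (osc_poly b p n t)))
      \<longlonglongrightarrow> mean (\<lambda>t. pser a p t * cnj (pser b p t))"
  proof (rule mean_uniform_limit)
    show "ap UNIV (freqs {p}) (\<lambda>t. osc_poly a p n t * cnj (osc_poly b p n t))" for n
      by (intro ap_group_mult ap_group_cnj subgroup_freqs trigs_ap trigs_osc_poly p UNIV_I)
    show "uniform_limit UNIV (\<lambda>n t. osc_poly a p n t * cnj (osc_poly b p n t))
       (\<lambda>t. pser a p t * cnj (pser b p t)) sequentially"
      by (rule uniform_lim_mult[OF pser_uniform[OF a] b' ap_bounded_range[OF ap_a] ap_bounded_range[OF ap_b]])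
  qed
  then show ?thesis
    unfolding mean_osc_poly[OF p] sums_def .
qed

lemma ap_osc:
  assumes "n > 0" shows "ap \<real>\<^sub>\<ge>\<^sub>0 UNIV (osc n)"
  using trigs_ap[OF trigs_monom[of 1 "\<real>\<^sub>\<ge>\<^sub>0" "- ln (real n)" UNIV]]
  by (simp add: osc_def[abs_def])

section \<open>The lower bound\<close>

text \<open>This is the modified Bessel function I_0 at \<open>2 * sqrt u\<close>. It arises as the
  mean of \<open>exp (\<alpha> z)\<close> times the conjugate of \<open>exp (\<beta> z)\<close> with
  \<open>u = \<alpha> * \<beta>\<close> and \<open>z\<close> on the unit circle.\<close>

definition bes :: "real \<Rightarrow> real" where
  "bes u = (\<Sum>j. u ^ j / (fact j)\<^sup>2)"

lemma summable_bes:
  fixes u :: real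
  assumes "u \<ge> 0" shows "summable (\<lambda>j. u ^ j / (fact j)\<^sup>2)"
proof (rule summable_comparison_test'[OF summable_exp[of u]])
  fix j :: nat
  have "(1::real) \<le> fact j" by (rule fact_ge_1)
  then have "(fact j :: real) \<le> (fact j)\<^sup>2" by (simp add: power2_eq_square)
  then have "u ^ j / (fact j)\<^sup>2 \<le> u ^ j / fact j" using assms by (intro divide_left_mono) auto
  then show "norm (u ^ j / (fact j)\<^sup>2) \<le> inverse (fact j) * u ^ j"
    using assms by (simp add: divide_inverse mult.commute)
qed

lemma bes_sums: "u \<ge> 0 \<Longrightarrow> (\<lambda>j. u ^ j / (fact j)\<^sup>2) sums bes u"
  unfolding bes_def by (rule summable_sums[OF summable_bes])

lemma bes_ge: assumes "u \<ge> 0" shows "1 + u \<le> bes u"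
proof -
  have "(\<Sum>j<2. u ^ j / (fact j)\<^sup>2) \<le> bes u"
    unfolding bes_def by (rule sum_le_suminf[OF summable_bes[OF assms]]) (use assms in auto)
  then show ?thesis by (simp add: numeral_2_eq_2)
qed

lemma bes_nonneg: "u \<ge> 0 \<Longrightarrow> 0 \<le> bes u"
  using bes_ge[of u] by linarith

text \<open>Compare the series for \<open>u + w\<close> termwise with the Cauchy product of those
  for \<open>bes u\<close> and \<open>exp w\<close>, using \<open>fact i <= fact n\<close>. A
  perturbation \<open>w\<close> of the argument thus costs only \<open>exp w\<close>; this controls
  the Rankin tail.\<close>

lemma bes_add_le:
  assumes "u \<ge> 0" "w \<ge> 0" shows "bes (u + w) \<le> bes u * exp w"
proof -
  have s1: "summable (\<lambda>j. norm (u ^ j / (fact j)\<^sup>2))"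
    using summable_bes[OF assms(1)] assms by simp
  have s2: "summable (\<lambda>j. norm (w ^ j /\<^sub>R fact j))" by (rule summable_norm_exp)
  have "(\<lambda>n. \<Sum>i\<le>n. (u ^ i / (fact i)\<^sup>2) * (w ^ (n - i) /\<^sub>R fact (n - i))) sums (bes u * exp w)"
    using Cauchy_product_sums[OF s1 s2] by (simp add: bes_def exp_def)
  moreover have "(u + w) ^ n / (fact n)\<^sup>2 \<le> (\<Sum>i\<le>n. (u ^ i / (fact i)\<^sup>2) * (w ^ (n - i) /\<^sub>R fact (n - i)))" for n
  proof -
    have "(u + w) ^ n / (fact n)\<^sup>2 = (\<Sum>i\<le>n. (real (n choose i) * u ^ i * w ^ (n - i)) / (fact n)\<^sup>2)"
      by (simp add: binomial_ring sum_divide_distrib)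
    also have "\<dots> \<le> (\<Sum>i\<le>n. (u ^ i / (fact i)\<^sup>2) * (w ^ (n - i) /\<^sub>R fact (n - i)))"
    proof (rule sum_mono)
      fix i assume i: "i \<in> {..n}"
      have c: "real (n choose i) = fact n / (fact i * fact (n - i))"
        using i by (simp add: binomial_fact)
      have "real (n choose i) / (fact n)\<^sup>2 = 1 / (fact i * fact (n - i) * fact n)"
        unfolding c by (simp add: power2_eq_square field_simps)
      also have "\<dots> \<le> 1 / (fact i * fact (n - i) * fact i)"
        using i by (intro divide_left_mono mult_left_mono fact_mono mult_pos_pos) auto
      finally have "real (n choose i) / (fact n)\<^sup>2 * (u ^ i * w ^ (n - i)) \<le> 1 / (fact i * fact (n - i) * fact i) * (u ^ i * w ^ (n - i))"
        using assms by (intro mult_right_mono) auto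
      then show "(real (n choose i) * u ^ i * w ^ (n - i)) / (fact n)\<^sup>2 \<le> (u ^ i / (fact i)\<^sup>2) * (w ^ (n - i) /\<^sub>R fact (n - i))"
        by (simp add: power2_eq_square divide_simps mult_ac)
    qed
    finally show ?thesis .
  qed
  moreover have "(\<lambda>n. (u + w) ^ n / (fact n)\<^sup>2) sums bes (u + w)"
    using assms by (intro bes_sums) simp
  ultimately show ?thesis
    by (rule sums_le[rotated 2]) 
qed

lemma exp_osc_pser: "exp (of_real \<alpha> * osc p t) = pser (\<lambda>i. of_real (\<alpha> ^ i / fact i)) p t"
proof -
  have "(\<lambda>i. of_real (\<alpha> ^ i / fact i) * osc p t ^ i) = (\<lambda>i. (of_real \<alpha> * osc p t) ^ i /\<^sub>R fact i)"
    by (intro ext) (simp add: power_mult_distrib scaleR_conv_of_real divide_inverse mult_ac)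
  then show ?thesis by (simp add: pser_def exp_def)
qed

lemma summable_exp_coeff: "summable (\<lambda>i. norm (complex_of_real (\<alpha> ^ i / fact i)))"
  using summable_norm_exp[of \<alpha>] unfolding norm_of_real by (simp add: divide_inverse mult.commute)

lemma ap_nonneg_group_mult:
  "add_subgroup G \<Longrightarrow> ap \<real>\<^sub>\<ge>\<^sub>0 G f \<Longrightarrow> ap \<real>\<^sub>\<ge>\<^sub>0 G g \<Longrightarrow> ap \<real>\<^sub>\<ge>\<^sub>0 G (\<lambda>t. f t * g t)"
  by (rule ap_mult) (auto simp: add_subgroup_def nonneg_Reals_mult_I)

lemma ap_nonneg_prod:
  assumes "finite S" "\<And>i. i \<in> S \<Longrightarrow> ap \<real>\<^sub>\<ge>\<^sub>0 UNIV (f i)"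
  shows "ap \<real>\<^sub>\<ge>\<^sub>0 UNIV (\<lambda>t. \<Prod>i\<in>S. f i t)"
  using assms
proof (induction S rule: finite_induct)
  case empty
  then show ?case using trigs_ap[OF trigs_const[of 1 "\<real>\<^sub>\<ge>\<^sub>0" UNIV]] by simp
qed (auto intro: ap_nonneg_group_mult)

lemma ap_exp_osc:
  assumes "prime p" "\<alpha> \<ge> 0"
  shows "ap \<real>\<^sub>\<ge>\<^sub>0 (freqs {p}) (\<lambda>t. exp (of_real \<alpha> * osc p t))"
    and "ap \<real>\<^sub>\<ge>\<^sub>0 (freqs {p}) (\<lambda>t. cnj (exp (of_real \<alpha> * osc p t)))"
proof -
  show 1: "ap \<real>\<^sub>\<ge>\<^sub>0 (freqs {p}) (\<lambda>t. exp (of_real \<alpha> * osc p t))"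
    unfolding exp_osc_pser
  proof (intro ap_pser summable_exp_coeff assms)
    show "complex_of_real (\<alpha> ^ i / fact i) \<in> \<real>\<^sub>\<ge>\<^sub>0" for i
      unfolding nonneg_Reals_of_real_iff using assms by simp
  qed
  show "ap \<real>\<^sub>\<ge>\<^sub>0 (freqs {p}) (\<lambda>t. cnj (exp (of_real \<alpha> * osc p t)))"
    by (rule ap_mono[OF ap_cnj[OF 1]])
      (use subgroup_freqs[of "{p}"] in \<open>auto simp: add_subgroup_def complex_nonneg_Reals_iff\<close>)
qed

lemma mean_exp_osc:
  assumes "prime p" "\<alpha> \<ge> 0" "\<beta> \<ge> 0"
  shows "mean (\<lambda>t. exp (of_real \<alpha> * osc p t) * cnj (exp (of_real \<beta> * osc p t))) = of_real (bes (\<alpha> * \<beta>))"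
proof -
  have "(\<lambda>i. of_real ((\<alpha> * \<beta>) ^ i / (fact i)\<^sup>2)) sums complex_of_real (bes (\<alpha> * \<beta>))"
    using bes_sums[of "\<alpha> * \<beta>"] assms by (subst sums_of_real_iff) auto
  moreover have "complex_of_real ((\<alpha> * \<beta>) ^ i / (fact i)\<^sup>2) = of_real (\<alpha> ^ i / fact i) * cnj (of_real (\<beta> ^ i / fact i))" for i
    by (simp add: power_mult_distrib power2_eq_square)
  ultimately have "(\<lambda>i. of_real (\<alpha> ^ i / fact i) * cnj (of_real (\<beta> ^ i / fact i))) sums complex_of_real (bes (\<alpha> * \<beta>))"
    by (simp only:)
  then show ?thesis
    unfolding exp_osc_pser
    by (rule sums_unique2[OF mean_pser_mult_cnj[OF summable_exp_coeff summable_exp_coeff assms(1)]])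
qed

text \<open>The factor of the test function at one prime. The exponents \<open>k - 1\<close> and
  \<open>k\<close> are unequal because the Dirichlet polynomial itself supplies one more holomorphic
  factor, which completes \<open>exp (k X)\<close> times its conjugate.\<close>

definition twist :: "real \<Rightarrow> nat \<Rightarrow> real \<Rightarrow> complex" where
  "twist k p t = exp (complex_of_real ((k - 1) * real p powr (- 1 / 2)) * osc p t) *
                 cnj (exp (complex_of_real (k * real p powr (- 1 / 2)) * osc p t))"

definition twist_coeff :: "real \<Rightarrow> nat \<Rightarrow> nat \<Rightarrow> real" where
  "twist_coeff k p j = Re (mean (\<lambda>t. osc p t ^ j * twist k p t))"

lemma ap_twist: "prime p \<Longrightarrow> k \<ge> 1 \<Longrightarrow> ap \<real>\<^sub>\<ge>\<^sub>0 (freqs {p}) (twist k p)"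
  unfolding twist_def by (intro ap_nonneg_group_mult ap_exp_osc subgroup_freqs) auto

lemma ap_osc_power: "prime p \<Longrightarrow> ap \<real>\<^sub>\<ge>\<^sub>0 (freqs {p}) (\<lambda>t. osc p t ^ j)"
  using trigs_ap[OF trigs_monom[of 1 "\<real>\<^sub>\<ge>\<^sub>0" "- (real j * ln (real p))" "freqs {p}"]] freqs_prime_power
  by (simp add: osc_power_cis)

lemma ap_osc_twist: "prime p \<Longrightarrow> k \<ge> 1 \<Longrightarrow> ap \<real>\<^sub>\<ge>\<^sub>0 (freqs {p}) (\<lambda>t. osc p t ^ j * twist k p t)"
  by (intro ap_nonneg_group_mult subgroup_freqs ap_osc_power ap_twist)

lemma mean_osc_twist:
  assumes "prime p" "k \<ge> 1"
  shows "mean (\<lambda>t. osc p t ^ j * twist k p t) = of_real (twist_coeff k p j)" "twist_coeff k p j \<ge> 0"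
  using ap_mean_nonneg[OF ap_osc_twist[OF assms]] unfolding twist_coeff_def
  by (auto simp: complex_nonneg_Reals_iff complex_eq_iff)

lemma half_powr_square: "x > 0 \<Longrightarrow> (x powr (- 1 / 2) :: real) * x powr (- 1 / 2) = 1 / x"
  by (simp add: powr_add[symmetric] powr_minus_divide)

text \<open>Truncation at \<open>J\<close> of the mean of
  \<open>exp (l * p powr (- 1 / 2) * z)\<close> times the twist. The weight is \<open>l = 1\<close>
  for the main term and \<open>l = p powr d\<close> for the Rankin tail.\<close>

definition twist_sum :: "real \<Rightarrow> real \<Rightarrow> nat \<Rightarrow> nat \<Rightarrow> real" where
  "twist_sum k l J p = (\<Sum>j\<le>J. (l * real p powr (- 1 / 2)) ^ j / fact j * twist_coeff k p j)"

text \<open>The exponential with weight \<open>l\<close> merges with the holomorphic part of the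
  twist into the exponent \<open>l + k - 1\<close>, so the sum is the mean of two exponentials and
  hence a Bessel value.\<close>

lemma twist_coeff_sums:
  assumes p: "prime p" and k: "k \<ge> 1" and l: "l \<ge> 0"
  shows "(\<lambda>j. (l * real p powr (- 1 / 2)) ^ j / fact j * twist_coeff k p j) sums bes ((l + k - 1) * k / real p)"
proof -
  define \<alpha> where "\<alpha> = l * real p powr (- 1 / 2)"
  define a where "a = (\<lambda>i::nat. complex_of_real (\<alpha> ^ i / fact i))"
  have tw: "ap UNIV UNIV (twist k p)" using ap_twist[OF p k] by (rule ap_UNIV)
  have tm: "mean (\<lambda>t. a i * osc p t ^ i * twist k p t) = of_real (\<alpha> ^ i / fact i * twist_coeff k p i)" for i
    using ap_mean_cmult[OF ap_osc_twist[OF p k, of i], where c = "a i"] mean_osc_twist[OF p k]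
    by (simp add: a_def mult.assoc)
  have apt: "ap UNIV UNIV (\<lambda>t. a i * osc p t ^ i * twist k p t)" for i
    using ap_group_mult[OF add_subgroup_UNIV ap_const[OF add_subgroup_UNIV, of "a i"] ap_UNIV[OF ap_osc_twist[OF p k, of i]]]
    by (simp add: mult.assoc)
  have sum: "ap UNIV UNIV (\<lambda>t. osc_poly a p n t * twist k p t)"
    "mean (\<lambda>t. osc_poly a p n t * twist k p t) = (\<Sum>i<n. of_real (\<alpha> ^ i / fact i * twist_coeff k p i))" for n
  proof (induction n)
    case 0
    case 1 show ?case using ap_const[of UNIV 0] by (simp add: osc_poly_def)
    case 2 show ?case by (simp add: osc_poly_def mean_const)
  next
    case (Suc n)
    case 1 show ?case using ap_add[OF Suc(1) apt[of n]] by (simp add: osc_poly_def distrib_right)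
    case 2 show ?case using ap_mean_add[OF Suc(1) apt[of n]] Suc(2) tm[of n] by (simp add: osc_poly_def distrib_right)
  qed
  have lim: "(\<lambda>n. mean (\<lambda>t. osc_poly a p n t * twist k p t)) \<longlonglongrightarrow> mean (\<lambda>t. pser a p t * twist k p t)"
  proof (rule mean_uniform_limit[OF sum(1)])
    have sm: "summable (\<lambda>i. norm (a i))" unfolding a_def by (rule summable_exp_coeff)
    show "uniform_limit UNIV (\<lambda>n t. osc_poly a p n t * twist k p t) (\<lambda>t. pser a p t * twist k p t) sequentially"
      by (rule uniform_lim_mult[OF pser_uniform[OF sm] uniform_limit_const ap_bounded_range[OF ap_pser[OF sm p UNIV_I]] ap_bounded_range[OF tw]])
  qed
  have "pser a p t * twist k p t = exp (of_real ((l + k - 1) * real p powr (- 1 / 2)) * osc p t) *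
      cnj (exp (complex_of_real (k * real p powr (- 1 / 2)) * osc p t))" for t
    unfolding twist_def a_def exp_osc_pser[symmetric] mult.assoc[symmetric] exp_add[symmetric]
    by (simp add: \<alpha>_def algebra_simps)
  then have "mean (\<lambda>t. pser a p t * twist k p t) = of_real (bes ((l + k - 1) * real p powr (- 1 / 2) * (k * real p powr (- 1 / 2))))"
    using mean_exp_osc[OF p, of "(l + k - 1) * real p powr (- 1 / 2)" "k * real p powr (- 1 / 2)"] k l by simp
  also have "(l + k - 1) * real p powr (- 1 / 2) * (k * real p powr (- 1 / 2)) = (l + k - 1) * k * (real p powr (- 1 / 2) * real p powr (- 1 / 2))"
    by (simp only: mult_ac)
  also have "\<dots> = (l + k - 1) * k / real p"
    using prime_gt_0_nat[OF p] by (subst half_powr_square) auto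
  finally have "(\<lambda>n. \<Sum>i<n. complex_of_real (\<alpha> ^ i / fact i * twist_coeff k p i)) \<longlonglongrightarrow> of_real (bes ((l + k - 1) * k / real p))"
    using lim sum(2) by simp
  then show ?thesis
    unfolding of_real_sum[symmetric] tendsto_of_real_iff sums_def by (simp only: \<alpha>_def)
qed

lemma twist_coeff_partial:
  assumes p: "prime p" and k: "k \<ge> 1" and l: "l \<ge> 0"
  shows "0 \<le> twist_sum k l J p"
    and "twist_sum k l J p \<le> bes ((l + k - 1) * k / real p)"
proof -
  have nn: "0 \<le> (l * real p powr (- 1 / 2)) ^ j / fact j * twist_coeff k p j" for j
    using mean_osc_twist(2)[OF p k] l by simp
  show "0 \<le> twist_sum k l J p"
    unfolding twist_sum_def by (intro sum_nonneg nn)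
  note s = twist_coeff_sums[OF assms]
  show "twist_sum k l J p \<le> bes ((l + k - 1) * k / real p)"
    unfolding sums_unique[OF s] twist_sum_def by (rule sum_le_suminf[OF sums_summable[OF s]]) (use nn in auto)
qed

lemma dirpoly_osc: "dirpoly N t = (\<Sum>n=1..N. of_real (real n powr (- 1 / 2)) * osc n t)"
  by (simp add: dirpoly_conv_cis osc_def)

lemma ap_dirpoly: "ap UNIV UNIV (dirpoly N)"
  unfolding dirpoly_conv_cis[abs_def] by (intro trigs_ap trigs_sum trigs_monom) auto

text \<open>Rankin's trick removes the tuples with \<open>from_exponents S g > N\<close>.\<close>

lemma mean_dirpoly_twist_ge_partial:
  assumes S: "finite S" "\<And>p. p \<in> S \<Longrightarrow> prime p" and k: "k \<ge> 1" and d: "d \<ge> 0" and N: "N \<ge> 1"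
  shows "(\<Prod>p\<in>S. twist_sum k 1 J p)
       - real N powr (- d) * (\<Prod>p\<in>S. twist_sum k (real p powr d) J p)
    \<le> Re (mean (\<lambda>t. dirpoly N t * (\<Prod>p\<in>S. twist k p t)))"
proof -
  define T where "T = exponents S J"
  define n where "n = from_exponents S"
  define G where "G = (\<lambda>t. \<Prod>p\<in>S. twist k p t)"
  define \<mu> where "\<mu> = (\<lambda>m. Re (mean (\<lambda>t. osc m t * G t)))"
  \<comment> \<open>The factorials replace the coefficients of the Euler product by the smaller ones
    of \<open>exp X\<close>. This loses nothing essential and makes the local sums explicit.\<close>
  define w where "w = (\<lambda>g. \<Prod>p\<in>S. (real p powr (- 1 / 2)) ^ g p / fact (g p) * twist_coeff k p (g p))"
  have finT: "finite T" unfolding T_def by (rule finite_exponents[OF S(1)])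
  have npos: "n g > 0" for g unfolding n_def by (rule from_exponents_pos[OF S(2)])
  have apG: "ap \<real>\<^sub>\<ge>\<^sub>0 UNIV G"
    unfolding G_def by (intro ap_nonneg_prod S ap_mono[OF ap_twist[OF S(2) k]]) auto
  have ap_oG: "ap \<real>\<^sub>\<ge>\<^sub>0 UNIV (\<lambda>t. osc m t * G t)" if "m > 0" for m
    by (intro ap_nonneg_group_mult ap_osc that apG) auto
  have \<mu>0: "\<mu> m \<ge> 0" if "m > 0" for m
    using ap_mean_nonneg[OF ap_oG[OF that]] by (auto simp: \<mu>_def complex_nonneg_Reals_iff)
  have c0: "twist_coeff k p j \<ge> 0" if "p \<in> S" for p j using mean_osc_twist(2)[OF S(2)[OF that] k] .
  have w0: "w g \<ge> 0" for g
    unfolding w_def using c0 by (intro prod_nonneg) auto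
  have \<mu>n: "\<mu> (n g) = (\<Prod>p\<in>S. twist_coeff k p (g p))" for g
  proof -
    have "osc (n g) t * G t = (\<Prod>p\<in>S. osc p t ^ g p * twist k p t)" for t
      by (simp only: n_def G_def osc_from_exponents[OF S] prod.distrib)
    then have "mean (\<lambda>t. osc (n g) t * G t) = (\<Prod>p\<in>S. mean (\<lambda>t. osc p t ^ g p * twist k p t))"
      using mean_prod_primes[OF S(1), of "\<lambda>p t. osc p t ^ g p * twist k p t"] ap_mono[OF ap_osc_twist[OF S(2) k]] by simp
    also have "\<dots> = (\<Prod>p\<in>S. of_real (twist_coeff k p (g p)))"
      by (intro prod.cong refl mean_osc_twist S k)
    finally show ?thesis by (simp add: \<mu>_def flip: of_real_prod)
  qed
  have np: "real (n g) powr r = (\<Prod>p\<in>S. (real p powr r) ^ g p)" for g r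
    unfolding n_def by (rule from_exponents_powr[OF S(2)])
  have w_le: "w g \<le> real (n g) powr (- 1 / 2) * \<mu> (n g)" for g
    unfolding w_def np \<mu>n prod.distrib[symmetric]
  proof (intro prod_mono conjI)
    fix p assume p: "p \<in> S"
    show "0 \<le> (real p powr (- 1 / 2)) ^ g p / fact (g p) * twist_coeff k p (g p)" using c0[OF p] by simp
    have "(real p powr (- 1 / 2)) ^ g p / fact (g p) \<le> (real p powr (- 1 / 2)) ^ g p / 1"
      by (intro divide_left_mono fact_ge_1) auto
    then show "(real p powr (- 1 / 2)) ^ g p / fact (g p) * twist_coeff k p (g p) \<le> (real p powr (- 1 / 2)) ^ g p * twist_coeff k p (g p)"
      using c0[OF p] by (intro mult_right_mono) auto
  qed
  have "(\<Sum>g\<in>T. w g) - real N powr (- d) * (\<Sum>g\<in>T. real (n g) powr d * w g) = (\<Sum>g\<in>T. w g - (real N powr (- d) * real (n g) powr d) * w g)"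
    by (simp add: sum_subtractf sum_distrib_left mult.assoc)
  \<comment> \<open>For \<open>d >= 0\<close> the quantity \<open>1 - (n / N) powr d\<close> is at
    most the indicator of \<open>n <= N\<close>, and the weights \<open>w g\<close> are
    nonnegative.\<close>
  also have "\<dots> \<le> (\<Sum>g\<in>T. if n g \<le> N then w g else 0)"
  proof (rule sum_mono)
    fix g
    have "1 \<le> real N powr (- d) * real (n g) powr d" if "\<not> n g \<le> N"
    proof -
      have "real N powr d \<le> real (n g) powr d" using that d by (intro powr_mono2) auto
      then show ?thesis using N by (simp add: powr_minus_divide divide_simps)
    qed
    then show "w g - (real N powr (- d) * real (n g) powr d) * w g \<le> (if n g \<le> N then w g else 0)"
      using w0[of g] mult_right_mono[of 1 "real N powr (- d) * real (n g) powr d" "w g"] by auto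
  qed
  also have "\<dots> = (\<Sum>g\<in>{g\<in>T. n g \<le> N}. w g)"
    using finT by (simp add: sum.inter_filter)
  also have "\<dots> \<le> (\<Sum>g\<in>{g\<in>T. n g \<le> N}. real (n g) powr (- 1 / 2) * \<mu> (n g))"
    by (intro sum_mono w_le)
  also have "\<dots> = (\<Sum>m\<in>n ` {g\<in>T. n g \<le> N}. real m powr (- 1 / 2) * \<mu> m)"
    by (subst sum.reindex) (auto simp: n_def T_def intro: inj_on_subset[OF inj_from_exponents[OF S]])
  \<comment> \<open>The coefficients \<open>\<mu> m\<close> are nonnegative, so the integers not
    reached by the tuples may be added.\<close>
  also have "\<dots> \<le> (\<Sum>m=1..N. real m powr (- 1 / 2) * \<mu> m)"
    using npos \<mu>0 by (intro sum_mono2) (auto simp: Suc_le_eq)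
  also have "\<dots> = Re (mean (\<lambda>t. dirpoly N t * G t))"
  proof -
    have "ap UNIV UNIV (\<lambda>t. dirpoly N t * G t)"
      by (intro ap_group_mult ap_dirpoly ap_UNIV[OF apG]) auto
    from mean_Re[OF this] have "Re (mean (\<lambda>t. dirpoly N t * G t)) = mean (\<lambda>t. \<Sum>m=1..N. real m powr (- 1 / 2) * Re (osc m t * G t))"
      by (simp add: dirpoly_osc sum_distrib_right mult.assoc)
    also have "\<dots> = (\<Sum>m=1..N. mean (\<lambda>t. real m powr (- 1 / 2) * Re (osc m t * G t)))"
      by (intro mean_sum rap_cmult rap_Re ap_UNIV[OF ap_oG]) auto
    also have "\<dots> = (\<Sum>m=1..N. real m powr (- 1 / 2) * \<mu> m)"
    proof (rule sum.cong[OF refl])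
      fix m assume "m \<in> {1..N}"
      then have "ap UNIV UNIV (\<lambda>t. osc m t * G t)" by (intro ap_UNIV[OF ap_oG]) auto
      then show "mean (\<lambda>t. real m powr (- 1 / 2) * Re (osc m t * G t)) = real m powr (- 1 / 2) * \<mu> m"
        unfolding \<mu>_def by (subst mean_cmult[OF rap_Re]) (simp_all only: mean_Re)
    qed
    finally show ?thesis by simp
  qed
  finally have "(\<Sum>g\<in>T. w g) - real N powr (- d) * (\<Sum>g\<in>T. real (n g) powr d * w g) \<le> Re (mean (\<lambda>t. dirpoly N t * G t))" .
  moreover have "(\<Sum>g\<in>T. w g) = (\<Prod>p\<in>S. twist_sum k 1 J p)"
    unfolding T_def exponents_def w_def twist_sum_def mult_1 by (rule prod_sum_PiE[symmetric]) (use S in auto)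
  moreover have "(\<Sum>g\<in>T. real (n g) powr d * w g) = (\<Prod>p\<in>S. twist_sum k (real p powr d) J p)"
  proof -
    have "real (n g) powr d * w g = (\<Prod>p\<in>S. (real p powr d * real p powr (- 1 / 2)) ^ g p / fact (g p) * twist_coeff k p (g p))" for g
      unfolding np w_def prod.distrib[symmetric] power_mult_distrib by (intro prod.cong refl) simp
    then show ?thesis
      unfolding T_def exponents_def twist_sum_def by (simp only:) (rule prod_sum_PiE[symmetric], use S in auto)
  qed
  ultimately show ?thesis by (simp only: G_def)
qed

lemma mean_dirpoly_twist_ge:
  assumes S: "finite S" "\<And>p. p \<in> S \<Longrightarrow> prime p" and k: "k \<ge> 1" and d: "d \<ge> 0" and N: "N \<ge> 1"
  shows "(\<Prod>p\<in>S. bes (k\<^sup>2 / real p)) - real N powr (- d) * (\<Prod>p\<in>S. bes ((real p powr d + k - 1) * k / real p))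
    \<le> Re (mean (\<lambda>t. dirpoly N t * (\<Prod>p\<in>S. twist k p t)))"
proof (rule LIMSEQ_le_const2)
  have "(\<lambda>J. \<Prod>p\<in>S. twist_sum k 1 J p) \<longlonglongrightarrow> (\<Prod>p\<in>S. bes ((1 + k - 1) * k / real p))"
    using twist_coeff_sums[OF S(2) k, of _ 1] by (intro tendsto_prod) (auto simp: sums_def_le twist_sum_def)
  then show "(\<lambda>J. (\<Prod>p\<in>S. twist_sum k 1 J p)
      - real N powr (- d) * (\<Prod>p\<in>S. bes ((real p powr d + k - 1) * k / real p))) \<longlonglongrightarrow>
      (\<Prod>p\<in>S. bes (k\<^sup>2 / real p)) - real N powr (- d) * (\<Prod>p\<in>S. bes ((real p powr d + k - 1) * k / real p))"
    by (intro tendsto_diff tendsto_const) (simp add: power2_eq_square)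
  show "\<exists>M. \<forall>J\<ge>M. (\<Prod>p\<in>S. twist_sum k 1 J p)
      - real N powr (- d) * (\<Prod>p\<in>S. bes ((real p powr d + k - 1) * k / real p)) \<le> Re (mean (\<lambda>t. dirpoly N t * (\<Prod>p\<in>S. twist k p t)))"
  proof (intro exI[of _ 0] allI impI)
    fix J
    have "(\<Prod>p\<in>S. twist_sum k (real p powr d) J p) \<le> (\<Prod>p\<in>S. bes ((real p powr d + k - 1) * k / real p))"
      by (intro prod_mono conjI twist_coeff_partial S k) auto
    then have "real N powr (- d) * (\<Prod>p\<in>S. twist_sum k (real p powr d) J p) \<le>
        real N powr (- d) * (\<Prod>p\<in>S. bes ((real p powr d + k - 1) * k / real p))"
      by (rule mult_left_mono) simp
    then show "(\<Prod>p\<in>S. twist_sum k 1 J p)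
      - real N powr (- d) * (\<Prod>p\<in>S. bes ((real p powr d + k - 1) * k / real p)) \<le> Re (mean (\<lambda>t. dirpoly N t * (\<Prod>p\<in>S. twist k p t)))"
      using mean_dirpoly_twist_ge_partial[OF S k d N, of J] by linarith
  qed
qed

lemma norm_twist: "norm (twist k p t) = exp ((2 * k - 1) * (real p powr (- 1 / 2) * Re (osc p t)))"
  unfolding twist_def norm_mult complex_mod_cnj norm_exp_eq_Re exp_add[symmetric]
  by (simp add: algebra_simps)

text \<open>Duality: with \<open>q\<close> conjugate to \<open>r = 2 * k\<close>, the
  \<open>q\<close>-th power of the norm of the twist product is \<open>exp (2 k X)\<close>, here
  with \<open>X\<close> denoting the real part. That is the squared norm of
  \<open>exp (k X)\<close>, and its mean is exactly the Bessel product.\<close>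

lemma pseudomoment_ge_twist:
  assumes S: "finite S" "\<And>p. p \<in> S \<Longrightarrow> prime p" and k: "k \<ge> 1"
    and ge: "(\<Prod>p\<in>S. bes (k\<^sup>2 / real p)) / 2 \<le> Re (mean (\<lambda>t. dirpoly N t * (\<Prod>p\<in>S. twist k p t)))"
  shows "2 powr (- 2 * k) * (\<Prod>p\<in>S. bes (k\<^sup>2 / real p)) \<le> pseudomoment k N"
proof -
  define G where "G = (\<lambda>t. \<Prod>p\<in>S. twist k p t)"
  define V where "V = (\<Prod>p\<in>S. bes (k\<^sup>2 / real p))"
  define e where "e = (\<lambda>p t. exp (complex_of_real (k * real p powr (- 1 / 2)) * osc p t) * cnj (exp (complex_of_real (k * real p powr (- 1 / 2)) * osc p t)))"
  define W where "W = (\<lambda>t. \<Prod>p\<in>S. e p t)"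
  define X where "X = (\<lambda>t. \<Sum>p\<in>S. real p powr (- 1 / 2) * Re (osc p t))"
  have nG: "norm (G t) = exp ((2 * k - 1) * X t)" for t
    unfolding G_def X_def prod_norm[symmetric] norm_twist sum_distrib_left exp_sum[OF S(1)] ..
  have WX: "W t = of_real (exp (2 * k * X t))" for t
  proof -
    have "e p t = of_real (exp (2 * k * (real p powr (- 1 / 2) * Re (osc p t))))" for p
      unfolding e_def complex_norm_square[symmetric] norm_exp_eq_Re
      by (simp add: exp_double[symmetric] flip: of_real_power)
    then show ?thesis
      unfolding W_def X_def sum_distrib_left exp_sum[OF S(1)] by simp
  qed
  have ape: "ap UNIV (freqs {p}) (e p)" if "p \<in> S" for p
    unfolding e_def using ap_exp_osc[OF S(2)[OF that], of "k * real p powr (- 1 / 2)"] k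
    by (intro ap_group_mult subgroup_freqs) (auto intro: ap_mono)
  have "mean W = (\<Prod>p\<in>S. mean (e p))"
    unfolding W_def by (rule mean_prod_primes[OF S(1) ape])
  also have "\<dots> = (\<Prod>p\<in>S. of_real (bes (k\<^sup>2 / real p)))"
  proof (rule prod.cong[OF refl])
    fix p assume p: "p \<in> S"
    have "k * real p powr (- 1 / 2) * (k * real p powr (- 1 / 2)) = k\<^sup>2 * (real p powr (- 1 / 2) * real p powr (- 1 / 2))"
      by (simp only: power2_eq_square mult_ac)
    also have "\<dots> = k\<^sup>2 / real p"
      using prime_gt_0_nat[OF S(2)[OF p]] by (subst half_powr_square) auto
    finally have *: "k * real p powr (- 1 / 2) * (k * real p powr (- 1 / 2)) = k\<^sup>2 / real p" .
    show "mean (e p) = of_real (bes (k\<^sup>2 / real p))"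
      unfolding e_def *[symmetric] using k by (intro mean_exp_osc S p) auto
  qed
  finally have mW: "mean W = of_real V" by (simp add: V_def)
  have apW: "ap UNIV UNIV W"
    unfolding W_def by (rule ap_UNIV[OF ap_prod_primes[OF S(1) ape]])
  have rW: "rap (\<lambda>t. exp (2 * k * X t))" using apW by (simp add: rap_def WX[abs_def])
  have mWr: "mean (\<lambda>t. exp (2 * k * X t)) = V"
    using mean_of_real[OF rW] mW unfolding WX[abs_def] by simp
  have apG: "ap UNIV UNIV G"
    unfolding G_def by (rule ap_UNIV[OF ap_prod_primes[OF S(1)]]) (rule ap_mono[OF ap_twist[OF S(2) k]], auto)
  define r where "r = 2 * k"
  define q where "q = r / (r - 1)"
  have r: "r > 1" and q: "q > 1" and rq: "1 / r + 1 / q = 1" "(r - 1) * q = r"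
    using k by (auto simp: r_def q_def field_simps)
  \<comment> \<open>The scaling has \<open>s powr q = 2\<close>, which halves the term of the twist
    product in Young's inequality. That term becomes \<open>V / (2 * q)\<close>, and
    \<open>V / (2 * r)\<close> of the available \<open>V / 2\<close> is left for the
    pseudomoment.\<close>
  define s where "s = (2::real) powr (1 / q)"
  have s: "s > 0" "s powr q = 2" "s powr r = 2 powr (r - 1)"
    using r q rq by (auto simp: s_def powr_powr) (simp add: q_def)
  have young: "Re (dirpoly N t * G t) \<le> 2 powr (r - 1) / r * norm (dirpoly N t) powr r + 1 / (2 * q) * exp (2 * k * X t)" for t
  proof -
    have "Re (dirpoly N t * G t) \<le> (norm (dirpoly N t) * s) * (exp ((r - 1) * X t) / s)"
      using complex_Re_le_cmod[of "dirpoly N t * G t"] s by (simp add: norm_mult nG r_def)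
    also have "\<dots> \<le> (norm (dirpoly N t) * s) powr r / r + (exp ((r - 1) * X t) / s) powr q / q"
      using s by (intro Youngs_inequality r q rq) auto
    also have "(norm (dirpoly N t) * s) powr r = norm (dirpoly N t) powr r * 2 powr (r - 1)"
      using s by (simp add: powr_mult)
    also have "(exp ((r - 1) * X t) / s) powr q = exp (2 * k * X t) / 2"
    proof -
      have "exp ((r - 1) * X t) powr q = exp (((r - 1) * q) * X t)"
        by (simp add: powr_def mult_ac)
      then show ?thesis using s rq(2) by (simp add: powr_divide r_def)
    qed
    finally show ?thesis by (simp add: mult_ac)
  qed
  have apPG: "ap UNIV UNIV (\<lambda>t. dirpoly N t * G t)"
    by (intro ap_group_mult ap_dirpoly apG) auto
  have rP: "rap (\<lambda>t. norm (dirpoly N t) powr r)" using r by (intro rap_norm_powr ap_dirpoly) auto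
  have "V / 2 \<le> mean (\<lambda>t. Re (dirpoly N t * G t))"
    using ge mean_Re[OF apPG] by (simp add: V_def G_def)
  also have "\<dots> \<le> mean (\<lambda>t. 2 powr (r - 1) / r * norm (dirpoly N t) powr r + 1 / (2 * q) * exp (2 * k * X t))"
    by (intro mean_mono rap_Re apPG rap_add rap_cmult rP rW young)
  also have "\<dots> = 2 powr (r - 1) / r * pseudomoment k N + 1 / (2 * q) * V"
  proof -
    have "mean (\<lambda>t. norm (dirpoly N t) powr r) = pseudomoment k N" by (simp add: pseudomoment_eq_mean r_def)
    then show ?thesis
      by (simp only: mean_add[OF rap_cmult[OF rP] rap_cmult[OF rW]] mean_cmult[OF rP] mean_cmult[OF rW] mWr)
  qed
  finally have "V / 2 * (1 - 1 / q) \<le> 2 powr (r - 1) / r * pseudomoment k N"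
    by (simp add: algebra_simps)
  moreover have "1 - 1 / q = 1 / r" using rq(1) by linarith
  ultimately have "V / 2 * (1 / r) \<le> 2 powr (r - 1) / r * pseudomoment k N"
    by (simp only:)
  then have "V / 2 \<le> 2 powr (r - 1) * pseudomoment k N"
    using r by (simp add: divide_simps)
  then have "V \<le> 2 powr r * pseudomoment k N"
    by (simp add: powr_diff)
  then have "2 powr (- r) * V \<le> 2 powr (- r) * (2 powr r * pseudomoment k N)"
    by (intro mult_left_mono) auto
  also have "\<dots> = pseudomoment k N"
    by (simp add: powr_minus)
  finally show ?thesis by (simp add: r_def V_def)
qed

lemma exp_le_one_plus_double:
  assumes "0 \<le> u" "u \<le> (1::real)" shows "exp u \<le> 1 + 2 * u"
proof -
  have "u\<^sup>2 \<le> u" using assms by (simp add: power2_eq_square mult_left_le)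
  then show ?thesis using exp_bound[OF assms] by linarith
qed

text \<open>Primes up to \<open>k^2\<close> are dropped since their factors are at least 1; this is
  the source of \<open>- ln (ln k)\<close>. For the others \<open>u = k^2 / p\<close> is at most 1
  and \<open>bes u >= 1 + u >= exp (u - u^2)\<close>, where the squares cost at most
  \<open>2 k^2\<close>. The constant 9 is 6 from Mertens, 1 from \<open>ln 2\<close> and 2 from the
  squares.\<close>

lemma prod_bes_ge:
  assumes k: "k \<ge> 2" and y: "y \<ge> 2"
  shows "exp (k\<^sup>2 * (ln (ln (real y)) - ln (ln k) - 9)) \<le> (\<Prod>p\<in>primes_upto y. bes (k\<^sup>2 / real p))"
proof -
  define Q where "Q = nat \<lfloor>k\<^sup>2\<rfloor>"
  have k2: "k\<^sup>2 \<ge> 4" using power_mono[of 2 k 2] k by simp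
  have Q: "Q \<ge> 3" "real Q \<le> k\<^sup>2" "k\<^sup>2 < real Q + 1"
    using k2 unfolding Q_def by linarith+
  let ?S = "primes_upto y - primes_upto Q"
  have pS: "k\<^sup>2 < real p" "prime p" "Q < p" "p \<le> y" if "p \<in> ?S" for p
  proof -
    show "prime p" "Q < p" "p \<le> y" using that by (auto simp: primes_upto_def)
    then have "real Q + 1 \<le> real p" by linarith
    then show "k\<^sup>2 < real p" using Q by linarith
  qed
  have lnQ: "ln (ln (real Q)) \<le> 1 + ln (ln k)"
  proof -
    have "ln (real Q) \<le> ln (k\<^sup>2)" using Q by (intro ln_mono) auto
    also have "ln (k\<^sup>2) = 2 * ln k" using k by (simp add: ln_realpow)
    finally have "ln (ln (real Q)) \<le> ln (2 * ln k)" using Q k by (intro ln_mono) auto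
    also have "\<dots> = ln 2 + ln (ln k)" using k by (intro ln_mult_pos) auto
    also have "ln (2::real) \<le> 1" using ln_le_minus_one[of 2] by simp
    finally show ?thesis by simp
  qed
  have sq: "(\<Sum>p\<in>?S. 1 / (real p)\<^sup>2) \<le> 2 / k\<^sup>2"
  proof -
    have "(\<Sum>p\<in>?S. 1 / (real p)\<^sup>2) \<le> 1 / real Q" using Q by (intro sum_prime_inverse_squares_le) auto
    also have "\<dots> \<le> 2 / k\<^sup>2"
    proof -
      have "k\<^sup>2 \<le> 2 * real Q" using Q by linarith
      then show ?thesis using Q k by (simp add: divide_simps)
    qed
    finally show ?thesis .
  qed
  have "k\<^sup>2 * (ln (ln (real y)) - ln (ln k) - 9) \<le> k\<^sup>2 * (\<Sum>p\<in>?S. 1 / real p) - k\<^sup>2 * 2"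
  proof -
    have "ln (ln (real y)) - ln (ln k) - 9 \<le> (\<Sum>p\<in>?S. 1 / real p) - 2"
      using sum_prime_inverse_tail_ge[OF y Q(1)] lnQ by linarith
    then show ?thesis
      unfolding right_diff_distrib[symmetric] by (intro mult_left_mono) auto
  qed
  also have "\<dots> \<le> k\<^sup>2 * (\<Sum>p\<in>?S. 1 / real p) - (k\<^sup>2)\<^sup>2 * (\<Sum>p\<in>?S. 1 / (real p)\<^sup>2)"
  proof -
    have "(k\<^sup>2)\<^sup>2 * (\<Sum>p\<in>?S. 1 / (real p)\<^sup>2) \<le> (k\<^sup>2)\<^sup>2 * (2 / k\<^sup>2)" by (intro mult_left_mono sq) simp
    also have "\<dots> = k\<^sup>2 * 2" using k2 by (simp add: power2_eq_square)
    finally show ?thesis by simp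
  qed
  also have "\<dots> = (\<Sum>p\<in>?S. k\<^sup>2 / real p - (k\<^sup>2 / real p)\<^sup>2)"
    by (simp add: sum_subtractf sum_distrib_left power_divide)
  finally have "exp (k\<^sup>2 * (ln (ln (real y)) - ln (ln k) - 9)) \<le> exp (\<Sum>p\<in>?S. k\<^sup>2 / real p - (k\<^sup>2 / real p)\<^sup>2)"
    by simp
  also have "\<dots> = (\<Prod>p\<in>?S. exp (k\<^sup>2 / real p - (k\<^sup>2 / real p)\<^sup>2))"
    by (rule exp_sum) simp
  also have "\<dots> \<le> (\<Prod>p\<in>?S. bes (k\<^sup>2 / real p))"
  proof (intro prod_mono conjI)
    fix p assume p: "p \<in> ?S"
    have u: "0 \<le> k\<^sup>2 / real p" "k\<^sup>2 / real p \<le> 1" using pS[OF p] k2 by (auto simp: divide_simps)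
    have "exp (k\<^sup>2 / real p - (k\<^sup>2 / real p)\<^sup>2) \<le> exp (ln (1 + k\<^sup>2 / real p))"
      using ln_one_plus_pos_lower_bound[OF u] by simp
    also have "\<dots> = 1 + k\<^sup>2 / real p" using u by (intro exp_ln) linarith
    also have "\<dots> \<le> bes (k\<^sup>2 / real p)" by (rule bes_ge[OF u(1)])
    finally show "exp (k\<^sup>2 / real p - (k\<^sup>2 / real p)\<^sup>2) \<le> bes (k\<^sup>2 / real p)" .
  qed simp
  also have "\<dots> \<le> (\<Prod>p\<in>primes_upto y. bes (k\<^sup>2 / real p))"
  proof (rule prod_mono2)
    fix p assume "p \<in> primes_upto y - ?S"
    have "0 \<le> k\<^sup>2 / real p" by simp
    then show "1 \<le> bes (k\<^sup>2 / real p)" using bes_ge[of "k\<^sup>2 / real p"] by linarith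
  next
    fix p
    show "0 \<le> bes (k\<^sup>2 / real p)" by (rule bes_nonneg) simp
  qed auto
  finally show ?thesis .
qed

text \<open>The cutoff is \<open>y = exp L\<close> with \<open>L = ln N / (5 k)\<close>, up to
  rounding, and Rankin's exponent is \<open>d = 1 / L\<close>. For \<open>p <= y\<close> one has
  \<open>p powr d - 1 <= 2 * d * ln p\<close>, so the weights enlarge the Bessel product by at most
  \<open>exp (4 k)\<close>, while \<open>N powr (- d) = exp (- 5 k)\<close>. The tail is then at
  most half of the main term, which is why the factor 5 is chosen.\<close>

lemma pseudomoment_lower:
  assumes k: "k \<ge> 2" and N: "N \<ge> 1" and kN: "5 * k \<le> ln (real N)"
  shows "exp (- k\<^sup>2 * ln k - k\<^sup>2 * ln (ln k) - 19 * k\<^sup>2) \<le> pseudomoment k N / ln (real N) powr (k\<^sup>2)"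
proof -
  define L where "L = ln (real N) / (5 * k)"
  define y where "y = nat \<lfloor>exp L\<rfloor>"
  define d where "d = 1 / L"
  define S where "S = primes_upto y"
  define V where "V = (\<Prod>p\<in>S. bes (k\<^sup>2 / real p))"
  have L: "L \<ge> 1" using k kN by (simp add: L_def divide_simps)
  have lnN: "ln (real N) > 0" using k kN by linarith
  have "exp L \<ge> 2" using exp_ge_add_one_self[of L] L by linarith
  then have y: "y \<ge> 2" "real y \<le> exp L" "exp L < real y + 1" unfolding y_def by linarith+
  have S: "finite S" "\<And>p. p \<in> S \<Longrightarrow> prime p" by (auto simp: S_def primes_upto_def)
  have lny: "ln (real y) \<le> L"
    using ln_mono[of "real y" "exp L"] y by simp
  have lny2: "L / 2 \<le> ln (real y)"
  proof -
    have "exp L \<le> 3 / 2 * real y" using y by linarith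
    also have "\<dots> \<le> exp (1 / 2) * real y"
      using exp_ge_add_one_self[of "1 / 2"] by (intro mult_right_mono) auto
    finally have "exp (L - 1 / 2) \<le> real y" by (simp only: exp_diff) (simp add: divide_simps mult.commute)
    then have "L - 1 / 2 \<le> ln (real y)" using y by (subst ln_ge_iff) auto
    then show ?thesis using L by linarith
  qed
  have pd: "real p powr d - 1 \<le> 2 * d * ln (real p)" "0 \<le> real p powr d - 1" if "p \<in> S" for p
  proof -
    have p: "p \<ge> 1" "p \<le> y" using that prime_ge_1_nat by (auto simp: S_def primes_upto_def)
    have "ln (real p) \<le> ln (real y)" using p by (intro ln_mono) auto
    then have "d * ln (real p) \<le> 1" using lny L by (simp add: d_def)
    moreover have "0 \<le> d * ln (real p)" using p L by (simp add: d_def)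
    moreover have "real p powr d = exp (d * ln (real p))" using p by (simp add: powr_def)
    ultimately show "real p powr d - 1 \<le> 2 * d * ln (real p)" "0 \<le> real p powr d - 1"
      using exp_le_one_plus_double[of "d * ln (real p)"] by auto
  qed
  have V0: "V \<ge> 0" unfolding V_def
  proof (rule prod_nonneg)
    fix p
    show "0 \<le> bes (k\<^sup>2 / real p)" by (rule bes_nonneg) simp
  qed
  have "(\<Prod>p\<in>S. bes ((real p powr d + k - 1) * k / real p)) \<le> (\<Prod>p\<in>S. bes (k\<^sup>2 / real p) * exp (2 * d * k * (ln (real p) / real p)))"
  proof (intro prod_mono conjI)
    fix p assume p: "p \<in> S"
    have pos: "real p > 0" using prime_gt_0_nat[OF S(2)[OF p]] by simp
    show "0 \<le> bes ((real p powr d + k - 1) * k / real p)" using pd[OF p] k pos by (intro bes_nonneg) simp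
    have "(real p powr d + k - 1) * k / real p = k\<^sup>2 / real p + (real p powr d - 1) * (k / real p)"
      by (simp add: power2_eq_square add_divide_distrib[symmetric] algebra_simps)
    then have "bes ((real p powr d + k - 1) * k / real p) \<le> bes (k\<^sup>2 / real p) * exp ((real p powr d - 1) * (k / real p))"
      using bes_add_le[of "k\<^sup>2 / real p" "(real p powr d - 1) * (k / real p)"] pd[OF p] k by simp
    also have "\<dots> \<le> bes (k\<^sup>2 / real p) * exp ((2 * d * ln (real p)) * (k / real p))"
    proof (intro mult_left_mono)
      show "exp ((real p powr d - 1) * (k / real p)) \<le> exp ((2 * d * ln (real p)) * (k / real p))"
        unfolding exp_le_cancel_iff using pd(1)[OF p] k by (intro mult_right_mono) auto
      show "0 \<le> bes (k\<^sup>2 / real p)" by (rule bes_nonneg) simp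
    qed
    finally show "bes ((real p powr d + k - 1) * k / real p) \<le> bes (k\<^sup>2 / real p) * exp (2 * d * k * (ln (real p) / real p))"
      by (simp add: mult_ac)
  qed
  also have "\<dots> = V * exp (2 * d * k * (\<Sum>p\<in>S. ln (real p) / real p))"
    by (simp only: prod.distrib exp_sum[OF S(1), symmetric] sum_distrib_left V_def)
  also have "\<dots> \<le> V * exp (4 * k)"
  proof (intro mult_left_mono V0)
    have "(\<Sum>p\<in>S. ln (real p) / real p) \<le> 2 * L" using sum_ln_prime_le[of y] lny by (simp add: S_def)
    then have "2 * d * k * (\<Sum>p\<in>S. ln (real p) / real p) \<le> 2 * d * k * (2 * L)"
      using k L by (intro mult_left_mono) (auto simp: d_def)
    also have "\<dots> = 4 * k" using L by (simp add: d_def)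
    finally show "exp (2 * d * k * (\<Sum>p\<in>S. ln (real p) / real p)) \<le> exp (4 * k)" by simp
  qed
  finally have tail: "(\<Prod>p\<in>S. bes ((real p powr d + k - 1) * k / real p)) \<le> V * exp (4 * k)" .
  have "real N powr (- d) = exp (- (5 * k))"
    using N lnN k by (simp add: powr_def d_def L_def)
  then have "real N powr (- d) * (\<Prod>p\<in>S. bes ((real p powr d + k - 1) * k / real p)) \<le> exp (- (5 * k)) * (V * exp (4 * k))"
    using tail by (simp add: mult_left_mono)
  also have "\<dots> = V * exp (- k)" by (simp add: mult_exp_exp)
  also have "\<dots> \<le> V * (1 / 2)"
  proof (intro mult_left_mono V0)
    have "2 \<le> exp k" using exp_ge_add_one_self[of k] k by linarith
    then show "exp (- k) \<le> 1 / 2" by (simp add: exp_minus divide_simps)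
  qed
  finally have "V / 2 \<le> V - real N powr (- d) * (\<Prod>p\<in>S. bes ((real p powr d + k - 1) * k / real p))" by simp
  also have "\<dots> \<le> Re (mean (\<lambda>t. dirpoly N t * (\<Prod>p\<in>S. twist k p t)))"
    unfolding V_def using L k by (intro mean_dirpoly_twist_ge S N) (auto simp: d_def)
  finally have M: "2 powr (- 2 * k) * V \<le> pseudomoment k N"
    unfolding V_def using k by (intro pseudomoment_ge_twist S) auto
  have "exp (- k\<^sup>2 * ln k - k\<^sup>2 * ln (ln k) - 19 * k\<^sup>2) * ln (real N) powr (k\<^sup>2)
      = exp (k\<^sup>2 * (ln (ln (real N)) - ln k - ln (ln k) - 19))"
    using lnN by (simp add: powr_def mult_exp_exp algebra_simps)
  also have "\<dots> \<le> exp (- k\<^sup>2 + k\<^sup>2 * (ln (ln (real y)) - ln (ln k) - 9))"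
  proof -
    have "ln (L / 2) \<le> ln (ln (real y))" using lny2 L by (intro ln_mono) auto
    moreover have "ln (L / 2) = ln (ln (real N)) - ln (10 * k)"
      using lnN k by (simp add: L_def ln_divide_pos)
    moreover have "ln (10 * k) = ln 10 + ln k" using k by (intro ln_mult_pos) auto
    moreover have "ln (10::real) \<le> 9" using ln_le_minus_one[of 10] by simp
    \<comment> \<open>The constant 19 is 9 for \<open>ln 10\<close> (from the factor 10 in
      \<open>L / 2\<close>), 9 from the Bessel product and 1 for the factor
      \<open>2 powr (- 2 * k)\<close>.\<close>
    ultimately have "ln (ln (real N)) - ln k - ln (ln k) - 19 \<le> - 1 + (ln (ln (real y)) - ln (ln k) - 9)" by linarith
    then have "k\<^sup>2 * (ln (ln (real N)) - ln k - ln (ln k) - 19) \<le> k\<^sup>2 * (- 1 + (ln (ln (real y)) - ln (ln k) - 9))"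
      by (intro mult_left_mono) auto
    then show ?thesis by (simp add: algebra_simps)
  qed
  also have "\<dots> \<le> 2 powr (- 2 * k) * V"
  proof -
    have "exp (- k\<^sup>2) \<le> 2 powr (- 2 * k)"
    proof -
      have "ln (2::real) \<le> 1" using ln_le_minus_one[of 2] by simp
      then have "2 * k * ln 2 \<le> 2 * k * 1" using k by (intro mult_left_mono) auto
      also have "\<dots> \<le> k\<^sup>2" using k by (simp add: power2_eq_square mult_right_mono)
      finally show ?thesis by (simp add: powr_def)
    qed
    then show ?thesis unfolding exp_add V_def S_def
      by (intro mult_mono prod_bes_ge k y) auto
  qed
  also note M
  finally show ?thesis using lnN by (simp add: pos_le_divide_eq)
qed

text \<open>Convexity at the point 1: \<open>norm z powr (2 * k)\<close> lies above the affine
  function \<open>1 + 2 * k * Re (z - 1)\<close>. Since \<open>dirpoly N t - 1\<close> contains only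
  the frequencies \<open>- ln n\<close> with \<open>n >= 2\<close>, the affine function has mean
  1.\<close>

lemma pseudomoment_ge_1:
  assumes k: "k > 1" and N: "N \<ge> 1" shows "1 \<le> pseudomoment k N"
proof -
  have apD: "ap UNIV UNIV (\<lambda>t. dirpoly N t - 1)"
    using ap_add[OF ap_dirpoly[of N] ap_const[OF add_subgroup_UNIV, of "- 1"]] by simp
  have m1: "mean (\<lambda>t. Re (dirpoly N t - 1)) = 0"
  proof -
    have "(\<lambda>t. dirpoly N t - 1) = (\<lambda>t. \<Sum>n=2..N. of_real (real n powr (- 1 / 2)) * cis (- ln (real n) * t))"
      using N by (intro ext) (simp add: dirpoly_conv_cis sum.atLeast_Suc_atMost numeral_2_eq_2)
    moreover have "\<dots> \<in> trigs UNIV {..<0}" by (intro trigs_sum trigs_monom) auto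
    ultimately have "mean (\<lambda>t. dirpoly N t - 1) = 0" using trigs_mean_nonzero_freq[of _ UNIV "{..<0}"] by auto
    then show ?thesis using mean_Re[OF apD] by simp
  qed
  have bern: "1 + k * (2 * Re (z - 1)) \<le> norm z powr (2 * k)" for z
  proof -
    have "1 + 2 * Re (z - 1) \<le> (norm z)\<^sup>2"
    proof -
      have "0 \<le> (Re z - 1)\<^sup>2 + (Im z)\<^sup>2" by simp
      then show ?thesis unfolding cmod_power2 by (simp add: power2_eq_square algebra_simps)
    qed
    then have "k * (1 + 2 * Re (z - 1)) \<le> k * (norm z)\<^sup>2" using k by (intro mult_left_mono) auto
    moreover have "(norm z)\<^sup>2 * 1 \<le> ((norm z)\<^sup>2) powr k / k + 1 powr (k / (k - 1)) / (k / (k - 1))"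
      using k by (intro Youngs_inequality) (auto simp: field_simps)
    then have "(norm z)\<^sup>2 \<le> (((norm z)\<^sup>2) powr k + (k - 1)) / k"
      by (simp add: add_divide_distrib)
    then have "k * (norm z)\<^sup>2 \<le> ((norm z)\<^sup>2) powr k + (k - 1)"
      using k by (simp only: pos_le_divide_eq) (simp add: mult.commute)
    moreover have "((norm z)\<^sup>2) powr k = norm z powr (2 * k)"
      by (cases "z = 0") (simp_all add: powr_powr flip: powr_numeral)
    ultimately show ?thesis by (simp add: algebra_simps)
  qed
  have "1 = mean (\<lambda>t. 1 + k * (2 * Re (dirpoly N t - 1)))"
    by (subst mean_add) (simp_all only: mean_const mean_cmult rap_cmult rap_const rap_Re[OF apD] m1 mult_zero_right add_0_right)
  also have "\<dots> \<le> pseudomoment k N"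
    unfolding pseudomoment_eq_mean
    using k by (intro mean_mono rap_add rap_const rap_cmult rap_Re apD rap_norm_powr ap_dirpoly bern) auto
  finally show ?thesis .
qed

section \<open>The upper bound\<close>

text \<open>The power mean inequality, obtained by applying Young's inequality to \<open>x i\<close>
  and \<open>S powr (r - 1)\<close>, where \<open>S\<close> is the weighted mean, and summing over
  \<open>i\<close>.\<close>

lemma powr_weighted_mean:
  fixes w x :: "'a \<Rightarrow> real"
  assumes fin: "finite I" and w: "\<And>i. i \<in> I \<Longrightarrow> w i \<ge> 0" and x: "\<And>i. i \<in> I \<Longrightarrow> x i \<ge> 0"
    and W: "sum w I > 0" and r: "r > 1"
  shows "(\<Sum>i\<in>I. w i * x i) powr r \<le> sum w I powr (r - 1) * (\<Sum>i\<in>I. w i * x i powr r)"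
proof -
  define W where "W = sum w I"
  define S where "S = (\<Sum>i\<in>I. w i * x i) / W"
  have W0: "W > 0" using W by (simp add: W_def)
  have sum0: "(\<Sum>i\<in>I. w i * x i) \<ge> 0" using w x by (intro sum_nonneg) auto
  have S0: "S \<ge> 0" using sum0 W0 by (simp add: S_def)
  have conj: "1 / r + 1 / (r / (r - 1)) = 1" "r / (r - 1) > 1" "(r - 1) * (r / (r - 1)) = r"
    using r by (auto simp: field_simps)
  have step: "w i * x i * S powr (r - 1) \<le> w i * x i powr r / r + w i * (S powr r * ((r - 1) / r))" if "i \<in> I" for i
  proof -
    have "x i * S powr (r - 1) \<le> x i powr r / r + (S powr (r - 1)) powr (r / (r - 1)) / (r / (r - 1))"
      using r x[OF that] conj by (intro Youngs_inequality) auto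
    also have "(S powr (r - 1)) powr (r / (r - 1)) = S powr r" by (simp only: powr_powr conj)
    finally have "w i * (x i * S powr (r - 1)) \<le> w i * (x i powr r / r + S powr r / (r / (r - 1)))"
      using w[OF that] by (intro mult_left_mono)
    then show ?thesis by (simp add: algebra_simps)
  qed
  have "(\<Sum>i\<in>I. w i * x i) * S powr (r - 1) \<le> (\<Sum>i\<in>I. w i * x i powr r / r + w i * (S powr r * ((r - 1) / r)))"
    unfolding sum_distrib_right by (intro sum_mono step)
  also have "\<dots> = (\<Sum>i\<in>I. w i * x i powr r) / r + W * (S powr r * ((r - 1) / r))"
    by (simp only: sum.distrib sum_divide_distrib sum_distrib_right W_def)
  also have "(\<Sum>i\<in>I. w i * x i) * S powr (r - 1) = W * S powr r"
  proof (cases "S = 0")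
    case True
    then show ?thesis using W0 r by (simp add: S_def)
  next
    case False
    then have "S powr r = S * S powr (r - 1)" using S0 powr_add[of S 1 "r - 1"] by simp
    moreover have "(\<Sum>i\<in>I. w i * x i) = W * S" using W0 by (simp add: S_def)
    ultimately show ?thesis by simp
  qed
  finally have "W * S powr r * (1 - (r - 1) / r) \<le> (\<Sum>i\<in>I. w i * x i powr r) / r"
    by (simp add: algebra_simps)
  moreover have "1 - (r - 1) / r = 1 / r" using r by (simp add: field_simps)
  ultimately have "W * S powr r \<le> (\<Sum>i\<in>I. w i * x i powr r)"
    using r by (simp add: divide_right_mono[of _ _ r] field_simps)
  then have "W powr (r - 1) * (W * S powr r) \<le> W powr (r - 1) * (\<Sum>i\<in>I. w i * x i powr r)"
    by (intro mult_left_mono) auto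
  moreover have "W powr (r - 1) * (W * S powr r) = (\<Sum>i\<in>I. w i * x i) powr r"
  proof -
    have "W powr (r - 1) * W = W powr r" using W0 powr_add[of W "r - 1" 1] by simp
    then have "W powr (r - 1) * (W * S powr r) = (W * S) powr r" using W0 S0 by (simp add: powr_mult)
    also have "W * S = (\<Sum>i\<in>I. w i * x i)" using W0 by (simp add: S_def)
    finally show ?thesis .
  qed
  ultimately show ?thesis by (simp add: W_def)
qed

text \<open>Consecutive quotients are \<open>(k + i) / (i + 1)\<close>, at most \<open>k\<close>. So
  the coefficients of \<open>(1 - z)\<close> to the power \<open>- k\<close> are dominated by a
  geometric series of ratio \<open>k\<close>.\<close>

lemma pochhammer_over_fact_le:
  fixes k :: real assumes "k \<ge> 1"
  shows "0 \<le> pochhammer k i / fact i \<and> pochhammer k i / fact i \<le> k ^ i"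
proof (induction i)
  case (Suc i)
  have eq: "pochhammer k (Suc i) / fact (Suc i) = pochhammer k i / fact i * ((k + real i) / (real i + 1))"
    by (simp add: pochhammer_Suc field_simps)
  have "k + real i \<le> k * (real i + 1)"
    using assms mult_right_mono[of 1 k "real i"] by (simp add: algebra_simps)
  then have "(k + real i) / (real i + 1) \<le> k" by (simp add: divide_simps)
  then have "pochhammer k i / fact i * ((k + real i) / (real i + 1)) \<le> k ^ i * k"
    using Suc assms by (intro mult_mono) auto
  moreover have "0 \<le> pochhammer k i / fact i * ((k + real i) / (real i + 1))"
    using Suc assms by (intro mult_nonneg_nonneg) auto
  ultimately show ?case unfolding eq by (simp only: power_Suc2)
qed simp

text \<open>Binomial coefficients of \<open>(1 - x z)\<close> to the power \<open>- k\<close>.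
  Expanding this \<open>k\<close>-th power, whose squared norm is the \<open>2 k\<close>-th power of
  the Euler factor, makes Parseval available for real \<open>k\<close>.\<close>

definition local_coeff :: "real \<Rightarrow> real \<Rightarrow> nat \<Rightarrow> real" where
  "local_coeff k x i = pochhammer k i / fact i * x ^ i"

lemma local_coeff:
  assumes k: "k \<ge> 1" and x: "0 < x" "x < 1" and p: "prime p"
  shows "summable (\<lambda>i. norm (complex_of_real (local_coeff k x i)))"
    and "pser (\<lambda>i. of_real (local_coeff k x i)) p t = (1 - of_real x * osc p t) powr (of_real (- k))"
proof -
  have nn: "0 \<le> local_coeff k x i" for i
    unfolding local_coeff_def using pochhammer_over_fact_le[OF k, of i] x by (intro mult_nonneg_nonneg) auto
  have "((- k) gchoose i) * (- x) ^ i = local_coeff k x i" for i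
    by (simp add: gbinomial_pochhammer local_coeff_def power_minus[of x] mult_ac)
  then have "local_coeff k x sums (1 - x) powr (- k)"
    using gen_binomial_real[of "- x" "- k"] x by simp
  then show "summable (\<lambda>i. norm (complex_of_real (local_coeff k x i)))"
    using nn by (simp add: sums_iff)
  have "(complex_of_real (- k) gchoose i) * (- (of_real x * osc p t)) ^ i = of_real (local_coeff k x i) * osc p t ^ i" for i
  proof -
    have "(complex_of_real (- k) gchoose i) = (- 1) ^ i * of_real (pochhammer k i / fact i)"
      by (simp add: gbinomial_pochhammer pochhammer_of_real)
    moreover have "(- (of_real x * osc p t)) ^ i = (- 1) ^ i * (of_real (x ^ i) * osc p t ^ i)"
      by (simp add: power_minus[of "of_real x * osc p t"] power_mult_distrib)
    moreover have "(- 1) ^ i * (- 1) ^ i = (1 :: complex)"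
      by (simp flip: power_mult_distrib)
    ultimately show ?thesis
      by (simp add: local_coeff_def mult_ac)
  qed
  moreover have "(\<lambda>i. (complex_of_real (- k) gchoose i) * (- (of_real x * osc p t)) ^ i) sums (1 + - (of_real x * osc p t)) powr (of_real (- k))"
    using x by (intro gen_binomial_complex) (simp add: norm_mult)
  ultimately show "pser (\<lambda>i. of_real (local_coeff k x i)) p t = (1 - of_real x * osc p t) powr (of_real (- k))"
    unfolding pser_def by (simp add: sums_iff)
qed

section \<open>Moments of a single Euler factor\<close>

definition euler_factor :: "real \<Rightarrow> nat \<Rightarrow> real \<Rightarrow> complex" where
  "euler_factor x p t = 1 / (1 - of_real x * osc p t)"

definition local_moment :: "real \<Rightarrow> real \<Rightarrow> nat \<Rightarrow> real" where
  "local_moment k x p = mean (\<lambda>t. norm (euler_factor x p t) powr (2 * k))"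

lemma geometric_limit:
  assumes x: "0 < x" "x < 1" and p: "prime p"
  shows "uniform_limit UNIV (osc_poly (\<lambda>i. of_real (x ^ i)) p) (euler_factor x p) sequentially"
    and "ap UNIV UNIV (euler_factor x p)"
proof -
  have sm: "summable (\<lambda>i. norm (complex_of_real (x ^ i)))"
    using x by (simp add: norm_power summable_geometric)
  have eq: "pser (\<lambda>i. of_real (x ^ i)) p t = euler_factor x p t" for t
  proof -
    have "(\<lambda>i. (of_real x * osc p t) ^ i) sums (1 / (1 - of_real x * osc p t))"
      using x by (intro geometric_sums) (simp add: norm_mult)
    then show ?thesis by (simp add: euler_factor_def pser_def power_mult_distrib sums_iff)
  qed
  show "uniform_limit UNIV (osc_poly (\<lambda>i. of_real (x ^ i)) p) (euler_factor x p) sequentially"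
    using pser_uniform[OF sm, of p] by (simp only: eq[abs_def])
  show "ap UNIV UNIV (euler_factor x p)"
    using ap_UNIV[OF ap_pser[OF sm p UNIV_I]] by (simp only: eq[abs_def])
qed

lemma norm_local_factor_le:
  assumes "0 < x" "x < 1"
  shows "norm (euler_factor x p t) \<le> 1 / (1 - x)"
proof -
  have "1 - x \<le> norm (1 - of_real x * osc p t)"
    using norm_triangle_ineq2[of 1 "of_real x * osc p t"] assms by (simp add: norm_mult)
  then show ?thesis using assms by (simp add: euler_factor_def norm_divide frac_le)
qed

lemma local_moment_le_trivial:
  assumes "k > 0" "0 < x" "x < 1" "prime p"
  shows "local_moment k x p \<le> (1 / (1 - x)) powr (2 * k)"
proof -
  have "local_moment k x p \<le> mean (\<lambda>t::real. (1 / (1 - x)) powr (2 * k))"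
    unfolding local_moment_def using assms
    by (intro mean_mono rap_norm_powr geometric_limit(2) rap_const powr_mono2 norm_local_factor_le) auto
  then show ?thesis by (simp add: mean_const)
qed

text \<open>By Parseval the moment is the sum of the squared binomial coefficients, which is at most
  the geometric series with ratio \<open>k^2 * x^2\<close>. The restriction to ratios at most 1/2
  keeps the logarithm of that series equal to the ratio up to a quadratic error.\<close>

lemma local_moment_le:
  assumes k: "k \<ge> 1" and x: "0 < x" "x < 1" and p: "prime p" and u: "k\<^sup>2 * x\<^sup>2 \<le> 1 / 2"
  shows "local_moment k x p \<le> exp (k\<^sup>2 * x\<^sup>2 + 2 * (k\<^sup>2 * x\<^sup>2)\<^sup>2)"
proof -
  let ?a = "\<lambda>i. complex_of_real (local_coeff k x i)"
  note sm = local_coeff(1)[OF k x p]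
  have sq: "pser ?a p t * cnj (pser ?a p t) = of_real (norm (euler_factor x p t) powr (2 * k))" for t
  proof -
    have ne: "norm (1 - of_real x * osc p t) > 0"
    proof -
      have "0 < 1 / (1 - x)" using x by simp
      have "norm (of_real x * osc p t) < 1" using x by (simp add: norm_mult)
      then have "of_real x * osc p t \<noteq> 1" by (metis norm_one less_irrefl)
      then show ?thesis by simp
    qed
    have "norm (pser ?a p t) = norm (1 - of_real x * osc p t) powr (- k)"
      unfolding local_coeff(2)[OF k x p] by (subst norm_powr_real_powr') auto
    then have "(norm (pser ?a p t))\<^sup>2 = norm (1 - of_real x * osc p t) powr (- (2 * k))"
      by (simp add: power2_eq_square powr_add[symmetric])
    also have "\<dots> = norm (euler_factor x p t) powr (2 * k)"
      using ne by (simp add: euler_factor_def norm_divide powr_divide powr_minus_divide)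
    finally have "(norm (pser ?a p t))\<^sup>2 = \<dots>" .
    then show ?thesis by (simp only: complex_norm_square[symmetric])
  qed
  have "rap (\<lambda>t. norm (euler_factor x p t) powr (2 * k))"
    using k by (intro rap_norm_powr geometric_limit x p) auto
  from mean_of_real[OF this]
  have "(\<lambda>i. ?a i * cnj (?a i)) sums of_real (local_moment k x p)"
    using mean_pser_mult_cnj[OF sm sm p] unfolding sq local_moment_def by simp
  then have S: "(\<lambda>i. (local_coeff k x i)\<^sup>2) sums local_moment k x p"
    by (simp add: power2_eq_square flip: of_real_mult) (simp only: sums_of_real_iff)
  have "local_moment k x p \<le> 1 / (1 - k\<^sup>2 * x\<^sup>2)"
  proof (rule sums_le[OF _ S])
    show "(\<lambda>i. (k\<^sup>2 * x\<^sup>2) ^ i) sums (1 / (1 - k\<^sup>2 * x\<^sup>2))"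
      using u by (intro geometric_sums) simp
    fix i
    have "local_coeff k x i \<le> k ^ i * x ^ i" "0 \<le> local_coeff k x i"
      unfolding local_coeff_def using pochhammer_over_fact_le[OF k, of i] x
      by (auto simp del: times_divide_eq_left intro: mult_right_mono mult_nonneg_nonneg)
    then have "(local_coeff k x i)\<^sup>2 \<le> (k ^ i * x ^ i)\<^sup>2" by (intro power_mono)
    also have "\<dots> = (k\<^sup>2 * x\<^sup>2) ^ i" by (simp add: power_mult_distrib flip: power_mult, simp add: mult.commute)
    finally show "(local_coeff k x i)\<^sup>2 \<le> (k\<^sup>2 * x\<^sup>2) ^ i" .
  qed
  also have "\<dots> = exp (- ln (1 - k\<^sup>2 * x\<^sup>2))" using u by (simp add: exp_minus inverse_eq_divide)
  also have "\<dots> \<le> exp (k\<^sup>2 * x\<^sup>2 + 2 * (k\<^sup>2 * x\<^sup>2)\<^sup>2)"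
    using ln_one_minus_pos_lower_bound[of "k\<^sup>2 * x\<^sup>2"] u by simp
  finally show ?thesis .
qed

section \<open>Abel summation and comparison with Euler products\<close>

definition damped :: "real \<Rightarrow> nat \<Rightarrow> real \<Rightarrow> complex" where
  "damped s n t = (\<Sum>m=1..n. of_real (real m powr (- 1 / 2 - s)) * osc m t)"

lemma ap_damped: "ap UNIV UNIV (damped s n)"
  unfolding damped_def[abs_def] osc_def by (intro trigs_ap trigs_sum trigs_monom) auto

text \<open>Summation by parts expresses \<open>dirpoly\<close> through all the damped partial sums.
  The weights have total absolute value \<open>2 * N powr s\<close> for \<open>s > 0\<close>, which
  is the price of the damping.\<close>

lemma dirpoly_abel:
  "dirpoly N t = of_real (real N powr s) * damped s N t
     - (\<Sum>n<N. of_real (real (Suc n) powr s - real n powr s) * damped s n t)"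
proof (induction N)
  case 0
  show ?case by (simp add: dirpoly_osc damped_def)
next
  case (Suc N)
  have *: "complex_of_real (real (Suc N) powr (- (1 / 2))) =
      of_real (real (Suc N) powr s) * of_real (real (Suc N) powr (- (1 / 2) - s))"
    unfolding of_real_mult[symmetric] by (simp flip: powr_add)
  have "dirpoly (Suc N) t = dirpoly N t + of_real (real (Suc N) powr (- 1 / 2)) * osc (Suc N) t"
    by (simp add: dirpoly_osc)
  moreover have "damped s (Suc N) t = damped s N t + of_real (real (Suc N) powr (- 1 / 2 - s)) * osc (Suc N) t"
    by (simp add: damped_def)
  ultimately show ?case
    unfolding Suc by (simp add: algebra_simps del: of_nat_Suc) (use * in simp)
qed

definition trunc_moment :: "real \<Rightarrow> real \<Rightarrow> nat \<Rightarrow> nat \<Rightarrow> real" where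
  "trunc_moment k x n p = mean (\<lambda>t. norm (osc_poly (\<lambda>j. of_real (x ^ j)) p n t) powr (2 * k))"

text \<open>The partial sum \<open>damped s n\<close> is the projection of a truncated Euler product to the
  frequencies \<open>\<ge> - ln n\<close>.\<close>

lemma mean_damped_le_partial:
  assumes k: "k \<ge> 2" and n: "1 \<le> n" "n \<le> N" "N \<le> J"
  shows "mean (\<lambda>t. norm (damped s n t) powr (2 * k)) \<le> exp (200 * k\<^sup>2) *
    (1 + (\<Prod>p\<in>primes_upto N. trunc_moment k (real p powr (- 1 / 2 - s)) (Suc J) p))"
proof -
  define S where "S = primes_upto N"
  have S: "finite S" "\<And>p. p \<in> S \<Longrightarrow> prime p" by (auto simp: S_def primes_upto_def)
  define T where "T = exponents S J"
  define \<nu> where "\<nu> = from_exponents S"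
  define f where "f = (\<lambda>p. osc_poly (\<lambda>j. of_real ((real p powr (- 1 / 2 - s)) ^ j)) p (Suc J))"
  define R where "R = (\<lambda>t. \<Sum>m\<in>\<nu> ` T - {1..n}. of_real (real m powr (- 1 / 2 - s)) * osc m t)"
  have fin: "finite (\<nu> ` T)" unfolding T_def using finite_exponents[OF S(1)] by simp
  have prod: "(\<Prod>p\<in>S. f p t) = damped s n t + R t" for t
  proof -
    have "(\<Prod>p\<in>S. f p t) = (\<Sum>g\<in>T. \<Prod>p\<in>S. of_real ((real p powr (- 1 / 2 - s)) ^ g p) * osc p t ^ g p)"
      unfolding f_def osc_poly_def lessThan_Suc_atMost T_def exponents_def by (rule prod_sum_PiE) (use S in auto)
    also have "\<dots> = (\<Sum>g\<in>T. of_real (real (\<nu> g) powr (- 1 / 2 - s)) * osc (\<nu> g) t)"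
      by (simp add: \<nu>_def from_exponents_powr[OF S(2)] osc_from_exponents[OF S] prod.distrib)
    also have "\<dots> = (\<Sum>m\<in>\<nu> ` T. of_real (real m powr (- 1 / 2 - s)) * osc m t)"
      unfolding \<nu>_def T_def by (subst sum.reindex[OF inj_from_exponents[OF S]]) simp_all
    also have "\<dots> = R t + damped s n t"
      unfolding R_def damped_def
    proof (rule sum.subset_diff[OF _ fin])
      show "{1..n} \<subseteq> \<nu> ` T"
        using from_exponents_surj[of _ N J] n unfolding \<nu>_def T_def S_def by auto
    qed
    finally show ?thesis by simp
  qed
  have tP: "damped s n \<in> trigs UNIV {- ln (real n)..}"
    unfolding damped_def[abs_def] osc_def by (intro trigs_sum trigs_monom) auto
  have tR: "R \<in> trigs UNIV {..<- ln (real n)}"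
    unfolding R_def osc_def
  proof (intro trigs_sum trigs_monom UNIV_I)
    fix m assume m: "m \<in> \<nu> ` T - {1..n}"
    then have "m > 0" using from_exponents_pos[OF S(2)] by (auto simp: \<nu>_def)
    then have "m > n" using m by auto
    then show "- ln (real m) \<in> {..<- ln (real n)}" using n by simp
  qed
  have "mean (\<lambda>t. norm (damped s n t) powr (2 * k)) \<le> exp (200 * k\<^sup>2) * (1 + mean (\<lambda>t. norm (\<Prod>p\<in>S. f p t) powr (2 * k)))"
    using riesz_real[OF tP tR k] by (simp only: prod)
  also have "mean (\<lambda>t. norm (\<Prod>p\<in>S. f p t) powr (2 * k)) = (\<Prod>p\<in>S. mean (\<lambda>t. norm (f p t) powr (2 * k)))"
  proof -
    have apf: "ap UNIV (freqs {p}) (f p)" if "p \<in> S" for p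
      unfolding f_def by (intro trigs_ap trigs_osc_poly S that UNIV_I)
    have ap: "ap UNIV (freqs {p}) (\<lambda>t. of_real (norm (f p t) powr (2 * k)))" if "p \<in> S" for p
      using k by (intro ap_continuous_norm subgroup_freqs apf that continuous_on_powr_const) auto
    have r: "rap (\<lambda>t. norm (f p t) powr (2 * k))" if "p \<in> S" for p
      unfolding rap_def by (rule ap_UNIV[OF ap[OF that]])
    have eq: "complex_of_real (norm (\<Prod>p\<in>S. f p t) powr (2 * k)) = (\<Prod>p\<in>S. of_real (norm (f p t) powr (2 * k)))" for t
      by (simp add: prod_norm[symmetric] prod_powr_distrib)
    have "rap (\<lambda>t. norm (\<Prod>p\<in>S. f p t) powr (2 * k))"
      unfolding rap_def eq by (rule ap_UNIV[OF ap_prod_primes[OF S(1) ap]])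
    then have "complex_of_real (mean (\<lambda>t. norm (\<Prod>p\<in>S. f p t) powr (2 * k))) = mean (\<lambda>t. \<Prod>p\<in>S. complex_of_real (norm (f p t) powr (2 * k)))"
      by (simp only: mean_of_real[symmetric] eq)
    also have "\<dots> = (\<Prod>p\<in>S. mean (\<lambda>t. complex_of_real (norm (f p t) powr (2 * k))))"
      by (rule mean_prod_primes[OF S(1) ap])
    also have "\<dots> = (\<Prod>p\<in>S. of_real (mean (\<lambda>t. norm (f p t) powr (2 * k))))"
      by (intro prod.cong refl mean_of_real r)
    also have "\<dots> = of_real (\<Prod>p\<in>S. mean (\<lambda>t. norm (f p t) powr (2 * k)))" by simp
    finally show ?thesis by (simp only: of_real_eq_iff)
  qed
  finally show ?thesis by (simp add: f_def S_def trunc_moment_def)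
qed

definition euler_moment :: "real \<Rightarrow> real \<Rightarrow> nat \<Rightarrow> real" where
  "euler_moment k s N = (\<Prod>p\<in>primes_upto N. local_moment k (real p powr (- 1 / 2 - s)) p)"

lemma mean_damped_le:
  assumes k: "k \<ge> 2" and n: "1 \<le> n" "n \<le> N" and s: "s \<ge> 0"
  shows "mean (\<lambda>t. norm (damped s n t) powr (2 * k)) \<le> exp (200 * k\<^sup>2) *
    (1 + euler_moment k s N)"
proof (rule LIMSEQ_le_const)
  show "(\<lambda>J. exp (200 * k\<^sup>2) * (1 + (\<Prod>p\<in>primes_upto N. trunc_moment k (real p powr (- 1 / 2 - s)) (Suc J) p)))
      \<longlonglongrightarrow> exp (200 * k\<^sup>2) * (1 + euler_moment k s N)"
    unfolding euler_moment_def
  proof (intro tendsto_mult tendsto_add tendsto_const tendsto_prod)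
    fix p assume "p \<in> primes_upto N"
    then have p: "prime p" by (simp add: primes_upto_def)
    define x where "x = real p powr (- 1 / 2 - s)"
    have x: "0 < x" "x < 1" using prime_gt_1_nat[OF p] s powr_less_one[of "real p" "- 1 / 2 - s"] by (auto simp: x_def)
    have "(\<lambda>m. trunc_moment k x m p) \<longlonglongrightarrow> local_moment k x p"
      unfolding trunc_moment_def local_moment_def using k
      by (intro mean_norm_powr_limit geometric_limit x p ap_UNIV[OF trigs_ap[OF trigs_osc_poly[OF p UNIV_I]]]) auto
    from LIMSEQ_Suc[OF this]
    show "(\<lambda>J. trunc_moment k (real p powr (- 1 / 2 - s)) (Suc J) p) \<longlonglongrightarrow> local_moment k (real p powr (- 1 / 2 - s)) p"
      by (simp only: x_def)
  qed
  show "\<exists>M. \<forall>J\<ge>M. mean (\<lambda>t. norm (damped s n t) powr (2 * k)) \<le> exp (200 * k\<^sup>2) *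
    (1 + (\<Prod>p\<in>primes_upto N. trunc_moment k (real p powr (- 1 / 2 - s)) (Suc J) p))"
    using mean_damped_le_partial[OF k n] by blast
qed

text \<open>The norm of \<open>dirpoly\<close> is at most a combination of the norms of the damped
  sums with nonnegative weights of total \<open>2 * N powr s\<close>. The power mean inequality then
  passes to moments, and all lengths \<open>n <= N\<close> share one bound, because each damped sum
  is a projection of the same Euler product over \<open>p <= N\<close>.\<close>

lemma pseudomoment_le_euler_moment:
  assumes k: "k \<ge> 2" and N: "1 \<le> N" and s: "s > 0"
  shows "pseudomoment k N \<le> (2 * real N powr s) powr (2 * k) * (exp (200 * k\<^sup>2) *
    (1 + euler_moment k s N))"
proof -
  define C where "C = exp (200 * k\<^sup>2) * (1 + euler_moment k s N)"
  define w where "w = (\<lambda>n. if n = N then real N powr s else real (Suc n) powr s - real n powr s)"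
  have w0: "w n \<ge> 0" if "n \<le> N" for n using s by (auto simp: w_def intro!: powr_mono2)
  \<comment> \<open>The telescoping sum starts at \<open>n = 0\<close>, where
    \<open>0 powr s = 0\<close>.\<close>
  have tel: "(\<Sum>n<N. real (Suc n) powr s - real n powr s) = real N powr s"
    using sum_lessThan_telescope[of "\<lambda>n. real n powr s" N] s by simp
  have W: "(\<Sum>n\<le>N. w n) = 2 * real N powr s"
    using tel by (simp add: w_def lessThan_Suc_atMost[symmetric] cong: sum.cong_simp)
  have r1: "rap (\<lambda>t. norm (damped s n t) powr (2 * k))" for n
    using k by (intro rap_norm_powr ap_damped) auto
  have bound: "norm (dirpoly N t) \<le> (\<Sum>n\<le>N. w n * norm (damped s n t))" for t
  proof -
    have "norm (dirpoly N t) \<le> norm (of_real (real N powr s) * damped s N t) + norm (\<Sum>n<N. of_real (real (Suc n) powr s - real n powr s) * damped s n t)"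
      unfolding dirpoly_abel[of N t s] by (rule norm_triangle_ineq4)
    also have "\<dots> \<le> real N powr s * norm (damped s N t) + (\<Sum>n<N. w n * norm (damped s n t))"
    proof (intro add_mono order.trans[OF norm_sum] sum_mono)
      fix n assume "n \<in> {..<N}"
      then have "w n = real (Suc n) powr s - real n powr s" "0 \<le> w n" using w0[of n] by (auto simp: w_def)
      then show "norm (of_real (real (Suc n) powr s - real n powr s) * damped s n t) \<le> w n * norm (damped s n t)"
        by (simp only: norm_mult norm_of_real abs_of_nonneg order.refl)
    qed (simp add: norm_mult)
    also have "\<dots> = (\<Sum>n\<le>N. w n * norm (damped s n t))"
      by (simp add: lessThan_Suc_atMost[symmetric] w_def)
    finally show ?thesis .
  qed
  have C: "mean (\<lambda>t. norm (damped s n t) powr (2 * k)) \<le> C" if "n \<le> N" for n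
  \<comment> \<open>\<open>damped s 0\<close> is the empty sum, so only \<open>0 <= C\<close> is
    required; this is read off from the case \<open>n = 1\<close>.\<close>
  proof (cases "n = 0")
    case True
    have "0 \<le> mean (\<lambda>t. norm (damped s 1 t) powr (2 * k))" by (intro mean_nonneg r1) auto
    also have "\<dots> \<le> C" unfolding C_def using k N s by (intro mean_damped_le) auto
    finally show ?thesis using True by (simp add: damped_def mean_const)
  next
    case False
    then show ?thesis unfolding C_def using k that s by (intro mean_damped_le) auto
  qed
  have "pseudomoment k N \<le> mean (\<lambda>t. (2 * real N powr s) powr (2 * k - 1) * (\<Sum>n\<le>N. w n * norm (damped s n t) powr (2 * k)))"
    unfolding pseudomoment_eq_mean
  proof (intro mean_mono rap_cmult rap_sum r1)
    show "rap (\<lambda>t. norm (dirpoly N t) powr (2 * k))" using k by (intro rap_norm_powr ap_dirpoly) auto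
    fix t
    have "norm (dirpoly N t) powr (2 * k) \<le> (\<Sum>n\<le>N. w n * norm (damped s n t)) powr (2 * k)"
      using k by (intro powr_mono2 bound) auto
    also have "\<dots> \<le> (\<Sum>n\<le>N. w n) powr (2 * k - 1) * (\<Sum>n\<le>N. w n * norm (damped s n t) powr (2 * k))"
      using k w0 N by (intro powr_weighted_mean) (auto simp: W)
    finally show "norm (dirpoly N t) powr (2 * k) \<le> (2 * real N powr s) powr (2 * k - 1) * (\<Sum>n\<le>N. w n * norm (damped s n t) powr (2 * k))"
      by (simp only: W)
  qed
  also have "\<dots> = (2 * real N powr s) powr (2 * k - 1) * (\<Sum>n\<le>N. w n * mean (\<lambda>t. norm (damped s n t) powr (2 * k)))"
    by (simp only: mean_cmult[OF rap_sum[OF rap_cmult[OF r1]]] mean_sum[OF rap_cmult[OF r1]] mean_cmult[OF r1])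
  also have "\<dots> \<le> (2 * real N powr s) powr (2 * k - 1) * (\<Sum>n\<le>N. w n * C)"
    using C w0 by (intro mult_left_mono sum_mono) auto
  also have "\<dots> = ((2 * real N powr s) powr (2 * k - 1) * (2 * real N powr s)) * C"
    by (simp only: sum_distrib_right[symmetric] W mult.assoc)
  also have "(2 * real N powr s) powr (2 * k - 1) * (2 * real N powr s) = (2 * real N powr s) powr (2 * k)"
    using powr_add[of "2 * real N powr s" "2 * k - 1" 1] N by simp
  finally show ?thesis by (simp only: C_def)
qed

lemma sum_inverse_sqrt_le: "(\<Sum>m=1..n. real m powr (- 1 / 2)) \<le> 2 * sqrt (real n)"
proof (induction n)
  case (Suc n)
  define a b where "a = sqrt (real n)" and "b = sqrt (real (Suc n))"
  have ab: "0 \<le> a" "0 < b" "a \<le> b" by (simp_all add: a_def b_def)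
  have "b * b - a * a = 1" by (simp add: a_def b_def)
  then have "1 = (b - a) * (b + a)" by (simp add: algebra_simps)
  also have "\<dots> \<le> (b - a) * (2 * b)" using ab by (intro mult_left_mono) auto
  finally have "1 / b \<le> 2 * (b - a)" using ab by (simp add: divide_simps mult_ac)
  moreover have "real (Suc n) powr (- 1 / 2) = 1 / b"
    by (simp add: b_def powr_minus_divide powr_half_sqrt del: of_nat_Suc)
  ultimately show ?case using Suc by (simp add: a_def b_def)
qed simp

text \<open>The split at \<open>Q\<close>, the floor of \<open>2 * k^2\<close>, is dictated by the
  condition \<open>k^2 * x^2 <= 1 / 2\<close> of the sharp local bound. Smaller primes get the
  trivial bound, whose total exponent is \<open>8 k\<close> times the sum of
  \<open>p powr (- 1 / 2)\<close> and so at most \<open>24 k^2\<close>. Their absence from the main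
  sum gives \<open>- ln (ln k)\<close>. The constant 29 is 24 + 5.\<close>

lemma euler_moment_le:
  assumes k: "k \<ge> 2" and s: "s > 0"
  shows "euler_moment k s N
     \<le> exp (k\<^sup>2 * (ln (1 + 1 / (2 * s)) - ln (ln k) + 29 + 4 * s * ln (2 * k\<^sup>2)))"
proof -
  define Q where "Q = nat \<lfloor>2 * k\<^sup>2\<rfloor>"
  define x where "x = (\<lambda>p::nat. real p powr (- 1 / 2 - s))"
  have kk: "k\<^sup>2 \<ge> 2 * k" using k by (simp add: power2_eq_square mult_right_mono)
  have Q: "real Q \<le> 2 * k\<^sup>2" "2 * k\<^sup>2 < real Q + 1" "k\<^sup>2 \<le> real Q" "k \<le> real Q" "Q \<ge> 2"
    using kk k unfolding Q_def by linarith+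
  let ?Z = "ln (1 + 1 / (2 * s)) - ln (ln k)" and ?U = "4 * s * ln (2 * k\<^sup>2)"
  let ?A = "primes_upto N \<inter> primes_upto Q" and ?B = "primes_upto N - primes_upto Q"
  have prime: "prime p" if "p \<in> primes_upto N" for p using that by (simp add: primes_upto_def)
  have x: "0 < x p" "x p \<le> real p powr (- 1 / 2)" "x p < 1" "(x p)\<^sup>2 = real p powr (- (1 + 2 * s))" "(x p)\<^sup>2 \<le> 1 / real p"
    if "prime p" for p
  proof -
    have p: "real p > 1" using prime_gt_1_nat[OF that] by simp
    show "0 < x p" using p by (simp add: x_def)
    show "x p \<le> real p powr (- 1 / 2)" unfolding x_def using p s by (intro powr_mono) auto
    show "x p < 1" unfolding x_def using p s by (intro powr_less_one) auto
    show sq: "(x p)\<^sup>2 = real p powr (- (1 + 2 * s))"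
      unfolding x_def power2_eq_square powr_add[symmetric] by simp
    have "real p powr (- (1 + 2 * s)) \<le> real p powr (- 1)" using p s by (intro powr_mono) auto
    then show "(x p)\<^sup>2 \<le> 1 / real p" unfolding sq using p by (simp add: powr_minus_divide)
  qed
  have lm0: "0 \<le> local_moment k (x p) p" if "prime p" for p
    unfolding local_moment_def using k by (intro mean_nonneg rap_norm_powr geometric_limit(2) x that) auto
  have small: "(\<Prod>p\<in>?A. local_moment k (x p) p) \<le> exp (24 * k\<^sup>2)"
  proof -
    have "(\<Prod>p\<in>?A. local_moment k (x p) p) \<le> (\<Prod>p\<in>?A. exp (8 * k * real p powr (- 1 / 2)))"
    proof (intro prod_mono conjI)
      fix p assume "p \<in> ?A"
      then have p: "prime p" by (auto intro: prime)
      show "0 \<le> local_moment k (x p) p" by (rule lm0[OF p])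
      have "1 / real p \<le> 1 / 2" using prime_ge_2_nat[OF p] by (intro divide_left_mono) auto
      then have "(x p)\<^sup>2 \<le> 1 / 2" using x(5)[OF p] by linarith
      also have "\<dots> \<le> (3 / 4)\<^sup>2" by (simp add: power2_eq_square)
      finally have x34: "x p \<le> 3 / 4" using power2_le_imp_le[of "x p" "3 / 4"] by simp
      have "1 / (1 - x p) = 1 + x p / (1 - x p)" using x34 by (simp add: field_simps)
      also have "x p / (1 - x p) \<le> x p / (1 / 4)" using x34 x(1)[OF p] by (intro divide_left_mono) auto
      finally have "1 / (1 - x p) \<le> 1 + 4 * x p" by simp
      also have "\<dots> \<le> exp (4 * x p)" by (rule exp_ge_add_one_self)
      finally have "(1 / (1 - x p)) powr (2 * k) \<le> exp (4 * x p) powr (2 * k)"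
        using x34 k by (intro powr_mono2) auto
      also have "\<dots> = exp (8 * k * x p)" by (simp add: powr_def mult_ac)
      also have "\<dots> \<le> exp (8 * k * real p powr (- 1 / 2))" using x(2)[OF p] k by simp
      finally show "local_moment k (x p) p \<le> exp (8 * k * real p powr (- 1 / 2))"
        using local_moment_le_trivial[of k "x p" p] x[OF p] p k by simp
    qed
    also have "\<dots> = exp (8 * k * (\<Sum>p\<in>?A. real p powr (- 1 / 2)))"
      by (simp add: exp_sum sum_distrib_left)
    also have "\<dots> \<le> exp (8 * k * (3 * k))"
    proof -
      have "(\<Sum>p\<in>?A. real p powr (- 1 / 2)) \<le> (\<Sum>m=1..Q. real m powr (- 1 / 2))"
        by (intro sum_mono2) (auto simp: primes_upto_def Suc_le_eq prime_gt_0_nat)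
      also have "\<dots> \<le> 2 * sqrt (real Q)" by (rule sum_inverse_sqrt_le)
      \<comment> \<open>The square of \<open>3 / 2 * k\<close> exceeds \<open>2 * k^2\<close>, hence
        \<open>Q\<close>.\<close>
      also have "\<dots> \<le> 2 * sqrt ((3 / 2 * k)\<^sup>2)"
        using Q by (intro mult_left_mono real_sqrt_le_mono) (auto simp: power_mult_distrib power2_eq_square)
      also have "\<dots> = 3 * k" using k by simp
      finally show ?thesis using k by simp
    qed
    finally show ?thesis by (simp add: power2_eq_square mult_ac)
  qed
  have large: "(\<Prod>p\<in>?B. local_moment k (x p) p) \<le> exp (k\<^sup>2 * (?Z + 5 + ?U))"
  proof -
    have "(\<Prod>p\<in>?B. local_moment k (x p) p) \<le> (\<Prod>p\<in>?B. exp (k\<^sup>2 * real p powr (- (1 + 2 * s)) + 2 * (k\<^sup>2)\<^sup>2 * (1 / (real p)\<^sup>2)))"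
    proof (intro prod_mono conjI)
      fix p assume pB: "p \<in> ?B"
      then have p: "prime p" "Q < p" by (auto simp: primes_upto_def)
      show "0 \<le> local_moment k (x p) p" by (rule lm0[OF p(1)])
      have p2: "2 * k\<^sup>2 < real p" using Q p(2) by linarith
      have "k\<^sup>2 * (x p)\<^sup>2 \<le> k\<^sup>2 * (1 / real p)" using x(5)[OF p(1)] by (intro mult_left_mono) auto
      then have kx: "k\<^sup>2 * (x p)\<^sup>2 \<le> k\<^sup>2 / real p" by simp
      also have "\<dots> \<le> 1 / 2" using p2 k by (simp add: divide_simps)
      finally have "local_moment k (x p) p \<le> exp (k\<^sup>2 * (x p)\<^sup>2 + 2 * (k\<^sup>2 * (x p)\<^sup>2)\<^sup>2)"
        using x[OF p(1)] p k by (intro local_moment_le) auto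
      also have "\<dots> \<le> exp (k\<^sup>2 * (x p)\<^sup>2 + 2 * (k\<^sup>2 / real p)\<^sup>2)"
        using kx by (simp add: power_mono)
      finally show "local_moment k (x p) p \<le> exp (k\<^sup>2 * real p powr (- (1 + 2 * s)) + 2 * (k\<^sup>2)\<^sup>2 * (1 / (real p)\<^sup>2))"
        by (simp add: x(4)[OF p(1)] power_divide)
    qed
    also have "\<dots> = exp (k\<^sup>2 * (\<Sum>p\<in>?B. real p powr (- (1 + 2 * s))) + 2 * (k\<^sup>2)\<^sup>2 * (\<Sum>p\<in>?B. 1 / (real p)\<^sup>2))"
      by (simp add: exp_sum[symmetric] sum.distrib sum_distrib_left)
    also have "\<dots> \<le> exp (k\<^sup>2 * (?Z + 3 + ?U) + k\<^sup>2 * 2)"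
    proof -
      have "(\<Sum>p\<in>?B. real p powr (- (1 + 2 * s))) \<le> ln (1 + 1 / (2 * s)) - ln (ln (real Q)) + 3 + 2 * (2 * s) * ln (real Q)"
        using s Q by (intro sum_prime_powr_tail_le) auto
      moreover have "ln (ln k) \<le> ln (ln (real Q))" using Q k by (intro ln_mono) auto
      moreover have "4 * s * ln (real Q) \<le> ?U" using Q s k by (intro mult_left_mono ln_mono) auto
      ultimately have 1: "(\<Sum>p\<in>?B. real p powr (- (1 + 2 * s))) \<le> ?Z + 3 + ?U"
        by linarith
      have "(\<Sum>p\<in>?B. 1 / (real p)\<^sup>2) \<le> 1 / real Q" using Q by (intro sum_prime_inverse_squares_le) auto
      also have "\<dots> \<le> 1 / k\<^sup>2" using Q k by (intro divide_left_mono) auto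
      finally have "(k\<^sup>2)\<^sup>2 * (\<Sum>p\<in>?B. 1 / (real p)\<^sup>2) \<le> (k\<^sup>2)\<^sup>2 * (1 / k\<^sup>2)" by (intro mult_left_mono) auto
      also have "\<dots> = k\<^sup>2" using k by (simp add: power2_eq_square)
      finally have 2: "(k\<^sup>2)\<^sup>2 * (\<Sum>p\<in>?B. 1 / (real p)\<^sup>2) \<le> k\<^sup>2" .
      have "k\<^sup>2 * (\<Sum>p\<in>?B. real p powr (- (1 + 2 * s))) \<le> k\<^sup>2 * (?Z + 3 + ?U)"
        using 1 by (intro mult_left_mono) auto
      with 2 show ?thesis unfolding exp_le_cancel_iff by linarith
    qed
    also have "k\<^sup>2 * (?Z + 3 + ?U) + k\<^sup>2 * 2 =
        k\<^sup>2 * (?Z + 5 + ?U)"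
      unfolding distrib_left[symmetric] by (simp add: algebra_simps)
    finally show ?thesis .
  qed
  have "(\<Prod>p\<in>primes_upto N. local_moment k (x p) p) = (\<Prod>p\<in>?A. local_moment k (x p) p) * (\<Prod>p\<in>?B. local_moment k (x p) p)"
    by (rule prod.Int_Diff) simp
  also have "\<dots> \<le> exp (24 * k\<^sup>2) * exp (k\<^sup>2 * (?Z + 5 + ?U))"
    by (intro mult_mono small large prod_nonneg lm0 prime) auto
  also have "\<dots> = exp (k\<^sup>2 * (?Z + 29 + ?U))"
    unfolding exp_add[symmetric] by (simp add: algebra_simps)
  finally show ?thesis by (simp only: x_def euler_moment_def)
qed

text \<open>This uses the junk value \<open>ln 0 = 0\<close>.\<close>

lemma ln_nat_pos:
  assumes "ln (ln (real N)) > 0" shows "ln (real N) > 0" "N \<ge> 1"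
proof -
  have "ln (real N) \<ge> 0" by (cases N) auto
  moreover have "ln (real N) \<noteq> 0" using assms by auto
  ultimately show "ln (real N) > 0" by simp
  then show "N \<ge> 1" by (cases N) auto
qed

text \<open>With \<open>s = k / ln N\<close> the damping costs \<open>N powr s = exp k\<close>, and
  \<open>ln (1 + 1 / (2 * s))\<close> is at most \<open>ln (ln N) - ln k\<close>. The range of
  \<open>k\<close> enters twice: it bounds the correction \<open>4 * s * ln (2 * k^2)\<close> by a
  constant, and it makes \<open>Y\<close> nonnegative.\<close>

lemma pseudomoment_upper:
  assumes k: "k \<ge> 2" and l: "ln (ln (real N)) \<ge> 2" and kN: "k \<le> ln (real N) / ln (ln (real N))"
  shows "pseudomoment k N / ln (real N) powr (k\<^sup>2) \<le> exp (- k\<^sup>2 * ln k - k\<^sup>2 * ln (ln k) + 245 * k\<^sup>2)"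
proof -
  define L where "L = ln (real N)"
  define l where "l = ln L"
  have l2: "l \<ge> 2" using l by (simp add: l_def L_def)
  have L0: "L > 0" and N: "N \<ge> 1" unfolding L_def by (rule ln_nat_pos, use l in linarith)+
  have kl: "k * l \<le> L" using kN l2 by (simp add: L_def l_def pos_le_divide_eq)
  have kL: "k \<le> L" using kl k l2 mult_left_mono[of 1 l k] by linarith
  have lnk: "ln k \<le> l - ln l"
  proof -
    have "ln (k * l) \<le> ln L" using kl k l2 by (intro ln_mono) auto
    then show ?thesis using k l2 by (simp add: ln_mult_pos l_def)
  qed
  have lnl: "ln l \<ge> 0" using l2 by simp
  have "ln k \<le> l" using lnk lnl by linarith
  then have lnlnk: "ln (ln k) \<le> ln l" using k by (intro ln_mono) auto
  define s where "s = k / L"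
  have s: "s > 0" using k L0 by (simp add: s_def)
  have Ns: "real N powr s = exp k" using N L0 by (simp add: powr_def s_def flip: L_def)
  \<comment> \<open>\<open>exp (k^2 * Y)\<close> is the asserted size of the pseudomoment. Since
    \<open>Y >= 0\<close>, the additive 1 inherited from the inhomogeneous projection inequality is
    harmless.\<close>
  define Y where "Y = l - ln k - ln (ln k)"
  have Y: "Y \<ge> 0" using lnk lnlnk by (simp add: Y_def)
  have k2: "2 * k \<le> k\<^sup>2" "k\<^sup>2 \<ge> 1" using k mult_right_mono[of 2 k k] mult_mono[of 1 k 1 k] by (auto simp: power2_eq_square)
  have "euler_moment k s N
     \<le> exp (k\<^sup>2 * (ln (1 + 1 / (2 * s)) - ln (ln k) + 29 + 4 * s * ln (2 * k\<^sup>2)))"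
    by (rule euler_moment_le[OF k s])
  also have "\<dots> \<le> exp (k\<^sup>2 * (Y + 41))"
  proof -
    have "2 * k \<le> L" using kl l2 k mult_left_mono[of 2 l k] by linarith
    then have "1 + 1 / (2 * s) \<le> L / k" using k L0 by (simp add: s_def field_simps)
    then have "ln (1 + 1 / (2 * s)) \<le> ln (L / k)" using s by (intro ln_mono) (auto intro: add_pos_pos)
    also have "\<dots> = l - ln k" using L0 k by (simp add: ln_divide_pos l_def)
    finally have 1: "ln (1 + 1 / (2 * s)) \<le> l - ln k" .
    have "ln (2 * k\<^sup>2) = ln 2 + 2 * ln k" using k by (simp add: ln_mult_pos ln_realpow)
    also have "ln (2::real) \<le> 1" using ln_le_minus_one[of 2] by simp
    finally have "ln (2 * k\<^sup>2) \<le> 3 * l" using lnk lnl l2 by linarith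
    then have "4 * s * ln (2 * k\<^sup>2) \<le> 4 * s * (3 * l)" using s by (intro mult_left_mono) auto
    also have "\<dots> \<le> 12" using kl L0 by (simp add: s_def divide_simps mult_ac)
    finally show ?thesis using 1 unfolding exp_le_cancel_iff by (intro mult_left_mono) (auto simp: Y_def)
  qed
  finally have P: "euler_moment k s N \<le> exp (k\<^sup>2 * (Y + 41))" .
  have P2: "1 + euler_moment k s N \<le> exp (k\<^sup>2 * (Y + 42))"
  proof -
    have "1 \<le> exp (k\<^sup>2 * (Y + 41))" using Y by simp
    then have "1 + euler_moment k s N \<le> 2 * exp (k\<^sup>2 * (Y + 41))"
      using P by linarith
    also have "\<dots> \<le> exp (k\<^sup>2) * exp (k\<^sup>2 * (Y + 41))"
    proof (rule mult_right_mono)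
      show "2 \<le> exp (k\<^sup>2)" using exp_ge_add_one_self[of "k\<^sup>2"] k2 by linarith
    qed simp
    also have "\<dots> = exp (k\<^sup>2 * (Y + 42))" by (simp add: algebra_simps flip: exp_add)
    finally show ?thesis .
  qed
  have W: "(2 * real N powr s) powr (2 * k) \<le> exp (k\<^sup>2 * 3)"
  proof -
    have "(2 * real N powr s) powr (2 * k) \<le> (exp 1 * exp k) powr (2 * k)"
      unfolding Ns using k exp_ge_add_one_self[of 1] by (intro powr_mono2 mult_right_mono) auto
    also have "\<dots> = exp (2 * k + 2 * (k * k))" by (simp add: powr_def algebra_simps flip: exp_add)
    also have "\<dots> \<le> exp (k\<^sup>2 * 3)" using k2(1) by (simp add: power2_eq_square)
    finally show ?thesis .
  qed
  have "pseudomoment k N \<le> (2 * real N powr s) powr (2 * k) * (exp (200 * k\<^sup>2) *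
    (1 + euler_moment k s N))"
    by (rule pseudomoment_le_euler_moment[OF k N s])
  also have "\<dots> \<le> (2 * real N powr s) powr (2 * k) * (exp (200 * k\<^sup>2) * exp (k\<^sup>2 * (Y + 42)))"
    by (intro mult_left_mono P2) auto
  also have "\<dots> \<le> exp (k\<^sup>2 * 3) * (exp (200 * k\<^sup>2) * exp (k\<^sup>2 * (Y + 42)))"
    by (intro mult_right_mono W) auto
  \<comment> \<open>The constant 245 is 3 from the damping, 200 from the projection and 42 from the
    Euler product.\<close>
  also have "\<dots> = exp (- k\<^sup>2 * ln k - k\<^sup>2 * ln (ln k) + 245 * k\<^sup>2) * L powr (k\<^sup>2)"
    using L0 by (simp add: powr_def Y_def l_def algebra_simps flip: exp_add)
  finally show ?thesis using L0 by (simp add: pos_divide_le_eq flip: L_def)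
qed

text \<open>Here \<open>ln k = ln C + l - ln l\<close> and \<open>ln (ln k) >= ln l - 1\<close>, so
  the exponent \<open>l - ln k - ln (ln k) + A\<close> is at most \<open>A + 1 - ln C\<close>, which
  is negative. The claimed bound times \<open>(ln N) powr k^2\<close> is then below 1.\<close>

lemma pseudomoment_large:
  assumes C: "C \<ge> max 1 (exp (A + 2))" and l: "ln (ln (real N)) \<ge> 2"
    and kd: "k = C * ln (real N) / ln (ln (real N))"
  shows "exp (- k\<^sup>2 * ln k - k\<^sup>2 * ln (ln k) + A * k\<^sup>2) < pseudomoment k N / ln (real N) powr (k\<^sup>2)"
proof -
  define L where "L = ln (real N)"
  define l where "l = ln L"
  have l2: "l \<ge> 2" using l by (simp add: l_def L_def)
  have L0: "L > 0" and N: "N \<ge> 1" unfolding L_def by (rule ln_nat_pos, use l in linarith)+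
  have C1: "C \<ge> 1" "ln C \<ge> A + 2" using C by (auto simp: ln_ge_iff)
  have lnk: "ln k = ln C + (l - ln l)"
  proof -
    have "ln (C * L / l) = ln (C * L) - ln l" using C1 L0 l2 by (intro ln_divide_pos) auto
    moreover have "ln (C * L) = ln C + l" unfolding l_def using C1 L0 by (intro ln_mult_pos) auto
    ultimately show ?thesis unfolding kd L_def[symmetric] l_def[symmetric] by simp
  qed
  have "ln (l / 2) \<le> l / 2 - 1" using l2 by (intro ln_le_minus_one) auto
  moreover have "ln (l / 2) = ln l - ln 2" using l2 by (intro ln_divide_pos) auto
  moreover have ln2: "ln (2::real) \<le> 1" using ln_le_minus_one[of 2] by simp
  ultimately have half: "l / 2 \<le> l - ln l" and lnl2: "ln (l / 2) = ln l - ln 2" by linarith+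
  have "ln C \<ge> 0" using C1 by simp
  with half have lnk2: "l / 2 \<le> ln k" unfolding lnk by linarith
  have lnlnk: "ln l - 1 \<le> ln (ln k)"
    using ln_mono[OF lnk2] l2 lnl2 ln2 by auto
  have k0: "k > 0" unfolding kd L_def[symmetric] l_def[symmetric] using C1 L0 l2
    by (intro divide_pos_pos mult_pos_pos) linarith+
  have "ln k > 0" using lnk2 l2 by linarith
  then have k1: "k > 1" using k0 by (rule ln_gt_zero_imp_gt_one)
  have "exp (- k\<^sup>2 * ln k - k\<^sup>2 * ln (ln k) + A * k\<^sup>2) * L powr (k\<^sup>2) = exp (k\<^sup>2 * (l - ln k - ln (ln k) + A))"
    using L0 by (simp add: powr_def l_def algebra_simps flip: exp_add)
  also have "\<dots> < exp 0"
  proof -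
    have "l - ln k - ln (ln k) + A < 0" using lnk lnlnk C1 by linarith
    then show ?thesis unfolding exp_less_cancel_iff using k0 by (intro mult_pos_neg) auto
  qed
  also have "\<dots> \<le> pseudomoment k N" using pseudomoment_ge_1[OF k1 N] by simp
  finally show ?thesis using L0 by (simp add: pos_less_divide_eq flip: L_def)
qed

section \<open>Assembly of the three statements\<close>

lemma filterlim_ln_ln: "filterlim (\<lambda>N::nat. ln (ln (real N))) at_top at_top"
  by (intro filterlim_compose[OF ln_at_top] filterlim_real_sequentially)

theorem theorem1:
  shows "\<exists>c > 0. \<exists>C1 > 0.
     (\<exists>A. \<forall>\<^sub>F N in at_top. \<forall>k::real. 2 \<le> k \<and> k \<le> c * sqrt (ln (ln (real N))) \<longrightarrow>
          pseudomoment k N / (ln (real N)) powr (k\<^sup>2)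
            \<ge> exp (- k\<^sup>2 * ln k - k\<^sup>2 * ln (ln k) - A * k\<^sup>2))
   \<and> (\<exists>A. \<forall>\<^sub>F N in at_top. \<forall>k::real. 2 \<le> k \<and> k \<le> C1 * ln (real N) / ln (ln (real N)) \<longrightarrow>
          pseudomoment k N / (ln (real N)) powr (k\<^sup>2)
            \<le> exp (- k\<^sup>2 * ln k - k\<^sup>2 * ln (ln k) + A * k\<^sup>2))
   \<and> (\<forall>A::real. \<exists>C0. \<forall>C2 \<ge> C0. \<forall>\<^sub>F N in at_top.
          (let k = C2 * ln (real N) / ln (ln (real N)) in
            pseudomoment k N / (ln (real N)) powr (k\<^sup>2)
              > exp (- k\<^sup>2 * ln k - k\<^sup>2 * ln (ln k) + A * k\<^sup>2)))"
proof (rule exI[of _ 1], rule conjI, simp, rule exI[of _ 1], rule conjI, simp, intro conjI allI)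
  \<comment> \<open>With \<open>u = ln (ln N) >= 10\<close> one has
    \<open>5 * u <= u^2 / 2 <= exp u = ln N\<close>. Hence \<open>k <= sqrt u <= u\<close> lies well
    inside the range \<open>5 * k <= ln N\<close> of the lower bound.\<close>
  have ev: "\<forall>\<^sub>F N::nat in at_top. ln (ln (real N)) \<ge> 10"
    using filterlim_ln_ln by (simp add: filterlim_at_top)
  show "\<exists>A. \<forall>\<^sub>F N in at_top. \<forall>k::real. 2 \<le> k \<and> k \<le> 1 * sqrt (ln (ln (real N))) \<longrightarrow>
          pseudomoment k N / (ln (real N)) powr (k\<^sup>2) \<ge> exp (- k\<^sup>2 * ln k - k\<^sup>2 * ln (ln k) - A * k\<^sup>2)"
  proof (rule exI[of _ 19], rule eventually_mono[OF ev], intro allI impI)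
    fix N :: nat and k :: real
    assume l: "10 \<le> ln (ln (real N))" and k: "2 \<le> k \<and> k \<le> 1 * sqrt (ln (ln (real N)))"
    define u where "u = ln (ln (real N))"
    have u: "u \<ge> 10" using l by (simp add: u_def)
    have L: "ln (real N) > 0" and N: "N \<ge> 1" by (rule ln_nat_pos, use l in linarith)+
    have "sqrt u \<le> u" using u by (intro real_le_lsqrt) (auto simp: power2_eq_square)
    then have "5 * k \<le> 5 * u" using k by (simp add: u_def)
    also have "\<dots> \<le> 1 + u + u\<^sup>2 / 2"
      using u mult_right_mono[of 10 u u] unfolding power2_eq_square by linarith
    also have "\<dots> \<le> exp u" using exp_lower_Taylor_quadratic[of u] u by simp
    also have "exp u = ln (real N)" using L by (simp add: u_def)
    finally show "pseudomoment k N / (ln (real N)) powr (k\<^sup>2) \<ge> exp (- k\<^sup>2 * ln k - k\<^sup>2 * ln (ln k) - 19 * k\<^sup>2)"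
      using pseudomoment_lower[OF _ N, of k] k by simp
  qed
  show "\<exists>A. \<forall>\<^sub>F N in at_top. \<forall>k::real. 2 \<le> k \<and> k \<le> 1 * ln (real N) / ln (ln (real N)) \<longrightarrow>
          pseudomoment k N / (ln (real N)) powr (k\<^sup>2) \<le> exp (- k\<^sup>2 * ln k - k\<^sup>2 * ln (ln k) + A * k\<^sup>2)"
  proof (rule exI[of _ 245], rule eventually_mono[OF ev], intro allI impI)
    fix N :: nat and k :: real
    assume "10 \<le> ln (ln (real N))" "2 \<le> k \<and> k \<le> 1 * ln (real N) / ln (ln (real N))"
    then show "pseudomoment k N / (ln (real N)) powr (k\<^sup>2) \<le> exp (- k\<^sup>2 * ln k - k\<^sup>2 * ln (ln k) + 245 * k\<^sup>2)"
      by (intro pseudomoment_upper) auto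
  qed
  show "\<exists>C0. \<forall>C2\<ge>C0. \<forall>\<^sub>F N in at_top.
          (let k = C2 * ln (real N) / ln (ln (real N)) in
            pseudomoment k N / (ln (real N)) powr (k\<^sup>2)
              > exp (- k\<^sup>2 * ln k - k\<^sup>2 * ln (ln k) + A * k\<^sup>2))" for A :: real
  proof (rule exI[of _ "max 1 (exp (A + 2))"], intro allI impI, rule eventually_mono[OF ev])
    fix C2 :: real and N :: nat
    assume "max 1 (exp (A + 2)) \<le> C2" "10 \<le> ln (ln (real N))"
    then show "let k = C2 * ln (real N) / ln (ln (real N)) in
            pseudomoment k N / (ln (real N)) powr (k\<^sup>2) > exp (- k\<^sup>2 * ln k - k\<^sup>2 * ln (ln k) + A * k\<^sup>2)"
      unfolding Let_def by (intro pseudomoment_large[OF _ _ refl]) auto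
  qed
qed

end
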